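(* Let $I\subset\mathbb{R}$ be an open bounded interval, $U\subset\mathbb{R}^2$ an open set with $[0,1]^2\subset U$, and $\Phi\in C^2(I\times U)$ a real-valued function; write $\Phi_\alpha(x)=\Phi(\alpha,x)$. Assume there is a constant $C_0\ge 1$ such that for all $\alpha\in I$ and $x\in U$: (1) $C_0^{-1}\le |\nabla\Phi_\alpha(x)|\le C_0$; (2) $|\partial_i\partial_j\Phi_\alpha(x)|\le C_0$ for all $i,j\in\{1,2\}$; (3) $C_0^{-1}\le\left|\det\begin{pmatrix}\partial_1\Phi_\alpha(x)&\partial_\alpha\partial_1\Phi_\alpha(x)\\ \partial_2\Phi_\alpha(x)&\partial_\alpha\partial_2\Phi_\alpha(x)\end{pmatrix}\right|\le C_0$. Let $L\ge2$ and let $S_n$ be the random sets constructed in the context from a uniform probability distribution $\chi$. Then there is a constant $C$ depending only on $\Phi$, $I$ and $L$ such that for all $n$ $$\mathbb{E}[\mathrm{Fav}_\Phi(S_n)]\le C\,\mathbb{E}[\mathrm{Fav}(S_{\lfloor n/2\rfloor})].$$ In particular, the known upper bounds for $\mathbb{E}[\mathrm{Fav}(S_n)]$ recalled in the context hold with $\mathrm{Fav}_\Phi$ in place of $\mathrm{Fav}$: $\mathbb{E}[\mathrm{Fav}_\Phi(S_n)]\lesssim \frac1n$ if $\chi$ is non-degenerate, and $\mathbb{E}[\mathrm{Fav}_\Phi(S_n)]\lesssim\frac{\log n}{n}$ (for $n\ge2$) if $\chi$ is degenerate, with implicit constants independent of $n$.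
   Context: Random construction: fix $L\ge 2$. For each $n$ divide $[0,1]^2$ into an $L^n\times L^n$ grid of squares and let $\mathcal{D}_n$ be the resulting set of (closed) squares of side $L^{-n}$. Let $\chi$ be a probability distribution on $\binom{\mathcal{D}_1}{L}$, the set of $L$-element subsets of $\mathcal{D}_1$. Put $S_0=[0,1]^2$. Choose $L$ squares of $\mathcal D_1$ at random according to $\chi$; $S_1$ is their union. Given $S_n$, a union of $L^n$ chosen squares of $\mathcal{D}_n$, repeat the selection (rescaled and translated) independently in each of the chosen squares, using the same $\chi$, to obtain $L^{n+1}$ squares of $\mathcal{D}_{n+1}$ whose union is $S_{n+1}\subset S_n$. $\chi$ is vertically degenerate if it selects one square in each column almost surely, horizontally degenerate if it selects one square in each row almost surely, degenerate if it is vertically or horizontally degenerate, and non-degenerate otherwise. $\chi$ is uniform if every square of the initial $L\times L$ grid is chosen for $S_1$ with probability $1/L$. Favard lengths: $\mathrm{Fav}_\Phi(F)=\int_I|\Phi_\alpha(F)|\,d\alpha$ for $F\subset U$, and $\mathrm{Fav}(F)=\int_0^\pi|\pi_\theta(F)|\,d\theta$ with $\pi_\theta(x)=x_1\cos\theta+x_2\sin\theta$; $|\cdot|$ of a subset of $\mathbb{R}$ is Lebesgue measure. $\nabla,\partial_1,\partial_2$ are derivatives in $x$. Known result from the literature (Chang–Shmerkin–Suomala): for uniform $\chi$, $\mathbb{E}[\mathrm{Fav}(S_n)]\approx 1/n$ if $\chi$ is non-degenerate and $\mathbb{E}[\mathrm{Fav}(S_n)]\approx \log(n)/n$ if $\chi$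 is degenerate, where $\approx$ means two-sided bounds up to constants independent of $n$. *)

theory Defs
  imports "HOL-Analysis.Analysis" "HOL-Probability.Probability"
begin

text \<open>
  A square of side \<open>L\<^sup>-\<^sup>n\<close> is encoded by its pair \<open>(i, j)\<close> of column and row indices, so that
  \<open>grid L n\<close> encodes the partition of the unit square into \<open>L\<^sup>n \<times> L\<^sup>n\<close> squares and
  \<open>grid_square L n\<close> decodes an index pair into a closed square.
  The selection law is called \<open>\<mu>\<close>, since HOL-Analysis reserves the letter chi as a binder.
\<close>

definition grid :: "nat \<Rightarrow> nat \<Rightarrow> (nat \<times> nat) set" where
  "grid L n = {..<L ^ n} \<times> {..<L ^ n}"

definition grid_square :: "nat \<Rightarrow> nat \<Rightarrow> nat \<times> nat \<Rightarrow> (real \<times> real) set" where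
  "grid_square L n q =
     {real (fst q) / real L ^ n .. real (fst q + 1) / real L ^ n} \<times>
     {real (snd q) / real L ^ n .. real (snd q + 1) / real L ^ n}"

definition selection :: "nat \<Rightarrow> (nat \<times> nat) set pmf \<Rightarrow> bool" where
  "selection L \<mu> \<longleftrightarrow> set_pmf \<mu> \<subseteq> {A. A \<subseteq> grid L 1 \<and> card A = L}"

definition uniform_selection :: "nat \<Rightarrow> (nat \<times> nat) set pmf \<Rightarrow> bool" where
  "uniform_selection L \<mu> \<longleftrightarrow>
     selection L \<mu> \<and> (\<forall>q\<in>grid L 1. measure_pmf.prob \<mu> {A. q \<in> A} = 1 / real L)"

definition vertically_degenerate :: "nat \<Rightarrow> (nat \<times> nat) set pmf \<Rightarrow> bool" where
  "vertically_degenerate L \<mu> \<longleftrightarrow> (AE A in measure_pmf \<mu>. \<forall>i<L. \<exists>!j. (i, j) \<in> A)"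

definition horizontally_degenerate :: "nat \<Rightarrow> (nat \<times> nat) set pmf \<Rightarrow> bool" where
  "horizontally_degenerate L \<mu> \<longleftrightarrow> (AE A in measure_pmf \<mu>. \<forall>j<L. \<exists>!i. (i, j) \<in> A)"

definition degenerate :: "nat \<Rightarrow> (nat \<times> nat) set pmf \<Rightarrow> bool" where
  "degenerate L \<mu> \<longleftrightarrow> vertically_degenerate L \<mu> \<or> horizontally_degenerate L \<mu>"

text \<open>
  \<open>subsquare L q d\<close> is the generation \<open>n + 1\<close> index of the square occupying, inside the
  generation \<open>n\<close> square \<open>q\<close>, the rescaled and translated position of \<open>d \<in> grid L 1\<close>.
\<close>

definition subsquare :: "nat \<Rightarrow> nat \<times> nat \<Rightarrow> nat \<times> nat \<Rightarrow> nat \<times> nat" where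
  "subsquare L q d = (L * fst q + fst d, L * snd q + snd d)"

text \<open>
  The law of the set of chosen squares of generation \<open>n\<close>. Given the chosen squares \<open>A\<close> of one
  generation, \<open>Pi_pmf A {} (\<lambda>_. \<mu>)\<close> makes an independent \<open>\<mu>\<close>-distributed selection for each
  \<open>q \<in> A\<close>; the set \<open>{}\<close> is only the dummy value taken outside \<open>A\<close>.
  Only the law of each single generation enters the expectations considered here.
\<close>

primrec chosen_squares :: "nat \<Rightarrow> (nat \<times> nat) set pmf \<Rightarrow> nat \<Rightarrow> (nat \<times> nat) set pmf" where
  "chosen_squares L \<mu> 0 = return_pmf {(0, 0)}"
| "chosen_squares L \<mu> (Suc n) =
     bind_pmf (chosen_squares L \<mu> n)
       (\<lambda>A. map_pmf (\<lambda>sel. \<Union>q\<in>A. subsquare L q ` sel q) (Pi_pmf A {} (\<lambda>_. \<mu>)))"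

definition random_set :: "nat \<Rightarrow> (nat \<times> nat) set pmf \<Rightarrow> nat \<Rightarrow> (real \<times> real) set pmf" where
  "random_set L \<mu> n = map_pmf (\<lambda>A. \<Union>q\<in>A. grid_square L n q) (chosen_squares L \<mu> n)"

definition family_favard ::
  "real set \<Rightarrow> (real \<Rightarrow> real \<times> real \<Rightarrow> real) \<Rightarrow> (real \<times> real) set \<Rightarrow> ennreal" where
  "family_favard I \<Phi> F = (\<integral>\<^sup>+\<alpha>\<in>I. emeasure lebesgue (\<Phi> \<alpha> ` F) \<partial>lebesgue)"

definition orth_proj :: "real \<Rightarrow> real \<times> real \<Rightarrow> real" where
  "orth_proj \<theta> x = fst x * cos \<theta> + snd x * sin \<theta>"

definition favard :: "(real \<times> real) set \<Rightarrow> ennreal" where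
  "favard F = (\<integral>\<^sup>+\<theta>\<in>{0..pi}. emeasure lebesgue (orth_proj \<theta> ` F) \<partial>lebesgue)"

definition expectation_of :: "(real \<times> real) set pmf \<Rightarrow> ((real \<times> real) set \<Rightarrow> ennreal) \<Rightarrow> ennreal"
  where "expectation_of p g = (\<integral>\<^sup>+S. g S \<partial>measure_pmf p)"

definition partial :: "'a::real_normed_vector \<Rightarrow> ('a \<Rightarrow> real) \<Rightarrow> 'a \<Rightarrow> real" where
  "partial e f x = deriv (\<lambda>t. f (x + t *\<^sub>R e)) 0"

text \<open>
  \<open>f\<close> is of class \<open>C\<^sup>k\<close> on the open set \<open>D\<close>: all iterated partial derivatives of order at most \<open>k\<close>
  exist and are continuous on \<open>D\<close>. The differentiability clause is needed since \<open>deriv\<close> is total.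
\<close>

primrec C_diff :: "nat \<Rightarrow> 'a::euclidean_space set \<Rightarrow> ('a \<Rightarrow> real) \<Rightarrow> bool" where
  "C_diff 0 D f \<longleftrightarrow> continuous_on D f"
| "C_diff (Suc k) D f \<longleftrightarrow> continuous_on D f \<and>
     (\<forall>e\<in>Basis. (\<forall>x\<in>D. (\<lambda>t. f (x + t *\<^sub>R e)) differentiable at 0) \<and> C_diff k D (partial e f))"

abbreviation pd1 :: "(real \<times> real \<Rightarrow> real) \<Rightarrow> real \<times> real \<Rightarrow> real" where
  "pd1 \<equiv> partial (1, 0)"

abbreviation pd2 :: "(real \<times> real \<Rightarrow> real) \<Rightarrow> real \<times> real \<Rightarrow> real" where
  "pd2 \<equiv> partial (0, 1)"

definition grad :: "(real \<times> real \<Rightarrow> real) \<Rightarrow> real \<times> real \<Rightarrow> real \<times> real" where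
  "grad g x = (pd1 g x, pd2 g x)"

definition mixed_det :: "(real \<Rightarrow> real \<times> real \<Rightarrow> real) \<Rightarrow> real \<Rightarrow> real \<times> real \<Rightarrow> real" where
  "mixed_det \<Phi> \<alpha> x = det (vector
     [vector [pd1 (\<Phi> \<alpha>) x, deriv (\<lambda>\<beta>. pd1 (\<Phi> \<beta>) x) \<alpha>],
      vector [pd2 (\<Phi> \<alpha>) x, deriv (\<lambda>\<beta>. pd2 (\<Phi> \<beta>) x) \<alpha>]] :: real^2^2)"

end

theory Submission
  imports Defs
begin

text \<open>
  Put \<open>k = n div 2\<close> and \<open>m = n - k\<close>. The part of \<open>S\<^sub>n\<close> in a chosen square of side \<open>L\<^sup>-\<^sup>m\<close> is a scaled copy
  of \<open>S\<^sub>k\<close>, and \<open>\<Phi>\<^sub>\<alpha>\<close> is affine on that square up to an error comparable with \<open>L\<^sup>-\<^sup>n\<close>, which costs only a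
  constant factor. Each square is chosen with probability \<open>L\<^sup>-\<^sup>m\<close>, and by the determinant condition the
  direction of the gradient moves with speed bounded above and below as \<open>\<alpha>\<close> varies, so the integral
  over \<open>\<alpha>\<close> is dominated by the ordinary Favard length of \<open>S\<^sub>k\<close>.

  For the bounds on the Favard length fix a slope. The probability that a line meets \<open>S\<^sub>n\<close> is an
  iterate of a monotone operator \<open>T\<close>, and \<open>T f\<close> is at most the mean \<open>P f\<close> of \<open>f\<close> over the subsquares minus
  a quadratic gain where the line meets two selected squares with positive probability. The chord
  length \<open>h\<close> satisfies \<open>P h = h\<close>, and \<open>A\<^sub>n h + A\<^sub>n\<^sup>2 w\<close> with \<open>A\<^sub>n\<close> of order \<open>1 / n\<close> and a corrector \<open>w\<close> is a
  supersolution. A line with horizontal slope \<open>\<phi>\<close> crosses column boundaries with frequency \<open>\<phi>\<close>, and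
  unless \<open>1 / \<phi>\<close> is close to a rational with small denominator these crossings are equidistributed and
  make the line branch at rate \<open>\<phi>\<close>; integrating \<open>1 / (\<phi> n)\<close> produces the logarithm. If two squares of
  one column are selected with positive probability, steep lines branch at a rate independent of \<open>\<phi>\<close>.
\<close>

section \<open>Generations of chosen squares\<close>

text \<open>Independence makes the probability of avoiding a line multiplicative over squares, so
  the hitting probability is an exact iterate and one pointwise inequality suffices. Two obstacles
  shape it. Branching occurs only at special positions of the line, so the corrector has to wait
  until the descendants are spread out; and the waiting time is not bounded uniformly in the slope.
  Slopes for which k generations are too few have measure decaying exponentially in k, hence the
  waiting time has a finite integral and costs only a constant. The amplitude is of order 1/n
  because a quadratic loss leads to a recursion like a' = a - s a^2. The supersolution starts well
  below 1, so it is applied to a reduced initial function, and shifts recover the full squares. The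
  generation is halved because the second order Taylor term on a square of side L^-m is of size
  L^-(2m), which is within the resolution L^-n once m is at least n/2. In the logarithmic bound
  slopes below 1/n are left to the trivial bound, so the integral starts there.\<close>

definition idx :: "nat \<times> nat \<Rightarrow> real \<times> real" where
  "idx q = (real (fst q), real (snd q))"

text \<open>
  If \<open>f s\<close> is the probability that the line \<open>v \<bullet> x = s\<close> meets a random subset of the unit square, then
  \<open>hit_step L \<mu> v f t\<close> is the probability that the line \<open>v \<bullet> x = t\<close> meets the union of independent
  rescaled copies of that subset, one in each first generation square selected by \<open>\<mu>\<close>.
\<close>

definition hit_step ::
  "nat \<Rightarrow> (nat \<times> nat) set pmf \<Rightarrow> real \<times> real \<Rightarrow> (real \<Rightarrow> real) \<Rightarrow> real \<Rightarrow> real" where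
  "hit_step L \<mu> v f t =
     (\<Sum>A\<in>Pow (grid L 1). pmf \<mu> A * (1 - (\<Prod>d\<in>A. 1 - f (real L * t - v \<bullet> idx d))))"

lemma finite_grid [simp]: "finite (grid L n)"
  by (simp add: grid_def)

lemma card_grid: "card (grid L n) = L ^ n * L ^ n"
  by (simp add: grid_def card_cartesian_product)

lemma grid_0 [simp]: "grid L 0 = {(0, 0)}"
  by (auto simp: grid_def)

lemma selectionD:
  assumes "selection L \<mu>" "A \<in> set_pmf \<mu>"
  shows "A \<subseteq> grid L 1" "card A = L"
  using assms by (auto simp: selection_def)

lemma selection_imp_finite: "selection L \<mu> \<Longrightarrow> A \<in> set_pmf \<mu> \<Longrightarrow> finite A"
  by (meson selectionD(1) finite_grid finite_subset)

lemma finite_set_pmf_selection: "selection L \<mu> \<Longrightarrow> finite (set_pmf \<mu>)"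
  by (meson PowI finite_Pow_iff finite_grid finite_subset selectionD(1) subsetI)

lemma uniform_imp_selection: "uniform_selection L \<mu> \<Longrightarrow> selection L \<mu>"
  by (simp add: uniform_selection_def)

lemma expectation_selection:
  fixes g :: "(nat \<times> nat) set \<Rightarrow> real"
  assumes "selection L \<mu>"
  shows "measure_pmf.expectation \<mu> g = (\<Sum>A\<in>Pow (grid L 1). pmf \<mu> A * g A)"
  by (subst integral_measure_pmf_real[of "Pow (grid L 1)"])
     (use selectionD(1)[OF assms] in \<open>simp_all add: mult.commute\<close>)

lemma sum_pmf_selection: "selection L \<mu> \<Longrightarrow> (\<Sum>A\<in>Pow (grid L 1). pmf \<mu> A) = 1"
  using expectation_selection[of L \<mu> "\<lambda>_. 1"] by simp

lemma hit_step_eq_expectation: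
  assumes "selection L \<mu>"
  shows "hit_step L \<mu> v f t =
    measure_pmf.expectation \<mu> (\<lambda>A. 1 - (\<Prod>d\<in>A. 1 - f (real L * t - v \<bullet> idx d)))"
  using expectation_selection[OF assms] by (simp add: hit_step_def)

text \<open>The transition from one generation to the next, kept separate so that one can condition
  on the squares \<open>A\<close> already chosen.\<close>

definition refine :: "nat \<Rightarrow> (nat \<times> nat) set pmf \<Rightarrow> (nat \<times> nat) set \<Rightarrow> (nat \<times> nat) set pmf" where
  "refine L \<mu> A = map_pmf (\<lambda>sel. \<Union>q\<in>A. subsquare L q ` sel q) (Pi_pmf A {} (\<lambda>_. \<mu>))"

lemma chosen_squares_Suc: "chosen_squares L \<mu> (Suc n) = bind_pmf (chosen_squares L \<mu> n) (refine L \<mu>)"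
  by (simp add: refine_def [abs_def])

lemma refine_empty [simp]: "refine L \<mu> {} = return_pmf {}"
  by (simp add: refine_def)

lemma subsquare_in_grid:
  assumes "q \<in> grid L n" "d \<in> grid L 1"
  shows "subsquare L q d \<in> grid L (Suc n)"
proof -
  have *: "L * a + b < L ^ Suc n" if "a < L ^ n" "b < L" for a b
  proof -
    have "L * a + b < L * (a + 1)" using that by simp
    also have "\<dots> \<le> L * L ^ n" using that by (intro mult_left_mono) auto
    finally show ?thesis by simp
  qed
  have "fst q < L ^ n" "snd q < L ^ n" "fst d < L" "snd d < L" using assms by (auto simp: grid_def)
  then show ?thesis using * by (simp add: grid_def subsquare_def mem_Times_iff)
qed

text \<open>Uniqueness of the base \<open>L\<close> digits of the column and row indices.\<close>

lemma subsquare_eq_iff: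
  assumes "d \<in> grid L 1" "d' \<in> grid L 1"
  shows "subsquare L q d = subsquare L q' d' \<longleftrightarrow> q = q' \<and> d = d'"
proof -
  have *: "a = a' \<and> b = b'" if "L * a + b = L * a' + b'" "b < L" "b' < L" for a a' b b' :: nat
  proof -
    have "(L * a + b) div L = a" "(L * a' + b') div L = a'" using that(2,3) by auto
    then have "a = a'" using that(1) by metis
    then show ?thesis using that(1) by simp
  qed
  have d: "fst d < L" "fst d' < L" "snd d < L" "snd d' < L" using assms by (auto simp: grid_def)
  show ?thesis
  proof
    assume "subsquare L q d = subsquare L q' d'"
    then have "L * fst q + fst d = L * fst q' + fst d'" "L * snd q + snd d = L * snd q' + snd d'"
      by (simp_all add: subsquare_def)
    from *[OF this(1) d(1,2)] *[OF this(2) d(3,4)] show "q = q' \<and> d = d'"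
      by (simp add: prod_eq_iff)
  qed simp
qed

lemma Pi_pmf_selection:
  assumes "selection L \<mu>" "finite A" "sel \<in> set_pmf (Pi_pmf A {} (\<lambda>_. \<mu>))" "q \<in> A"
  shows "sel q \<in> set_pmf \<mu>"
  using assms by (auto simp: set_Pi_pmf PiE_dflt_def)

lemma chosen_squares_subset:
  assumes "selection L \<mu>" "A \<in> set_pmf (chosen_squares L \<mu> n)"
  shows "A \<subseteq> grid L n"
  using assms(2)
proof (induction n arbitrary: A)
  case (Suc n)
  then obtain B sel where B: "B \<in> set_pmf (chosen_squares L \<mu> n)"
    and sel: "sel \<in> set_pmf (Pi_pmf B {} (\<lambda>_. \<mu>))" and A: "A = (\<Union>q\<in>B. subsquare L q ` sel q)"
    by auto
  have Bg: "B \<subseteq> grid L n" by (rule Suc.IH[OF B])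
  then have "finite B" by (rule finite_subset) simp
  then have "sel q \<subseteq> grid L 1" if "q \<in> B" for q
    using Pi_pmf_selection[OF assms(1) _ sel that] selectionD[OF assms(1)] by auto
  then show ?case using Bg subsquare_in_grid unfolding A by blast
qed auto

lemma finite_chosen_squares:
  "selection L \<mu> \<Longrightarrow> A \<in> set_pmf (chosen_squares L \<mu> n) \<Longrightarrow> finite A"
  by (meson chosen_squares_subset finite_grid finite_subset)

lemma finite_set_pmf_chosen: "selection L \<mu> \<Longrightarrow> finite (set_pmf (chosen_squares L \<mu> n))"
  by (rule finite_subset[of _ "Pow (grid L n)"]) (auto dest: chosen_squares_subset)

lemma idx_subsquare: "idx (subsquare L q d) = real L *\<^sub>R idx q + idx d"
  by (simp add: idx_def subsquare_def)

lemma prod_one_minus_bounds: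
  fixes p :: "'a \<Rightarrow> real"
  assumes "\<And>d. d \<in> A \<Longrightarrow> 0 \<le> p d \<and> p d \<le> 1"
  shows "0 \<le> (\<Prod>d\<in>A. 1 - p d)" "(\<Prod>d\<in>A. 1 - p d) \<le> 1"
  using assms by (auto intro!: prod_nonneg prod_le_1)

lemma hit_step_bounds:
  assumes "selection L \<mu>" "\<And>t. 0 \<le> f t \<and> f t \<le> 1"
  shows "0 \<le> hit_step L \<mu> v f t \<and> hit_step L \<mu> v f t \<le> 1"
proof -
  have "hit_step L \<mu> v f t \<le> (\<Sum>A\<in>Pow (grid L 1). pmf \<mu> A * 1)"
    unfolding hit_step_def using assms(2)
    by (intro sum_mono mult_left_mono) (auto intro!: prod_one_minus_bounds)
  then show ?thesis using assms sum_pmf_selection[OF assms(1)]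
    by (auto simp: hit_step_def intro!: sum_nonneg mult_nonneg_nonneg prod_one_minus_bounds)
qed

lemma funpow_hit_step_bounds:
  assumes "selection L \<mu>" "\<And>t. 0 \<le> f t \<and> f t \<le> 1"
  shows "0 \<le> (hit_step L \<mu> v ^^ n) f t \<and> (hit_step L \<mu> v ^^ n) f t \<le> 1"
proof (induction n arbitrary: t)
  case (Suc n) then show ?case using hit_step_bounds[OF assms(1)] by simp
qed (use assms in simp)

text \<open>Reading \<open>f\<close> as the probability that a line meets the content of a unit
  square, both sides are the probability of avoiding the content of all squares. Children of
  different squares are different, so the product over the new generation splits over
  \<open>A\<close>; independence of the selections turns the expectation into a product of
  expectations, each of which is \<open>1 - hit_step\<close>.\<close>

lemma expectation_refine:
  assumes sel: "selection L \<mu>" and f: "\<And>t. 0 \<le> f t \<and> f t \<le> 1" and A: "finite A"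
  shows "measure_pmf.expectation (refine L \<mu> A) (\<lambda>B. \<Prod>q\<in>B. 1 - f (real L ^ Suc n * t - v \<bullet> idx q)) =
    (\<Prod>q\<in>A. 1 - hit_step L \<mu> v f (real L ^ n * t - v \<bullet> idx q))"
proof -
  let ?P = "Pi_pmf A {} (\<lambda>_. \<mu>)"
  \<comment> \<open>The factor contributed by the square \<open>q\<close> when its selection is
    \<open>B\<close>.\<close>
  define g where "g q B = (\<Prod>d\<in>B. 1 - f (real L * (real L ^ n * t - v \<bullet> idx q) - v \<bullet> idx d))" for q and B :: "(nat \<times> nat) set"
  have g: "(\<Prod>q\<in>(\<Union>q\<in>A. subsquare L q ` s q). 1 - f (real L ^ Suc n * t - v \<bullet> idx q)) = (\<Prod>q\<in>A. g q (s q))"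
    if "s \<in> set_pmf ?P" for s
  proof -
    have s: "s q \<subseteq> grid L 1" "finite (s q)" if "q \<in> A" for q
      using Pi_pmf_selection[OF sel A \<open>s \<in> _\<close> that] selectionD[OF sel] selection_imp_finite[OF sel] by auto
    have "(\<Prod>q\<in>(\<Union>q\<in>A. subsquare L q ` s q). 1 - f (real L ^ Suc n * t - v \<bullet> idx q)) =
      (\<Prod>q\<in>A. \<Prod>r\<in>subsquare L q ` s q. 1 - f (real L ^ Suc n * t - v \<bullet> idx r))"
    proof (rule prod.UNION_disjoint)
      show "\<forall>i\<in>A. \<forall>j\<in>A. i \<noteq> j \<longrightarrow> subsquare L i ` s i \<inter> subsquare L j ` s j = {}"
      proof (intro ballI impI equals0I)
        fix i j x assume ij: "i \<in> A" "j \<in> A" "i \<noteq> j" and "x \<in> subsquare L i ` s i \<inter> subsquare L j ` s j"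
        then obtain d d' where "d \<in> s i" "d' \<in> s j" "subsquare L i d = subsquare L j d'" by auto
        then show False using subsquare_eq_iff[of d L d' i j] s ij by blast
      qed
    qed (use A s in auto)
    also have "\<dots> = (\<Prod>q\<in>A. g q (s q))"
    proof (rule prod.cong)
      fix q assume q: "q \<in> A"
      have "inj_on (subsquare L q) (s q)"
      proof (rule inj_onI)
        fix x y assume "x \<in> s q" "y \<in> s q" "subsquare L q x = subsquare L q y"
        then show "x = y" using subsquare_eq_iff[of x L y q q] s(1)[OF q] by blast
      qed
      then show "(\<Prod>r\<in>subsquare L q ` s q. 1 - f (real L ^ Suc n * t - v \<bullet> idx r)) = g q (s q)"
        by (simp add: prod.reindex g_def idx_subsquare inner_add_right algebra_simps)
    qed simp
    finally show ?thesis .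
  qed
  have "measure_pmf.expectation (refine L \<mu> A) (\<lambda>B. \<Prod>q\<in>B. 1 - f (real L ^ Suc n * t - v \<bullet> idx q)) =
    measure_pmf.expectation ?P (\<lambda>s. \<Prod>q\<in>A. g q (s q))"
    unfolding refine_def integral_map_pmf
    by (rule integral_cong_AE) (auto simp: AE_measure_pmf_iff g simp del: power_Suc)
  also have "\<dots> = (\<Prod>q\<in>A. measure_pmf.expectation \<mu> (g q))"
    by (rule expectation_prod_Pi_pmf[OF A])
       (use f in \<open>auto intro!: integrable_measure_pmf_finite finite_set_pmf_selection[OF sel] prod_nonneg simp: g_def\<close>)
  also have "\<dots> = (\<Prod>q\<in>A. 1 - hit_step L \<mu> v f (real L ^ n * t - v \<bullet> idx q))"
    by (intro prod.cong)
       (simp_all add: hit_step_eq_expectation[OF sel] g_def [abs_def] Bochner_Integration.integral_diff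
          integrable_measure_pmf_finite[OF finite_set_pmf_selection[OF sel]])
  finally show ?thesis .
qed

text \<open>The last generation is integrated out first, which replaces \<open>f\<close> by
  \<open>hit_step L \<mu> v f\<close>; hence \<open>f\<close> is arbitrary in the induction.\<close>

lemma expectation_chosen_squares_prod:
  assumes sel: "selection L \<mu>" and f: "\<And>t. 0 \<le> f t \<and> f t \<le> 1"
  shows "measure_pmf.expectation (chosen_squares L \<mu> n) (\<lambda>A. \<Prod>q\<in>A. 1 - f (real L ^ n * t - v \<bullet> idx q)) =
    1 - (hit_step L \<mu> v ^^ n) f t"
  using f
proof (induction n arbitrary: f)
  case 0
  then show ?case by (simp add: idx_def zero_prod_def[symmetric])
next
  case (Suc n)
  let ?C = "set_pmf (chosen_squares L \<mu> n)"
  have fin: "finite ?C" by (rule finite_set_pmf_chosen[OF sel])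
  have fin2: "finite (set_pmf (refine L \<mu> A))" if "A \<in> ?C" for A
  proof (rule finite_subset)
    show "set_pmf (refine L \<mu> A) \<subseteq> set_pmf (chosen_squares L \<mu> (Suc n))"
      unfolding chosen_squares_Suc using that by auto
  qed (rule finite_set_pmf_chosen[OF sel])
  have "measure_pmf.expectation (chosen_squares L \<mu> (Suc n)) (\<lambda>A. \<Prod>q\<in>A. 1 - f (real L ^ Suc n * t - v \<bullet> idx q))
     = (\<Sum>A\<in>?C. pmf (chosen_squares L \<mu> n) A *\<^sub>R
          measure_pmf.expectation (refine L \<mu> A) (\<lambda>A. \<Prod>q\<in>A. 1 - f (real L ^ Suc n * t - v \<bullet> idx q)))"
    unfolding chosen_squares_Suc using fin fin2 by (intro pmf_expectation_bind) auto
  also have "\<dots> = (\<Sum>A\<in>?C. pmf (chosen_squares L \<mu> n) A *\<^sub>R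
      (\<Prod>q\<in>A. 1 - hit_step L \<mu> v f (real L ^ n * t - v \<bullet> idx q)))"
    by (intro sum.cong refl arg_cong2[where f = scaleR] expectation_refine[OF sel Suc.prems]
        finite_chosen_squares[OF sel])
  also have "\<dots> = measure_pmf.expectation (chosen_squares L \<mu> n)
      (\<lambda>A. \<Prod>q\<in>A. 1 - hit_step L \<mu> v f (real L ^ n * t - v \<bullet> idx q))"
    by (subst integral_measure_pmf_real[OF fin]) (auto simp: mult.commute)
  also have "\<dots> = 1 - (hit_step L \<mu> v ^^ n) (hit_step L \<mu> v f) t"
    by (rule Suc.IH) (rule hit_step_bounds[OF sel Suc.prems])
  finally show ?case by (simp add: funpow_swap1)
qed

section \<open>Restriction to a square of an earlier generation\<close>

definition restrict_to :: "nat \<Rightarrow> nat \<Rightarrow> nat \<times> nat \<Rightarrow> (nat \<times> nat) set \<Rightarrow> (nat \<times> nat) set" where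
  "restrict_to L k q A = {r \<in> grid L k. (L ^ k * fst q + fst r, L ^ k * snd q + snd r) \<in> A}"

lemma div_mod_in_grid:
  assumes "r \<in> grid L (Suc k)"
  shows "(fst r div L, snd r div L) \<in> grid L k" "(fst r mod L, snd r mod L) \<in> grid L 1"
    "r = subsquare L (fst r div L, snd r div L) (fst r mod L, snd r mod L)"
proof -
  from assms have "fst r < L ^ k * L" "snd r < L ^ k * L" by (auto simp: grid_def mult.commute)
  moreover from this have "L > 0" by (cases L) auto
  ultimately show "(fst r div L, snd r div L) \<in> grid L k" "(fst r mod L, snd r mod L) \<in> grid L 1"
    "r = subsquare L (fst r div L, snd r div L) (fst r mod L, snd r mod L)"
    by (auto simp: grid_def subsquare_def less_mult_imp_div_less)
qed

text \<open>Selections are independent, so those made outside the square \<open>q\<close> can be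
  integrated out of the product law (\<open>Pi_pmf_subset\<close>), and the remaining ones are
  relabelled by the shift \<open>e\<close>.\<close>

lemma restrict_to_refine:
  assumes sel: "selection L \<mu>" and A: "finite A"
  shows "map_pmf (restrict_to L (Suc k) q) (refine L \<mu> A) = refine L \<mu> (restrict_to L k q A)"
proof -
  define e where "e r = (L ^ k * fst q + fst r, L ^ k * snd q + snd r)" for r :: "nat \<times> nat"
  define B where "B = restrict_to L k q A"
  have inj: "inj e" by (rule injI) (auto simp: e_def prod_eq_iff)
  have e: "(L ^ Suc k * fst q + fst (subsquare L r d), L ^ Suc k * snd q + snd (subsquare L r d))
      = subsquare L (e r) d" for r d
    by (simp add: e_def subsquare_def algebra_simps)
  have B: "r \<in> B \<longleftrightarrow> r \<in> grid L k \<and> e r \<in> A" for r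
    by (simp add: B_def restrict_to_def e_def)
  have BA: "e ` B \<subseteq> A" by (auto simp: B)
  have fB: "finite B" by (rule finite_subset[of _ "grid L k"]) (auto simp: B)
  have "refine L \<mu> B = map_pmf (\<lambda>s. \<Union>q\<in>B. subsquare L q ` s q) (map_pmf (\<lambda>g. g \<circ> e) (Pi_pmf (e ` B) {} (\<lambda>_. \<mu>)))"
    unfolding refine_def
    by (subst Pi_pmf_bij_betw[OF fB, of e "e ` B"]) (use inj in \<open>auto simp: bij_betw_def inj_on_def\<close>)
  also have "\<dots> = map_pmf (\<lambda>s. \<Union>r\<in>B. subsquare L r ` s (e r)) (Pi_pmf A {} (\<lambda>_. \<mu>))"
    by (subst Pi_pmf_subset[OF A BA]) (auto simp: pmf.map_comp o_def intro!: map_pmf_cong)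
  also have "\<dots> = map_pmf (restrict_to L (Suc k) q) (refine L \<mu> A)"
    unfolding refine_def pmf.map_comp o_def
  proof (rule map_pmf_cong[OF refl])
    fix s assume s: "s \<in> set_pmf (Pi_pmf A {} (\<lambda>_. \<mu>))"
    have sg: "s p \<subseteq> grid L 1" if "p \<in> A" for p
      using Pi_pmf_selection[OF sel A s that] selectionD[OF sel] by auto
    show "(\<Union>r\<in>B. subsquare L r ` s (e r)) = restrict_to L (Suc k) q (\<Union>p\<in>A. subsquare L p ` s p)"
    proof (intro set_eqI iffI)
      fix x assume "x \<in> (\<Union>r\<in>B. subsquare L r ` s (e r))"
      then obtain r d where r: "r \<in> grid L k" "e r \<in> A" and d: "d \<in> s (e r)" and x: "x = subsquare L r d"
        using B by auto
      have "x \<in> grid L (Suc k)" unfolding x by (intro subsquare_in_grid r(1) subsetD[OF sg[OF r(2)] d])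
      moreover have "subsquare L (e r) d \<in> (\<Union>p\<in>A. subsquare L p ` s p)"
        by (intro UN_I[of "e r"] imageI r(2) d)
      ultimately show "x \<in> restrict_to L (Suc k) q (\<Union>p\<in>A. subsquare L p ` s p)"
        unfolding restrict_to_def x mem_Collect_eq e by (rule conjI)
    next
      fix x assume x: "x \<in> restrict_to L (Suc k) q (\<Union>p\<in>A. subsquare L p ` s p)"
      define r d where "r = (fst x div L, snd x div L)" and "d = (fst x mod L, snd x mod L)"
      have xg: "x \<in> grid L (Suc k)" using x by (simp add: restrict_to_def)
      note dm = div_mod_in_grid[OF xg, folded r_def d_def]
      have "subsquare L (e r) d \<in> (\<Union>p\<in>A. subsquare L p ` s p)"
        using x unfolding restrict_to_def e[symmetric] dm(3)[symmetric] by auto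
      then obtain p d' where p: "p \<in> A" "d' \<in> s p" "subsquare L (e r) d = subsquare L p d'" by auto
      with subsquare_eq_iff[OF dm(2), of d' "e r" p] sg[OF p(1)] have pd: "p = e r" "d = d'" by auto
      show "x \<in> (\<Union>r\<in>B. subsquare L r ` s (e r))"
        using p dm(1) pd B by (subst dm(3)) (intro UN_I[of r] imageI, auto)
    qed
  qed
  finally show ?thesis by (simp add: B_def)
qed

text \<open>The branching property: inside a chosen square of generation \<open>m\<close> the later
  generations have the law of the whole construction, and inside any other square they are
  empty.\<close>

lemma restrict_to_chosen_squares:
  assumes sel: "selection L \<mu>"
  shows "map_pmf (restrict_to L k q) (chosen_squares L \<mu> (m + k)) =
    bind_pmf (chosen_squares L \<mu> m) (\<lambda>A. if q \<in> A then chosen_squares L \<mu> k else return_pmf {})"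
proof (induction k)
  case 0
  have "restrict_to L 0 q A = (if q \<in> A then {(0, 0)} else {})" for A
    by (auto simp: restrict_to_def)
  then show ?case by (auto simp: map_pmf_def intro!: bind_pmf_cong)
next
  case (Suc k)
  have "map_pmf (restrict_to L (Suc k) q) (chosen_squares L \<mu> (m + Suc k)) =
    bind_pmf (chosen_squares L \<mu> (m + k)) (\<lambda>A. refine L \<mu> (restrict_to L k q A))"
    unfolding add_Suc_right chosen_squares_Suc map_bind_pmf
    by (intro bind_pmf_cong refl restrict_to_refine[OF sel] finite_chosen_squares[OF sel])
  also have "\<dots> = bind_pmf (map_pmf (restrict_to L k q) (chosen_squares L \<mu> (m + k))) (refine L \<mu>)"
    by (simp add: bind_map_pmf)
  also have "\<dots> = bind_pmf (chosen_squares L \<mu> m)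
      (\<lambda>A. if q \<in> A then chosen_squares L \<mu> (Suc k) else return_pmf {})"
    unfolding Suc.IH bind_assoc_pmf chosen_squares_Suc
    by (intro bind_pmf_cong refl) (simp add: bind_return_pmf)
  finally show ?case .
qed

lemma chosen_squares_1:
  assumes "selection L \<mu>"
  shows "chosen_squares L \<mu> (Suc 0) = \<mu>"
proof -
  have "subsquare L (0, 0) d = d" for d by (simp add: subsquare_def)
  then show ?thesis
    by (simp add: bind_return_pmf Pi_pmf_singleton pmf.map_comp o_def image_def)
qed

lemma emeasure_chosen_squares:
  assumes u: "uniform_selection L \<mu>" and "q \<in> grid L m"
  shows "emeasure (measure_pmf (chosen_squares L \<mu> m)) {A. q \<in> A} = ennreal (1 / real L ^ m)"
  using assms(2)
proof (induction m arbitrary: q)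
  case (Suc m)
  note sel = uniform_imp_selection[OF u]
  define r d where "r = (fst q div L, snd q div L)" and "d = (fst q mod L, snd q mod L)"
  note dm = div_mod_in_grid[OF Suc.prems, folded r_def d_def]
  \<comment> \<open>After restriction to the parent square \<open>r\<close> only the last pair of
    digits \<open>d\<close> is left, which is governed by \<open>\<mu>\<close> alone.\<close>
  have "{A. q \<in> A} = restrict_to L 1 r -` {B. d \<in> B}"
    using dm(2) by (subst dm(3)) (auto simp: restrict_to_def subsquare_def)
  then have "emeasure (measure_pmf (chosen_squares L \<mu> (Suc m))) {A. q \<in> A} =
      emeasure (measure_pmf (map_pmf (restrict_to L 1 r) (chosen_squares L \<mu> (m + 1)))) {B. d \<in> B}"
    by simp
  also have "\<dots> = (\<integral>\<^sup>+A. emeasure (measure_pmf (if r \<in> A then \<mu> else return_pmf {})) {B. d \<in> B}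
      \<partial>measure_pmf (chosen_squares L \<mu> m))"
    unfolding restrict_to_chosen_squares[OF sel] emeasure_bind_pmf
    by (intro nn_integral_cong) (use chosen_squares_1[OF sel] in auto)
  also have "\<dots> = (\<integral>\<^sup>+A. ennreal (1 / L) * indicator {A. r \<in> A} A \<partial>measure_pmf (chosen_squares L \<mu> m))"
    using u dm(2) by (intro nn_integral_cong)
      (auto simp: uniform_selection_def measure_pmf.emeasure_eq_measure)
  also have "\<dots> = ennreal (1 / L) * ennreal (1 / real L ^ m)"
    using Suc.IH[OF dm(1)] by (simp add: nn_integral_cmult)
  finally show ?case by (simp add: ennreal_mult[symmetric])
qed auto

text \<open>The premise on \<open>{}\<close> discards the event that \<open>q\<close> is not chosen;
  the factor is the probability that it is.\<close>

lemma nn_integral_restrict_to: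
  assumes u: "uniform_selection L \<mu>" and "q \<in> grid L m" and "\<psi> {} = 0"
  shows "(\<integral>\<^sup>+A. \<psi> (restrict_to L k q A) \<partial>measure_pmf (chosen_squares L \<mu> (m + k))) =
    ennreal (1 / real L ^ m) * (\<integral>\<^sup>+B. \<psi> B \<partial>measure_pmf (chosen_squares L \<mu> k))"
proof -
  note sel = uniform_imp_selection[OF u]
  define E where "E = (\<integral>\<^sup>+B. \<psi> B \<partial>measure_pmf (chosen_squares L \<mu> k))"
  have "(\<integral>\<^sup>+A. \<psi> (restrict_to L k q A) \<partial>measure_pmf (chosen_squares L \<mu> (m + k))) =
    (\<integral>\<^sup>+B. \<psi> B \<partial>measure_pmf (map_pmf (restrict_to L k q) (chosen_squares L \<mu> (m + k))))"
    by simp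
  also have "\<dots> = (\<integral>\<^sup>+A. E * indicator {A. q \<in> A} A \<partial>measure_pmf (chosen_squares L \<mu> m))"
    unfolding restrict_to_chosen_squares[OF sel] nn_integral_bind_pmf
    by (intro nn_integral_cong) (auto simp: E_def assms(3))
  also have "\<dots> = E * ennreal (1 / real L ^ m)"
    using emeasure_chosen_squares[OF assms(1,2)] by (simp add: nn_integral_cmult)
  finally show ?thesis by (simp add: E_def mult.commute)
qed

section \<open>Shadows and their symmetries\<close>

definition low_end :: "real \<times> real \<Rightarrow> real" where
  "low_end v = min 0 (fst v) + min 0 (snd v)"

definition high_end :: "real \<times> real \<Rightarrow> real" where
  "high_end v = max 0 (fst v) + max 0 (snd v)"

definition proj_interval :: "real \<times> real \<Rightarrow> real set" where
  "proj_interval v = {low_end v..high_end v}"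

lemma low_end_le_high_end: "low_end v \<le> high_end v"
  by (auto simp: low_end_def high_end_def)

lemma high_end_minus_low_end: "high_end v - low_end v = \<bar>fst v\<bar> + \<bar>snd v\<bar>"
  by (auto simp: low_end_def high_end_def min_def max_def)

lemma image_unit_square: "(\<bullet>) v ` ({0..1} \<times> {0..1}) = proj_interval v"
proof (intro equalityI subsetI)
  fix t assume "t \<in> (\<bullet>) v ` ({0..1} \<times> {0..1})"
  then obtain x y where xy: "0 \<le> x" "x \<le> 1" "0 \<le> y" "y \<le> 1" and t: "t = fst v * x + snd v * y"
    by (auto simp: inner_prod_def)
  have *: "min 0 a \<le> a * z \<and> a * z \<le> max 0 a" if "0 \<le> z" "z \<le> 1" for a z :: real
  proof (cases "a \<ge> 0")
    case True then show ?thesis using that by (auto simp: mult_left_le)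
  next
    case False
    then have "a * z \<le> 0" "a * 1 \<le> a * z" using that by (auto simp: mult_nonpos_nonneg intro!: mult_left_mono_neg)
    then show ?thesis using False by auto
  qed
  show "t \<in> proj_interval v" using *[of x "fst v"] *[of y "snd v"] xy
    by (auto simp: t proj_interval_def low_end_def high_end_def)
next
  fix t assume t: "t \<in> proj_interval v"
  \<comment> \<open>Corners of the unit square at which \<open>v \<bullet> x\<close> is smallest and
    largest; the segment between them already has the whole projection.\<close>
  define c where "c = (if fst v \<le> 0 then 1 else 0 :: real, if snd v \<le> 0 then 1 else 0 :: real)"
  define d where "d = (if fst v \<le> 0 then 0 else 1 :: real, if snd v \<le> 0 then 0 else 1 :: real)"
  have cd: "v \<bullet> c = low_end v" "v \<bullet> d = high_end v"
    by (auto simp: c_def d_def inner_prod_def low_end_def high_end_def)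
  define s where "s = (if high_end v = low_end v then 0 else (t - low_end v) / (high_end v - low_end v))"
  have s: "0 \<le> s" "s \<le> 1" using t by (auto simp: s_def proj_interval_def divide_simps)
  have st: "t = (1 - s) * low_end v + s * high_end v"
  proof (cases "high_end v = low_end v")
    case True then show ?thesis using t by (simp add: s_def proj_interval_def)
  next
    case False
    then have "s * (high_end v - low_end v) = t - low_end v" by (simp add: s_def)
    then show ?thesis by (simp add: algebra_simps)
  qed
  have "t = v \<bullet> ((1 - s) *\<^sub>R c + s *\<^sub>R d)"
    unfolding st cd[symmetric] by (simp add: inner_add_right)
  moreover have "(1 - s) *\<^sub>R c + s *\<^sub>R d \<in> {0..1} \<times> {0..1}"
    using s by (auto simp: c_def d_def)
  ultimately show "t \<in> (\<bullet>) v ` ({0..1} \<times> {0..1})" by (rule image_eqI)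
qed

lemma grid_square_eq_image:
  assumes "L > 0"
  shows "grid_square L n q = (\<lambda>x. (1 / real L ^ n) *\<^sub>R (idx q + x)) ` ({0..1} \<times> {0..1})"
proof (intro equalityI subsetI)
  fix x assume x: "x \<in> grid_square L n q"
  have p: "real L ^ n > 0" using assms by simp
  have "x = (1 / real L ^ n) *\<^sub>R (idx q + (real L ^ n *\<^sub>R x - idx q))"
    using assms by (simp add: scaleR_right_diff_distrib)
  moreover have "real L ^ n *\<^sub>R x - idx q \<in> {0..1} \<times> {0..1}"
    using x p unfolding grid_square_def idx_def mem_Times_iff atLeastAtMost_iff pos_divide_le_eq[OF p] pos_le_divide_eq[OF p]
    by (simp add: mult.commute algebra_simps)
  ultimately show "x \<in> (\<lambda>x. (1 / real L ^ n) *\<^sub>R (idx q + x)) ` ({0..1} \<times> {0..1})" by (rule image_eqI)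
next
  fix x assume "x \<in> (\<lambda>x. (1 / real L ^ n) *\<^sub>R (idx q + x)) ` ({0..1} \<times> {0..1})"
  then show "x \<in> grid_square L n q" using assms
    by (auto simp: grid_square_def idx_def divide_right_mono)
qed

lemma grid_square_subset:
  assumes "L > 0" "q \<in> grid L n"
  shows "grid_square L n q \<subseteq> {0..1} \<times> {0..1}"
proof -
  have "real (fst q + 1) \<le> real (L ^ n)" "real (snd q + 1) \<le> real (L ^ n)"
    using assms(2) by (auto simp: grid_def simp del: of_nat_add of_nat_power)
  then have "real (fst q + 1) / real L ^ n \<le> 1" "real (snd q + 1) / real L ^ n \<le> 1"
    using assms(1) by (simp_all add: divide_le_eq_1)
  moreover have "0 \<le> real (fst q) / real L ^ n" "0 \<le> real (snd q) / real L ^ n" by simp_all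
  ultimately show ?thesis unfolding grid_square_def
    by (intro Sigma_mono) (simp_all only: atLeastatMost_subset_iff simp_thms)
qed

lemma image_grid_square:
  assumes "L > 0"
  shows "(\<bullet>) v ` grid_square L n q = {t. real L ^ n * t - v \<bullet> idx q \<in> proj_interval v}"
proof -
  have p: "real L ^ n > 0" using assms by simp
  have "(\<bullet>) v ` grid_square L n q = (\<lambda>s. (v \<bullet> idx q + s) / real L ^ n) ` ((\<bullet>) v ` ({0..1} \<times> {0..1}))"
    by (simp add: grid_square_eq_image[OF assms] image_image inner_add_right)
  also have "\<dots> = {t. real L ^ n * t - v \<bullet> idx q \<in> proj_interval v}"
  proof (intro equalityI subsetI)
    fix t assume "t \<in> {t. real L ^ n * t - v \<bullet> idx q \<in> proj_interval v}"
    then show "t \<in> (\<lambda>s. (v \<bullet> idx q + s) / real L ^ n) ` ((\<bullet>) v ` ({0..1} \<times> {0..1}))"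
      unfolding image_unit_square using p
      by (intro image_eqI[of _ _ "real L ^ n * t - v \<bullet> idx q"]) auto
  qed (use p in \<open>auto simp: image_unit_square\<close>)
  finally show ?thesis .
qed

lemma image_grid_squares:
  assumes "L > 0"
  shows "(\<bullet>) v ` (\<Union>q\<in>A. grid_square L n q) = (\<Union>q\<in>A. {t. real L ^ n * t - v \<bullet> idx q \<in> proj_interval v})"
  using image_grid_square[OF assms] by (simp add: image_UN)

lemma scaled_proj_interval_borel [measurable]:
  "{t. real L ^ n * t - v \<bullet> idx q \<in> proj_interval v} \<in> sets borel"
  unfolding proj_interval_def by measurable

lemma measurable_hit_step:
  assumes [measurable]: "f \<in> borel_measurable borel"
  shows "hit_step L \<mu> v f \<in> borel_measurable borel"
  unfolding hit_step_def [abs_def] by measurable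

lemma measurable_funpow_hit_step:
  assumes "f \<in> borel_measurable borel"
  shows "(hit_step L \<mu> v ^^ n) f \<in> borel_measurable borel"
  by (induction n) (use assms measurable_hit_step in auto)

section \<open>Expected length of the projection in a fixed direction\<close>

definition mean_shadow :: "nat \<Rightarrow> (nat \<times> nat) set pmf \<Rightarrow> nat \<Rightarrow> real \<times> real \<Rightarrow> ennreal" where
  "mean_shadow L \<mu> n v =
    (\<integral>\<^sup>+A. emeasure lebesgue ((\<bullet>) v ` (\<Union>q\<in>A. grid_square L n q)) \<partial>measure_pmf (chosen_squares L \<mu> n))"

lemma emeasure_image_grid_squares:
  assumes "L > 0" "finite A"
  shows "emeasure lebesgue ((\<bullet>) v ` (\<Union>q\<in>A. grid_square L n q)) =
    emeasure lborel (\<Union>q\<in>A. {t. real L ^ n * t - v \<bullet> idx q \<in> proj_interval v})"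
proof -
  have "(\<Union>q\<in>A. {t. real L ^ n * t - v \<bullet> idx q \<in> proj_interval v}) \<in> sets lborel"
    using assms(2) by auto
  then show ?thesis unfolding image_grid_squares[OF assms(1)] by simp
qed

text \<open>The length is the measure of a section of a set that is measurable jointly in the
  direction \<open>v\<close> and the position on the line.\<close>

lemma measurable_shadow:
  assumes "L > 0" "finite A"
  shows "(\<lambda>v. emeasure lebesgue ((\<bullet>) v ` (\<Union>q\<in>A. grid_square L n q))) \<in> borel_measurable borel"
proof -
  let ?Q = "\<Union>q\<in>A. {p \<in> space (borel \<Otimes>\<^sub>M lborel). low_end (fst p) \<le> real L ^ n * snd p - fst p \<bullet> idx q \<and>
     real L ^ n * snd p - fst p \<bullet> idx q \<le> high_end (fst p)}"
  have "?Q \<in> sets (borel \<Otimes>\<^sub>M lborel)"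
  proof (intro sets.finite_UN assms(2))
    have "low_end \<in> borel_measurable borel" "high_end \<in> borel_measurable borel"
      unfolding low_end_def [abs_def] high_end_def [abs_def]
      by (intro borel_measurable_continuous_onI continuous_intros)+
    note [measurable] = this
    fix q show "{p \<in> space (borel \<Otimes>\<^sub>M lborel). low_end (fst p) \<le> real L ^ n * snd p - fst p \<bullet> idx q \<and>
      real L ^ n * snd p - fst p \<bullet> idx q \<le> high_end (fst p)} \<in> sets (borel \<Otimes>\<^sub>M lborel)"
      by measurable
  qed
  from lborel.measurable_emeasure_Pair[OF this]
  show ?thesis unfolding emeasure_image_grid_squares[OF assms]
    by (rule measurable_cong[THEN iffD1, rotated])
       (auto simp: proj_interval_def space_pair_measure intro!: arg_cong[where f = "emeasure lborel"])
qed

lemma mean_shadow_eq_sum: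
  assumes "selection L \<mu>"
  shows "mean_shadow L \<mu> n v = (\<Sum>A\<in>set_pmf (chosen_squares L \<mu> n).
     emeasure lebesgue ((\<bullet>) v ` (\<Union>q\<in>A. grid_square L n q)) * ennreal (pmf (chosen_squares L \<mu> n) A))"
  unfolding mean_shadow_def using finite_set_pmf_chosen[OF assms]
  by (rule nn_integral_measure_pmf_finite) simp

lemma measurable_mean_shadow [measurable]:
  assumes "selection L \<mu>" "L > 0"
  shows "mean_shadow L \<mu> n \<in> borel_measurable borel"
  unfolding mean_shadow_eq_sum[OF assms(1), abs_def]
  by (intro borel_measurable_sum borel_measurable_times_ennreal measurable_shadow assms(2)
      finite_chosen_squares[OF assms(1)]) auto

lemma orth_proj_eq_inner: "orth_proj \<theta> = (\<bullet>) (cos \<theta>, sin \<theta>)"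
  by (auto simp: orth_proj_def inner_prod_def fun_eq_iff)

text \<open>Expectation and integral over directions are exchanged as a finite sum, since a
  generation takes only finitely many values.\<close>

lemma expectation_favard:
  assumes sel: "selection L \<mu>" and L: "L > 0"
  shows "expectation_of (random_set L \<mu> n) favard =
    (\<integral>\<^sup>+\<theta>. mean_shadow L \<mu> n (cos \<theta>, sin \<theta>) * indicator {0..pi} \<theta> \<partial>lborel)"
proof -
  let ?C = "chosen_squares L \<mu> n"
  define g where "g A \<theta> = emeasure lebesgue ((\<bullet>) (cos \<theta>, sin \<theta>) ` (\<Union>q\<in>A. grid_square L n q))" for A and \<theta> :: real
  have [measurable]: "g A \<in> borel_measurable borel" if "A \<in> set_pmf ?C" for A
  proof -
    note measurable_shadow[OF L finite_chosen_squares[OF sel that], of n, measurable]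
    show ?thesis unfolding g_def by measurable
  qed
  have "expectation_of (random_set L \<mu> n) favard = (\<Sum>A\<in>set_pmf ?C. favard (\<Union>q\<in>A. grid_square L n q) * pmf ?C A)"
    unfolding expectation_of_def random_set_def nn_integral_map_pmf
    using finite_set_pmf_chosen[OF sel]
    by (rule nn_integral_measure_pmf_finite) simp
  also have "\<dots> = (\<Sum>A\<in>set_pmf ?C. (\<integral>\<^sup>+\<theta>. g A \<theta> * indicator {0..pi} \<theta> * pmf ?C A \<partial>lborel))"
    by (intro sum.cong refl)
       (auto simp: favard_def g_def[symmetric] orth_proj_eq_inner nn_integral_multc nn_integral_completion)
  also have "\<dots> = (\<integral>\<^sup>+\<theta>. (\<Sum>A\<in>set_pmf ?C. g A \<theta> * indicator {0..pi} \<theta> * pmf ?C A) \<partial>lborel)"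
    by (intro nn_integral_sum[symmetric]) auto
  also have "\<dots> = (\<integral>\<^sup>+\<theta>. mean_shadow L \<mu> n (cos \<theta>, sin \<theta>) * indicator {0..pi} \<theta> \<partial>lborel)"
    unfolding mean_shadow_eq_sum[OF sel] g_def[symmetric]
    by (intro nn_integral_cong) (simp add: sum_distrib_left sum_distrib_right mult_ac)
  finally show ?thesis .
qed

text \<open>For each realisation the integrand is the chance that a line is hit when every chosen
  square receives an independent copy of a set with hitting probability \<open>f\<close>. Allowing
  \<open>f\<close> other than an indicator makes room for initial functions that lie below the
  supersolution.\<close>

lemma nn_integral_funpow_hit_step:
  assumes sel: "selection L \<mu>" and f: "\<And>t. 0 \<le> f t \<and> f t \<le> 1" and fm: "f \<in> borel_measurable borel"
  shows "(\<integral>\<^sup>+A. (\<integral>\<^sup>+t. ennreal (1 - (\<Prod>q\<in>A. 1 - f (real L ^ n * t - v \<bullet> idx q))) \<partial>lborel)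
      \<partial>measure_pmf (chosen_squares L \<mu> n)) = (\<integral>\<^sup>+t. ennreal ((hit_step L \<mu> v ^^ n) f t) \<partial>lborel)"
proof -
  note [measurable] = fm
  let ?C = "chosen_squares L \<mu> n"
  define g where "g A t = 1 - (\<Prod>q\<in>A. 1 - f (real L ^ n * t - v \<bullet> idx q))" for A t
  have [measurable]: "(\<lambda>t. ennreal (g A t)) \<in> borel_measurable borel" for A
    unfolding g_def by measurable
  have gnn: "0 \<le> g A t" for A t using f by (auto simp: g_def intro!: prod_one_minus_bounds)
  have "(\<integral>\<^sup>+A. (\<integral>\<^sup>+t. ennreal (g A t) \<partial>lborel) \<partial>measure_pmf ?C) =
      (\<Sum>A\<in>set_pmf ?C. (\<integral>\<^sup>+t. ennreal (g A t) * pmf ?C A \<partial>lborel))"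
    by (subst nn_integral_measure_pmf_finite[OF finite_set_pmf_chosen[OF sel]]) (simp_all add: nn_integral_multc)
  also have "\<dots> = (\<integral>\<^sup>+t. (\<Sum>A\<in>set_pmf ?C. ennreal (g A t) * pmf ?C A) \<partial>lborel)"
    by (intro nn_integral_sum[symmetric]) auto
  also have "\<dots> = (\<integral>\<^sup>+t. ennreal ((hit_step L \<mu> v ^^ n) f t) \<partial>lborel)"
  proof (intro nn_integral_cong)
    fix t
    have "(\<Sum>A\<in>set_pmf ?C. ennreal (g A t) * pmf ?C A) = ennreal (\<Sum>A\<in>set_pmf ?C. g A t * pmf ?C A)"
      using gnn by (simp add: ennreal_mult sum_ennreal[symmetric])
    also have "(\<Sum>A\<in>set_pmf ?C. g A t * pmf ?C A) = measure_pmf.expectation ?C (\<lambda>A. g A t)"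
      by (rule integral_measure_pmf_real[symmetric]) (auto simp: finite_set_pmf_chosen[OF sel])
    also have "\<dots> = 1 - measure_pmf.expectation ?C (\<lambda>A. \<Prod>q\<in>A. 1 - f (real L ^ n * t - v \<bullet> idx q))"
      unfolding g_def
      by (subst Bochner_Integration.integral_diff)
         (auto simp: integrable_measure_pmf_finite[OF finite_set_pmf_chosen[OF sel]])
    also have "\<dots> = (hit_step L \<mu> v ^^ n) f t"
      by (subst expectation_chosen_squares_prod[OF sel f]) auto
    finally show "(\<Sum>A\<in>set_pmf ?C. ennreal (g A t) * pmf ?C A) = ennreal ((hit_step L \<mu> v ^^ n) f t)" .
  qed
  finally show ?thesis by (simp add: g_def)
qed

text \<open>Full squares correspond to an indicator as \<open>f\<close>: the product vanishes as
  soon as one square is met and is 1 otherwise.\<close>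

lemma mean_shadow_eq_nn_integral:
  assumes sel: "selection L \<mu>" and L: "L > 0"
  shows "mean_shadow L \<mu> n v = (\<integral>\<^sup>+t. ennreal ((hit_step L \<mu> v ^^ n) (indicator (proj_interval v)) t) \<partial>lborel)"
proof -
  define g where "g A t = 1 - (\<Prod>q\<in>A. 1 - indicator (proj_interval v) (real L ^ n * t - v \<bullet> idx q) :: real)" for A t
  have g: "ennreal (g A t) = indicator (\<Union>q\<in>A. {t. real L ^ n * t - v \<bullet> idx q \<in> proj_interval v}) t"
    if "A \<in> set_pmf (chosen_squares L \<mu> n)" for A t
  proof (cases "\<exists>q\<in>A. real L ^ n * t - v \<bullet> idx q \<in> proj_interval v")
    case True
    then have "(\<Prod>q\<in>A. 1 - indicator (proj_interval v) (real L ^ n * t - v \<bullet> idx q) :: real) = 0"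
      using finite_chosen_squares[OF sel that] by (intro prod_zero) (force simp: indicator_def)+
    then show ?thesis using True by (auto simp: g_def)
  next
    case False
    then show ?thesis by (auto simp: g_def indicator_def)
  qed
  have "emeasure lebesgue ((\<bullet>) v ` (\<Union>q\<in>A. grid_square L n q)) = (\<integral>\<^sup>+t. ennreal (g A t) \<partial>lborel)"
    if A: "A \<in> set_pmf (chosen_squares L \<mu> n)" for A
    unfolding emeasure_image_grid_squares[OF L finite_chosen_squares[OF sel A]] g[OF A]
    using finite_chosen_squares[OF sel A] by (intro nn_integral_indicator[symmetric]) auto
  then have "mean_shadow L \<mu> n v = (\<integral>\<^sup>+A. (\<integral>\<^sup>+t. ennreal (g A t) \<partial>lborel) \<partial>measure_pmf (chosen_squares L \<mu> n))"
    unfolding mean_shadow_def by (intro nn_integral_cong_AE) (simp add: AE_measure_pmf_iff)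
  also have "\<dots> = (\<integral>\<^sup>+t. ennreal ((hit_step L \<mu> v ^^ n) (indicator (proj_interval v)) t) \<partial>lborel)"
    unfolding g_def by (rule nn_integral_funpow_hit_step[OF sel]) (auto simp: proj_interval_def)
  finally show ?thesis .
qed

text \<open>Shadows are taken for vectors of any length, so that gradients, which are not unit
  vectors, can be inserted directly.\<close>

lemma mean_shadow_scaleR:
  "mean_shadow L \<mu> n (c *\<^sub>R v) = ennreal \<bar>c\<bar> * mean_shadow L \<mu> n v"
proof -
  have "emeasure lebesgue ((\<bullet>) (c *\<^sub>R v) ` S) = ennreal \<bar>c\<bar> * emeasure lebesgue ((\<bullet>) v ` S)" for S
    using emeasure_lebesgue_affine[of c 0 "(\<bullet>) v ` S"] by (simp add: image_image)
  then show ?thesis by (simp add: mean_shadow_def nn_integral_cmult)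
qed

lemma mean_shadow_le:
  assumes sel: "selection L \<mu>" and L: "L > 0"
  shows "mean_shadow L \<mu> n v \<le> ennreal (\<bar>fst v\<bar> + \<bar>snd v\<bar>)"
proof -
  have "emeasure lebesgue ((\<bullet>) v ` (\<Union>q\<in>A. grid_square L n q)) \<le> ennreal (\<bar>fst v\<bar> + \<bar>snd v\<bar>)"
    if "A \<in> set_pmf (chosen_squares L \<mu> n)" for A
  proof -
    have "(\<bullet>) v ` (\<Union>q\<in>A. grid_square L n q) \<subseteq> proj_interval v"
      unfolding image_unit_square[symmetric] using chosen_squares_subset[OF sel that] grid_square_subset[OF L] by blast
    then have "emeasure lebesgue ((\<bullet>) v ` (\<Union>q\<in>A. grid_square L n q)) \<le> emeasure lebesgue (proj_interval v)"
      by (rule emeasure_mono) (simp add: proj_interval_def)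
    also have "\<dots> = ennreal (\<bar>fst v\<bar> + \<bar>snd v\<bar>)"
      by (simp add: proj_interval_def low_end_le_high_end high_end_minus_low_end)
    finally show ?thesis .
  qed
  then have "mean_shadow L \<mu> n v \<le> (\<integral>\<^sup>+A. ennreal (\<bar>fst v\<bar> + \<bar>snd v\<bar>) \<partial>measure_pmf (chosen_squares L \<mu> n))"
    unfolding mean_shadow_def by (intro nn_integral_mono_AE) (auto simp: AE_measure_pmf_iff)
  then show ?thesis by simp
qed

section \<open>Symmetries of the grid\<close>

locale grid_involution =
  fixes L :: nat and \<rho> :: "nat \<times> nat \<Rightarrow> nat \<times> nat"
  assumes in_grid: "d \<in> grid L 1 \<Longrightarrow> \<rho> d \<in> grid L 1"
    and invol: "d \<in> grid L 1 \<Longrightarrow> \<rho> (\<rho> d) = d"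
begin

lemma inj_on: "A \<subseteq> grid L 1 \<Longrightarrow> inj_on \<rho> A"
  by (metis inj_onI invol subsetD)

lemma mem_image_iff:
  assumes "A \<subseteq> grid L 1" "q \<in> grid L 1"
  shows "q \<in> \<rho> ` A \<longleftrightarrow> \<rho> q \<in> A"
proof
  assume "q \<in> \<rho> ` A"
  then obtain d where "d \<in> A" "q = \<rho> d" by (rule imageE)
  then show "\<rho> q \<in> A" using assms(1) invol by (metis subsetD)
next
  assume "\<rho> q \<in> A"
  then have "\<rho> (\<rho> q) \<in> \<rho> ` A" by (rule imageI)
  then show "q \<in> \<rho> ` A" using invol[OF assms(2)] by simp
qed

lemma selection_image:
  assumes "selection L \<mu>"
  shows "selection L (map_pmf ((`) \<rho>) \<mu>)"
proof -
  have "\<rho> ` A \<subseteq> grid L 1 \<and> card (\<rho> ` A) = L" if "A \<in> set_pmf \<mu>" for A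
  proof
    show "\<rho> ` A \<subseteq> grid L 1" by (intro image_subsetI in_grid subsetD[OF selectionD(1)[OF assms that]])
    show "card (\<rho> ` A) = L"
      using card_image[OF inj_on[OF selectionD(1)[OF assms that]]] selectionD(2)[OF assms that] by simp
  qed
  then show ?thesis by (auto simp: selection_def)
qed

lemma uniform_selection_image:
  assumes "uniform_selection L \<mu>"
  shows "uniform_selection L (map_pmf ((`) \<rho>) \<mu>)"
proof -
  note sel = uniform_imp_selection[OF assms]
  have "measure_pmf.prob (map_pmf ((`) \<rho>) \<mu>) {A. q \<in> A} = 1 / real L" if q: "q \<in> grid L 1" for q
  proof -
    have "measure_pmf.prob (map_pmf ((`) \<rho>) \<mu>) {A. q \<in> A} = measure_pmf.prob \<mu> {A. q \<in> \<rho> ` A}"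
      by (simp add: vimage_def)
    also have "\<dots> = measure_pmf.prob \<mu> {A. \<rho> q \<in> A}"
      by (rule measure_pmf.finite_measure_eq_AE)
         (use mem_image_iff[OF selectionD(1)[OF sel] q] in \<open>simp_all add: AE_measure_pmf_iff\<close>)
    also have "\<dots> = 1 / real L" using assms in_grid[OF q] by (simp add: uniform_selection_def)
    finally show ?thesis .
  qed
  then show ?thesis using selection_image[OF sel] by (simp add: uniform_selection_def)
qed

text \<open>The symmetry may move the projection of the unit square, so positions are compared up to
  a shift \<open>c\<close>. The shift reproduces itself in each generation: it is magnified to
  \<open>L * c\<close>, and the indices take back \<open>c * (L - 1)\<close>.\<close>

lemma funpow_hit_step_image:
  assumes sel: "selection L \<mu>"
    and v: "\<And>d. d \<in> grid L 1 \<Longrightarrow> v' \<bullet> idx (\<rho> d) = v \<bullet> idx d - c * (real L - 1)"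
    and f: "\<And>t. f' t = f (t + c)"
  shows "(hit_step L (map_pmf ((`) \<rho>) \<mu>) v' ^^ n) f' t = (hit_step L \<mu> v ^^ n) f (t + c)"
proof (induction n arbitrary: t)
  case 0 then show ?case by (simp add: f)
next
  case (Suc n)
  define g where "g = (hit_step L \<mu> v ^^ n) f"
  define g' where "g' = (hit_step L (map_pmf ((`) \<rho>) \<mu>) v' ^^ n) f'"
  have g': "g' t = g (t + c)" for t using Suc by (simp add: g_def g'_def)
  have *: "(\<Prod>d\<in>\<rho> ` A. 1 - g' (real L * t - v' \<bullet> idx d)) = (\<Prod>d\<in>A. 1 - g (real L * (t + c) - v \<bullet> idx d))"
    if A: "A \<in> set_pmf \<mu>" for A
  proof -
    have "1 - g' (real L * t - v' \<bullet> idx (\<rho> d)) = 1 - g (real L * (t + c) - v \<bullet> idx d)" if d: "d \<in> A" for d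
    proof -
      have "real L * t - v' \<bullet> idx (\<rho> d) + c = real L * (t + c) - v \<bullet> idx d"
        using v[OF subsetD[OF selectionD(1)[OF sel A] d]] by (simp add: algebra_simps)
      then show ?thesis by (simp add: g')
    qed
    then show ?thesis using inj_on[OF selectionD(1)[OF sel A]] by (simp add: prod.reindex)
  qed
  have "hit_step L (map_pmf ((`) \<rho>) \<mu>) v' g' t = hit_step L \<mu> v g (t + c)"
    unfolding hit_step_eq_expectation[OF sel] hit_step_eq_expectation[OF selection_image[OF sel]] integral_map_pmf
    by (rule integral_cong_AE) (simp_all add: AE_measure_pmf_iff *)
  then show ?case by (simp add: g_def g'_def)
qed

lemma mean_shadow_image:
  assumes sel: "selection L \<mu>" and L: "L > 0"
    and v: "\<And>d. d \<in> grid L 1 \<Longrightarrow> v' \<bullet> idx (\<rho> d) = v \<bullet> idx d - c * (real L - 1)"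
    and e: "low_end v = low_end v' + c" "high_end v = high_end v' + c"
  shows "mean_shadow L (map_pmf ((`) \<rho>) \<mu>) n v' = mean_shadow L \<mu> n v"
proof -
  have m: "(\<lambda>t. ennreal ((hit_step L \<mu> v ^^ n) (indicator (proj_interval v)) t)) \<in> borel_measurable borel"
    using measurable_funpow_hit_step[of "indicator (proj_interval v)"] by (simp add: proj_interval_def)
  have f: "indicator (proj_interval v') t = (indicator (proj_interval v) (t + c) :: real)" for t
    using e by (auto simp: indicator_def proj_interval_def)
  have "(hit_step L (map_pmf ((`) \<rho>) \<mu>) v' ^^ n) (indicator (proj_interval v')) t =
      (hit_step L \<mu> v ^^ n) (indicator (proj_interval v)) (t + c)" for t
    by (rule funpow_hit_step_image[OF sel]) (simp_all add: v f)
  then show ?thesis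
    unfolding mean_shadow_eq_nn_integral[OF sel L] mean_shadow_eq_nn_integral[OF selection_image[OF sel] L]
    using nn_integral_real_affine[OF m, of 1 c] by (simp add: add.commute)
qed

end

text \<open>The reflection of the unit square in its horizontal midline, written on indices.\<close>

definition reflect :: "nat \<Rightarrow> nat \<times> nat \<Rightarrow> nat \<times> nat" where
  "reflect L d = (fst d, L - 1 - snd d)"

interpretation reflect: grid_involution L "reflect L" for L
  by standard (auto simp: grid_def reflect_def)

interpretation swap: grid_involution L prod.swap for L
  by standard (auto simp: grid_def)

lemma mean_shadow_reflect:
  assumes "selection L \<mu>" "L > 0"
  shows "mean_shadow L (map_pmf ((`) (reflect L)) \<mu>) n (x, - y) = mean_shadow L \<mu> n (x, y)"
proof (rule reflect.mean_shadow_image[OF assms])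
  fix d assume "d \<in> grid L 1"
  then have "snd d \<le> L - 1" by (auto simp: grid_def)
  then show "(x, - y) \<bullet> idx (reflect L d) = (x, y) \<bullet> idx d - y * (real L - 1)"
    using assms(2) by (simp add: idx_def reflect_def of_nat_diff algebra_simps)
qed (auto simp: low_end_def high_end_def)

lemma mean_shadow_swap:
  assumes "selection L \<mu>" "L > 0"
  shows "mean_shadow L (map_pmf ((`) prod.swap) \<mu>) n (x, y) = mean_shadow L \<mu> n (y, x)"
  by (rule swap.mean_shadow_image[OF assms, where c = 0])
     (auto simp: low_end_def high_end_def idx_def)

section \<open>A supersolution for the hitting probabilities\<close>

lemma one_minus_sum_le_prod:
  fixes p :: "'a \<Rightarrow> real"
  assumes "finite A" "\<And>d. d \<in> A \<Longrightarrow> 0 \<le> p d \<and> p d \<le> 1"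
  shows "1 - (\<Sum>d\<in>A. p d) \<le> (\<Prod>d\<in>A. 1 - p d)"
  using assms
proof (induction A rule: finite_induct)
  case (insert x A)
  have "1 - p x - (\<Sum>d\<in>A. p d) \<le> (1 - p x) * (1 - (\<Sum>d\<in>A. p d))"
    using insert.prems by (simp add: algebra_simps sum_nonneg)
  also have "\<dots> \<le> (1 - p x) * (\<Prod>d\<in>A. 1 - p d)"
    using insert by (intro mult_left_mono) auto
  finally show ?case using insert by simp
qed simp

text \<open>The events \<open>a\<close> and \<open>b\<close> are treated exactly and the remaining
  ones by the union bound; keeping a single pair already yields a quadratic gain.\<close>

lemma prod_one_minus_ge_pair:
  fixes p :: "'a \<Rightarrow> real"
  assumes A: "finite A" and p: "\<And>d. d \<in> A \<Longrightarrow> 0 \<le> p d \<and> p d \<le> 1" and ab: "a \<in> A" "b \<in> A" "a \<noteq> b"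
  shows "1 - (\<Sum>d\<in>A. p d) + p a * p b \<le> (\<Prod>d\<in>A. 1 - p d)"
proof -
  define B where "B = A - {a, b}"
  have AB: "A = insert a (insert b B)" "finite B" "a \<notin> insert b B" "b \<notin> B"
    using A ab by (auto simp: B_def)
  define X where "X = (1 - p a) * (1 - p b)"
  define S where "S = (\<Sum>d\<in>B. p d)"
  have "0 \<le> X" "X \<le> 1" unfolding X_def using p[OF ab(1)] p[OF ab(2)] by (auto intro: mult_le_one)
  moreover have "0 \<le> S" unfolding S_def using p AB(1) by (intro sum_nonneg) auto
  ultimately have "X - S \<le> X * (1 - S)" by (simp add: algebra_simps mult_left_le)
  also have "\<dots> \<le> X * (\<Prod>d\<in>B. 1 - p d)"
    using \<open>0 \<le> X\<close> AB p unfolding S_def by (intro mult_left_mono one_minus_sum_le_prod) auto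
  finally have "X - S \<le> X * (\<Prod>d\<in>B. 1 - p d)" .
  moreover have "(\<Prod>d\<in>A. 1 - p d) = X * (\<Prod>d\<in>B. 1 - p d)" "(\<Sum>d\<in>A. p d) = p a + p b + S"
    using AB by (simp_all add: X_def S_def mult.assoc)
  ultimately show ?thesis by (simp add: X_def algebra_simps)
qed

lemma hit_step_mono:
  assumes "\<And>t. 0 \<le> f t \<and> f t \<le> g t \<and> g t \<le> 1"
  shows "hit_step L \<mu> v f t \<le> hit_step L \<mu> v g t"
  unfolding hit_step_def
  using assms by (intro sum_mono mult_left_mono diff_left_mono prod_mono) auto

text \<open>The linearisation of \<open>hit_step\<close>: all \<open>L^2\<close> subsquares are
  summed and each is selected with probability \<open>1 / L\<close>. Constants are therefore
  multiplied by \<open>L\<close>.\<close>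

definition mean_step :: "nat \<Rightarrow> real \<times> real \<Rightarrow> (real \<Rightarrow> real) \<Rightarrow> real \<Rightarrow> real" where
  "mean_step L v f t = (\<Sum>d\<in>grid L 1. f (real L * t - v \<bullet> idx d)) / real L"

lemma mean_step_mono: "(\<And>t. f t \<le> g t) \<Longrightarrow> mean_step L v f t \<le> mean_step L v g t"
  by (auto simp: mean_step_def intro!: divide_right_mono sum_mono)

lemma mean_step_add: "mean_step L v (\<lambda>t. f t + g t) t = mean_step L v f t + mean_step L v g t"
  by (simp add: mean_step_def sum.distrib add_divide_distrib)

lemma mean_step_diff: "mean_step L v (\<lambda>t. f t - g t) t = mean_step L v f t - mean_step L v g t"
  by (simp add: mean_step_def sum_subtractf diff_divide_distrib)

lemma mean_step_cmult: "mean_step L v (\<lambda>t. c * f t) t = c * mean_step L v f t"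
  by (simp add: mean_step_def sum_distrib_left[symmetric])

lemma mean_step_sum: "mean_step L v (\<lambda>t. \<Sum>i\<in>I. f i t) t = (\<Sum>i\<in>I. mean_step L v (f i) t)"
  unfolding mean_step_def by (simp add: sum_divide_distrib[symmetric] sum.swap[of _ I])

text \<open>The iterate runs over the squares of generation \<open>k\<close>; applied to an
  indicator it counts those that the line meets in a prescribed position.\<close>

lemma funpow_mean_step:
  assumes "L > 0"
  shows "(mean_step L v ^^ k) f t = (\<Sum>q\<in>grid L k. f (real L ^ k * t - v \<bullet> idx q)) / real L ^ k"
proof (induction k arbitrary: f)
  case 0
  show ?case by (simp add: idx_def zero_prod_def[symmetric])
next
  case (Suc k)
  have "(mean_step L v ^^ Suc k) f t = (mean_step L v ^^ k) (mean_step L v f) t"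
    by (simp add: funpow_swap1)
  also have "\<dots> = (\<Sum>q\<in>grid L k. \<Sum>d\<in>grid L 1. f (real L ^ Suc k * t - v \<bullet> idx (subsquare L q d))) / real L ^ Suc k"
    unfolding Suc.IH mean_step_def
    by (simp add: sum_divide_distrib[symmetric] idx_subsquare inner_add_right algebra_simps)
  also have "(\<Sum>q\<in>grid L k. \<Sum>d\<in>grid L 1. f (real L ^ Suc k * t - v \<bullet> idx (subsquare L q d))) =
    (\<Sum>(q, d)\<in>grid L k \<times> grid L 1. f (real L ^ Suc k * t - v \<bullet> idx (subsquare L q d)))"
    by (simp add: sum.cartesian_product)
  also have "\<dots> = (\<Sum>q\<in>grid L (Suc k). f (real L ^ Suc k * t - v \<bullet> idx q))"
  proof -
    define i where "i r = ((fst r div L, snd r div L), (fst r mod L, snd r mod L))" for r :: "nat \<times> nat"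
    define j where "j = (\<lambda>(q, d). subsquare L q d)"
    have ij: "i (j a) = a \<and> j a \<in> grid L (Suc k)" if "a \<in> grid L k \<times> grid L 1" for a
    proof -
      obtain q d where qd: "a = (q, d)" by (cases a)
      with that have qd: "a = (q, d)" "q \<in> grid L k" "d \<in> grid L 1" by (simp_all only: mem_Sigma_iff)
      have "fst d < L" "snd d < L" using qd by (auto simp: grid_def)
      then show ?thesis
        using subsquare_in_grid[OF qd(2,3)] by (simp add: qd i_def j_def subsquare_def)
    qed
    have ji: "j (i r) = r \<and> i r \<in> grid L k \<times> grid L 1" if "r \<in> grid L (Suc k)" for r
      using div_mod_in_grid[OF that] by (simp add: i_def j_def)
    show ?thesis
      by (rule sum.reindex_bij_witness[of _ i j]) (use ij ji in \<open>auto simp: j_def\<close>)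
  qed
  finally show ?case .
qed

lemma sum_selection_eq_mean_step:
  assumes u: "uniform_selection L \<mu>"
  shows "measure_pmf.expectation \<mu> (\<lambda>A. \<Sum>d\<in>A. f (real L * t - v \<bullet> idx d)) = mean_step L v f t"
proof -
  note sel = uniform_imp_selection[OF u]
  note int = integrable_measure_pmf_finite[OF finite_set_pmf_selection[OF sel]]
  have "measure_pmf.expectation \<mu> (\<lambda>A. \<Sum>d\<in>A. f (real L * t - v \<bullet> idx d)) =
    measure_pmf.expectation \<mu> (\<lambda>A. \<Sum>d\<in>grid L 1. indicator {A. d \<in> A} A * f (real L * t - v \<bullet> idx d))"
  proof (rule integral_cong_AE)
    have "(\<Sum>d\<in>A. f (real L * t - v \<bullet> idx d)) = (\<Sum>d\<in>grid L 1. indicator {A. d \<in> A} A * f (real L * t - v \<bullet> idx d))"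
      if "A \<in> set_pmf \<mu>" for A
      using selectionD(1)[OF sel that] by (intro sum.mono_neutral_cong_left) auto
    then show "AE A in measure_pmf \<mu>. (\<Sum>d\<in>A. f (real L * t - v \<bullet> idx d)) =
       (\<Sum>d\<in>grid L 1. indicator {A. d \<in> A} A * f (real L * t - v \<bullet> idx d))"
      by (simp add: AE_measure_pmf_iff)
  qed auto
  also have "\<dots> = (\<Sum>d\<in>grid L 1. measure_pmf.prob \<mu> {A. d \<in> A} * f (real L * t - v \<bullet> idx d))"
    by (subst Bochner_Integration.integral_sum) (auto simp: int)
  also have "\<dots> = mean_step L v f t"
    using u by (simp add: uniform_selection_def mean_step_def sum_divide_distrib)
  finally show ?thesis .
qed

text \<open>Each selection with two squares of \<open>G\<close> gains the product of their hitting
  probabilities over the union bound; averaging over \<open>\<mu>\<close> turns the union bound into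
  \<open>mean_step\<close> by uniformity.\<close>

lemma hit_step_le_mean_step_pair:
  assumes u: "uniform_selection L \<mu>" and f: "\<And>t. 0 \<le> f t \<and> f t \<le> 1"
    and G: "G \<subseteq> grid L 1" "\<And>d. d \<in> G \<Longrightarrow> \<beta> \<le> f (real L * t - v \<bullet> idx d)" and \<beta>: "0 \<le> \<beta>"
  shows "hit_step L \<mu> v f t \<le> mean_step L v f t - measure_pmf.prob \<mu> {A. 2 \<le> card (A \<inter> G)} * \<beta>\<^sup>2"
proof -
  note sel = uniform_imp_selection[OF u]
  note int = integrable_measure_pmf_finite[OF finite_set_pmf_selection[OF sel]]
  let ?p = "\<lambda>d. f (real L * t - v \<bullet> idx d)"
  have "1 - (\<Prod>d\<in>A. 1 - ?p d) \<le> (\<Sum>d\<in>A. ?p d) - indicator {A. 2 \<le> card (A \<inter> G)} A * \<beta>\<^sup>2"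
    if "A \<in> set_pmf \<mu>" for A
  proof (cases "2 \<le> card (A \<inter> G)")
    case True
    then obtain a b where ab: "a \<in> A \<inter> G" "b \<in> A \<inter> G" "a \<noteq> b"
      by (meson card_2_iff' card_le_Suc_iff numeral_2_eq_2 obtain_subset_with_card_n subsetD)
    have "\<beta>\<^sup>2 \<le> ?p a * ?p b"
      using G(2)[of a] G(2)[of b] ab \<beta> unfolding power2_eq_square by (intro mult_mono) auto
    then show ?thesis
      using prod_one_minus_ge_pair[OF selection_imp_finite[OF sel that], of ?p a b] f ab True by auto
  next
    case False
    then show ?thesis
      using one_minus_sum_le_prod[OF selection_imp_finite[OF sel that], of ?p] f by auto
  qed
  then have "hit_step L \<mu> v f t \<le>
      measure_pmf.expectation \<mu> (\<lambda>A. (\<Sum>d\<in>A. ?p d) - indicator {A. 2 \<le> card (A \<inter> G)} A * \<beta>\<^sup>2)"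
    unfolding hit_step_eq_expectation[OF sel] by (intro integral_mono_AE int) (simp add: AE_measure_pmf_iff)
  also have "\<dots> = mean_step L v f t - measure_pmf.prob \<mu> {A. 2 \<le> card (A \<inter> G)} * \<beta>\<^sup>2"
    by (subst Bochner_Integration.integral_diff) (auto simp: int sum_selection_eq_mean_step[OF u])
  finally show ?thesis .
qed

lemma hit_step_le_mean_step:
  assumes "uniform_selection L \<mu>" "\<And>t. 0 \<le> f t \<and> f t \<le> 1"
  shows "hit_step L \<mu> v f t \<le> mean_step L v f t"
  using hit_step_le_mean_step_pair[OF assms, where G = "{}" and \<beta> = 0] by simp

definition clamp01 :: "real \<Rightarrow> real" where
  "clamp01 x = max 0 (min 1 x)"

text \<open>
  The vertical extent of the part of the line \<open>x - \<phi> y = t\<close> in the unit square. Uniformity of the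
  selection enters the upper bounds only through \<open>mean_step_chord\<close>, the invariance of \<open>chord\<close>.
\<close>

definition chord :: "real \<Rightarrow> real \<Rightarrow> real" where
  "chord \<phi> t = (clamp01 (t + \<phi>) - clamp01 t) / \<phi>"

lemma chord_bounds:
  assumes "0 < \<phi>"
  shows "0 \<le> chord \<phi> t" "chord \<phi> t \<le> 1"
  using assms by (auto simp: chord_def clamp01_def divide_simps)

lemma chord_pos_iff:
  assumes "0 < \<phi>"
  shows "0 < chord \<phi> t \<longleftrightarrow> - \<phi> < t \<and> t < 1"
  using assms by (auto simp: chord_def clamp01_def zero_less_divide_iff)

lemma chord_eq_0:
  assumes "0 < \<phi>" "t \<notin> {-\<phi>..1}"
  shows "chord \<phi> t = 0"
  using chord_pos_iff[OF assms(1), of t] chord_bounds(1)[OF assms(1), of t] assms(2) by auto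

lemma sum_clamp01: "(\<Sum>i<n. clamp01 (y - real i)) = max 0 (min (real n) y)"
  by (induction n) (auto simp: clamp01_def)

lemma sum_clamp01_scaled:
  assumes "L > 0"
  shows "(\<Sum>i<L. clamp01 (real L * x - real i)) = real L * clamp01 x"
  using assms unfolding sum_clamp01 unfolding clamp01_def
  by (auto simp: max_def min_def mult_le_0_iff zero_le_mult_iff)

text \<open>The extents in the subsquares add up to the extent in the whole square, and the
  magnification by \<open>L\<close> cancels the division by \<open>L\<close>. In each row the clamps
  add up to a single clamp, and successive rows telescope.\<close>

lemma mean_step_chord:
  assumes L: "L > 0" and \<phi>: "0 < \<phi>"
  shows "mean_step L (1, - \<phi>) (chord \<phi>) t = chord \<phi> t"
proof -
  define g where "g j = real L * clamp01 (t + \<phi> * real j / real L)" for j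
  have e: "real L * (t + \<phi> * real j / real L) - real i = real L * t - (1, - \<phi>) \<bullet> idx (i, j)" for i j
    using L by (simp add: idx_def field_simps)
  have e': "real L * t - (1, - \<phi>) \<bullet> idx (i, j) + \<phi> = real L * t - (1, - \<phi>) \<bullet> idx (i, Suc j)" for i j
    by (simp add: idx_def algebra_simps)
  have "(\<Sum>d\<in>grid L 1. chord \<phi> (real L * t - (1, - \<phi>) \<bullet> idx d)) =
    (\<Sum>j<L. \<Sum>i<L. chord \<phi> (real L * t - (1, - \<phi>) \<bullet> idx (i, j)))"
    unfolding grid_def by (subst sum.swap) (simp add: sum.cartesian_product case_prod_beta' del: inner_Pair)
  also have "\<dots> = (\<Sum>j<L. (g (Suc j) - g j) / \<phi>)"
    unfolding g_def sum_clamp01_scaled[OF L, symmetric] e chord_def e'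
    by (simp add: sum_subtractf sum_divide_distrib[symmetric] del: inner_Pair)
  also have "\<dots> = (g L - g 0) / \<phi>"
    by (simp add: sum_divide_distrib[symmetric] sum_lessThan_telescope)
  also have "\<dots> = real L * chord \<phi> t"
    using L by (simp add: g_def chord_def right_diff_distrib)
  finally show ?thesis using L by (simp add: mean_step_def)
qed

lemma funpow_mean_step_chord:
  assumes "L > 0" "0 < \<phi>"
  shows "(mean_step L (1, - \<phi>) ^^ k) (chord \<phi>) = chord \<phi>"
  by (induction k) (auto simp: mean_step_chord[OF assms])

text \<open>
  A line close to a corner meets a single first generation square, so it cannot branch; there the
  square root, which \<open>mean_step\<close> contracts, takes over the role of the branching gain.
\<close>

lemma mean_step_sqrt_chord_corner:
  assumes "L \<ge> 2" and \<phi>: "0 < \<phi>" "\<phi> \<le> 1" and t: "chord \<phi> t \<le> 1 / real L"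
  shows "mean_step L (1, - \<phi>) (\<lambda>t. sqrt (chord \<phi> t)) t \<le> sqrt (chord \<phi> t) / sqrt (real L)"
proof -
  have L: "L > 0" using assms(1) by simp
  let ?c = "\<lambda>d. chord \<phi> (real L * t - (1, - \<phi>) \<bullet> idx d)"
  \<comment> \<open>The single child is the top square of the first column for \<open>t < 0\<close>
    and the bottom square of the last column otherwise.\<close>
  have "\<exists>d0. \<forall>d\<in>grid L 1. d \<noteq> d0 \<longrightarrow> ?c d = 0"
  proof (cases "t < 0")
    case True
    have t': "real L * t \<le> \<phi> - real L * \<phi>"
    proof (cases "t + \<phi> \<le> 0")
      case True
      then have "real L * (t + \<phi>) \<le> 0" by (simp add: mult_nonneg_nonpos)
      then show ?thesis using \<phi> by (simp add: algebra_simps)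
    next
      case False
      then have "chord \<phi> t = (t + \<phi>) / \<phi>" using True \<phi> by (auto simp: chord_def clamp01_def)
      with t have "(t + \<phi>) / \<phi> \<le> 1 / real L" by simp
      then show ?thesis using \<phi> L by (simp add: field_simps)
    qed
    have "d = (0, L - 1)" if d: "d \<in> grid L 1" and "?c d \<noteq> 0" for d
    proof -
      have "?c d > 0" using that chord_bounds(1)[OF \<phi>(1)] by (simp add: less_le)
      then have "- \<phi> < real L * t - real (fst d) + \<phi> * real (snd d)"
        unfolding chord_pos_iff[OF \<phi>(1)] by (simp add: idx_def)
      with t' have *: "real (fst d) < \<phi> * (real (snd d) + 2 - real L)" by (simp add: algebra_simps)
      then have "0 < \<phi> * (real (snd d) + 2 - real L)" by (meson le_less_trans of_nat_0_le_iff)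
      then have "real L < real (snd d) + 2" using \<phi> by (simp add: zero_less_mult_iff)
      moreover have "snd d < L" using d by (auto simp: grid_def)
      ultimately have s: "snd d = L - 1" by linarith
      then have "real (fst d) < \<phi>" using * L by (simp add: of_nat_diff)
      then have "fst d = 0" using \<phi> by linarith
      then show ?thesis using s by (simp add: prod_eq_iff)
    qed
    then show ?thesis by blast
  next
    case False
    have t': "real L * t \<ge> real L - \<phi>"
    proof (cases "t \<ge> 1")
      case True
      then have "real L * 1 \<le> real L * t" by (intro mult_left_mono) auto
      then show ?thesis using \<phi> by simp
    next
      case F2: False
      show ?thesis
      proof (cases "t + \<phi> \<le> 1")
        case True
        then have "chord \<phi> t = 1" using False F2 \<phi> by (auto simp: chord_def clamp01_def)
        with t have "L = 1" using L by (simp add: field_simps)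
        then show ?thesis using assms(1) by simp
      next
        case F3: False
        then have "chord \<phi> t = (1 - t) / \<phi>" using False F2 \<phi> by (auto simp: chord_def clamp01_def)
        with t have "(1 - t) / \<phi> \<le> 1 / real L" by simp
        then show ?thesis using \<phi> L by (simp add: field_simps)
      qed
    qed
    have "d = (L - 1, 0)" if d: "d \<in> grid L 1" and "?c d \<noteq> 0" for d
    proof -
      have "?c d > 0" using that chord_bounds(1)[OF \<phi>(1)] by (simp add: less_le)
      then have "real L * t - real (fst d) + \<phi> * real (snd d) < 1"
        unfolding chord_pos_iff[OF \<phi>(1)] by (simp add: idx_def)
      with t' have *: "\<phi> * (real (snd d) - 1) < real (fst d) + 1 - real L" by (simp add: algebra_simps)
      have f: "fst d < L" using d by (auto simp: grid_def)
      then have "\<phi> * (real (snd d) - 1) < 0" using * by linarith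
      then have s: "snd d = 0" using \<phi> by (simp add: mult_less_0_iff)
      then have "real L < real (fst d) + 2" using * \<phi> by simp
      then have "fst d = L - 1" using f by linarith
      then show ?thesis using s by (simp add: prod_eq_iff)
    qed
    then show ?thesis by blast
  qed
  then obtain d0 where d0: "\<And>d. d \<in> grid L 1 \<Longrightarrow> d \<noteq> d0 \<Longrightarrow> ?c d = 0" by blast
  have sum: "(\<Sum>d\<in>grid L 1. ?c d) = real L * chord \<phi> t"
    using mean_step_chord[OF L \<phi>(1), of t] L by (simp add: mean_step_def field_simps del: inner_Pair)
  \<comment> \<open>A single summand keeps the sum at \<open>sqrt (L * chord)\<close>, so that the
    division by \<open>L\<close> leaves the factor \<open>1 / sqrt L\<close>.\<close>
  have "(\<Sum>d\<in>grid L 1. sqrt (?c d)) \<le> sqrt (real L * chord \<phi> t)"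
  proof (cases "d0 \<in> grid L 1")
    case True
    have "(\<Sum>d\<in>grid L 1. sqrt (?c d)) = (\<Sum>d\<in>{d0}. sqrt (?c d))"
      using True d0 by (intro sum.mono_neutral_right) (auto simp del: inner_Pair)
    moreover have "?c d0 \<le> (\<Sum>d\<in>grid L 1. ?c d)"
      using True chord_bounds(1)[OF \<phi>(1)] by (intro member_le_sum) auto
    ultimately show ?thesis unfolding sum by simp
  next
    case False
    then have "(\<Sum>d\<in>grid L 1. sqrt (?c d)) = 0" using d0 by (intro sum.neutral ballI) (metis real_sqrt_zero)
    then show ?thesis using chord_bounds(1)[OF \<phi>(1)] by simp
  qed
  then have "mean_step L (1, - \<phi>) (\<lambda>t. sqrt (chord \<phi> t)) t \<le> sqrt (real L) * sqrt (chord \<phi> t) / real L"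
    unfolding mean_step_def real_sqrt_mult[symmetric] by (intro divide_right_mono) auto
  also have "\<dots> = sqrt (chord \<phi> t) / sqrt (real L)"
    using L by (simp add: field_simps)
  finally show ?thesis .
qed

text \<open>The interface between the geometry of a slope and the supersolution. On \<open>J\<close>
  two squares that the line meets well are selected together with probability at least
  \<open>\<eta>\<close>. The premise \<open>lower\<close> says that after \<open>k\<close>
  generations the visits to \<open>J\<close> are spread out, except near corners, and
  \<open>upper\<close> bounds the visits made until then. Different kinds of slopes supply different
  sets \<open>J\<close>.\<close>

locale branching_rate =
  fixes L :: nat and \<mu> :: "(nat \<times> nat) set pmf" and \<phi> :: real and J :: "real set"
    and k :: nat and W \<rho> \<eta> :: real
  assumes unif: "uniform_selection L \<mu>" and L: "L \<ge> 2"
    and slope: "0 < \<phi>" "\<phi> \<le> 1"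
    and params: "0 < \<eta>" "\<eta> \<le> 1" "0 < \<rho>" "\<rho> \<le> 1" "0 \<le> W"
    and pair: "\<And>t. t \<in> J \<Longrightarrow> \<exists>G\<subseteq>grid L 1. \<eta> \<le> measure_pmf.prob \<mu> {A. 2 \<le> card (A \<inter> G)} \<and>
        (\<forall>d\<in>G. 1 / 4 \<le> chord \<phi> (real L * t - (1, - \<phi>) \<bullet> idx d))"
    and upper: "\<And>t. (\<Sum>i<k. (mean_step L (1, - \<phi>) ^^ i) (indicator J) t) \<le> W * chord \<phi> t"
    and lower: "\<And>t. 1 / real L < chord \<phi> t \<Longrightarrow> \<rho> * chord \<phi> t \<le> (mean_step L (1, - \<phi>) ^^ k) (indicator J) t"
begin

abbreviation "v \<equiv> (1 :: real, - \<phi>)"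

text \<open>\<open>c\<close> is \<open>\<eta> * (1 / 4)^2\<close>, the gain on \<open>J\<close> per
  squared amplitude. \<open>\<kappa>\<close> is so small that away from corners the delayed gain is
  at least twice the possible loss of the square root term. \<open>R\<close> keeps the corrector
  term below the leading one in the upper bound of \<open>super\<close>. \<open>s\<close> is a
  twelfth of \<open>\<kappa>\<close> because the drift \<open>\<kappa> / 4\<close> has to pay for
  three losses of size \<open>s\<close>. The amplitude solves
  \<open>amp n - amp (n + 1) = s * amp n * amp (n + 1)\<close>.\<close>

definition "c = \<eta> / 16"
definition "\<kappa> = c * \<rho> / (2 * real L ^ 3)"
definition "R = 2 + c * W + \<kappa>"
definition "s = \<kappa> / 12"
definition "amp n = 1 / (R + s * real n)"

text \<open>
  The corrector \<open>w\<close> postpones the branching gain by \<open>k\<close> generations, after which it is equidistributed: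
  the sum telescopes under \<open>mean_step\<close> and turns the gain on \<open>J\<close> into the lower bound of \<open>lower\<close>.
\<close>

definition "w t = c * (W * chord \<phi> t - (\<Sum>i<k. (mean_step L v ^^ i) (indicator J) t)) + \<kappa> * sqrt (chord \<phi> t)"
definition "super n t = amp n * chord \<phi> t + (amp n)\<^sup>2 * w t"

lemma L0: "L > 0" using L by simp

lemma selection: "selection L \<mu>" by (rule uniform_imp_selection[OF unif])

lemma pos_consts: "0 < c" "c \<le> 1" "0 < \<kappa>" "\<kappa> \<le> 1" "0 < s" "2 \<le> R" "c * W + \<kappa> \<le> R"
proof -
  show c: "0 < c" "c \<le> 1" using params by (auto simp: c_def)
  show \<kappa>: "0 < \<kappa>" using c params L by (simp add: \<kappa>_def)
  have "1 \<le> real L ^ 3" using L by (intro one_le_power) simp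
  moreover have "c * \<rho> \<le> 1 * 1" using c params by (intro mult_mono) auto
  ultimately have "c * \<rho> \<le> 2 * real L ^ 3" by linarith
  then show "\<kappa> \<le> 1" using L by (simp add: \<kappa>_def divide_le_eq)
  show "0 < s" using \<kappa> by (simp add: s_def)
  have "0 \<le> c * W" using c params by simp
  then show "2 \<le> R" "c * W + \<kappa> \<le> R" using \<kappa> by (auto simp: R_def)
qed

lemma amp: "0 < amp n" "amp n \<le> 1 / R" "amp n \<le> 1 / 2" "amp n * (c * W + \<kappa>) \<le> 1"
  "amp (Suc n) \<le> amp n" "amp n - amp (Suc n) \<le> s * (amp n)\<^sup>2"
proof -
  have p: "R \<le> R + s * real n" "0 < R + s * real n" using pos_consts by (auto intro: add_pos_nonneg)
  then show a: "0 < amp n" "amp n \<le> 1 / R" using pos_consts by (auto simp: amp_def intro!: divide_left_mono)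
  show "amp n \<le> 1 / 2" using a pos_consts by (meson divide_left_mono mult_pos_pos order_trans zero_le_one zero_less_numeral less_le_trans)
  have "amp n * (c * W + \<kappa>) \<le> 1 / R * R"
    using a pos_consts params by (intro mult_mono) auto
  then show "amp n * (c * W + \<kappa>) \<le> 1" using pos_consts by simp
  have p2: "0 < R + s * real (Suc n)" using pos_consts by (auto intro: add_pos_nonneg)
  show m: "amp (Suc n) \<le> amp n"
    unfolding amp_def using p p2 pos_consts by (intro divide_left_mono mult_pos_pos) (auto simp: algebra_simps)
  have "amp n - amp (Suc n) = s * (amp n * amp (Suc n))"
    using p p2 by (simp add: amp_def field_simps)
  also have "\<dots> \<le> s * (amp n * amp n)"
    using pos_consts m a by (intro mult_left_mono) auto
  finally show "amp n - amp (Suc n) \<le> s * (amp n)\<^sup>2" by (simp add: power2_eq_square)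
qed

lemma chord_le_sqrt: "chord \<phi> t \<le> sqrt (chord \<phi> t)"
proof -
  have "chord \<phi> t * chord \<phi> t \<le> chord \<phi> t * 1"
    using chord_bounds[OF slope(1), of t] by (intro mult_left_mono) auto
  then show ?thesis using chord_bounds[OF slope(1), of t]
    by (intro real_le_rsqrt) (simp add: power2_eq_square)
qed

lemma funpow_indicator_nonneg: "0 \<le> (mean_step L v ^^ i) (indicator J) t"
  unfolding funpow_mean_step[OF L0] by (intro divide_nonneg_nonneg sum_nonneg) auto

lemma w_bounds: "0 \<le> w t" "w t \<le> (c * W + \<kappa>) * sqrt (chord \<phi> t)"
proof -
  show "0 \<le> w t" unfolding w_def using upper[of t] pos_consts chord_bounds[OF slope(1), of t]
    by (intro add_nonneg_nonneg mult_nonneg_nonneg) auto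
  have "c * (W * chord \<phi> t - (\<Sum>i<k. (mean_step L v ^^ i) (indicator J) t)) \<le> c * (W * sqrt (chord \<phi> t))"
  proof (intro mult_left_mono)
    have "W * chord \<phi> t \<le> W * sqrt (chord \<phi> t)"
      using chord_le_sqrt params by (intro mult_left_mono) auto
    moreover have "0 \<le> (\<Sum>i<k. (mean_step L v ^^ i) (indicator J) t)"
      by (intro sum_nonneg funpow_indicator_nonneg)
    ultimately show "W * chord \<phi> t - (\<Sum>i<k. (mean_step L v ^^ i) (indicator J) t) \<le> W * sqrt (chord \<phi> t)"
      by linarith
  qed (use pos_consts in auto)
  then show "w t \<le> (c * W + \<kappa>) * sqrt (chord \<phi> t)" by (simp add: w_def algebra_simps)
qed

lemma super_bounds: "amp n * chord \<phi> t \<le> super n t" "0 \<le> super n t" "super n t \<le> 2 * amp n * sqrt (chord \<phi> t)" "super n t \<le> 1"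
proof -
  show 1: "amp n * chord \<phi> t \<le> super n t" using w_bounds(1) by (simp add: super_def)
  show "0 \<le> super n t" using 1 amp(1)[of n] chord_bounds(1)[OF slope(1), of t]
    by (meson less_imp_le mult_nonneg_nonneg order_trans)
  have "super n t \<le> amp n * sqrt (chord \<phi> t) + (amp n)\<^sup>2 * ((c * W + \<kappa>) * sqrt (chord \<phi> t))"
    unfolding super_def using w_bounds(2) chord_le_sqrt amp(1)[of n]
    by (intro add_mono mult_left_mono) auto
  also have "\<dots> = amp n * sqrt (chord \<phi> t) + (amp n * (c * W + \<kappa>)) * (amp n * sqrt (chord \<phi> t))"
    by (simp add: power2_eq_square)
  also have "\<dots> \<le> amp n * sqrt (chord \<phi> t) + 1 * (amp n * sqrt (chord \<phi> t))"
    using amp[of n] chord_bounds[OF slope(1), of t] by (intro add_left_mono mult_right_mono) auto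
  finally show 2: "super n t \<le> 2 * amp n * sqrt (chord \<phi> t)" by (simp add: mult_ac)
  have "2 * amp n * sqrt (chord \<phi> t) \<le> 1 * 1"
    using amp[of n] chord_bounds[OF slope(1), of t] by (intro mult_mono) auto
  then show "super n t \<le> 1" using 2 by simp
qed

lemma mean_step_w:
  "mean_step L v w t = w t - c * (mean_step L v ^^ k) (indicator J) t + c * indicator J t
     - \<kappa> * (sqrt (chord \<phi> t) - mean_step L v (\<lambda>t. sqrt (chord \<phi> t)) t)"
proof -
  let ?P = "\<lambda>i. (mean_step L v ^^ i) (indicator J)"
  have "mean_step L v (\<lambda>t. \<Sum>i<k. ?P i t) t = (\<Sum>i<k. ?P (Suc i) t)"
    by (simp add: mean_step_sum)
  also have "\<dots> = (\<Sum>i<k. ?P i t) + ?P k t - indicator J t"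
    using sum.lessThan_Suc_shift[of "\<lambda>i. ?P i t" k] by simp
  finally have *: "mean_step L v (\<lambda>t. \<Sum>i<k. ?P i t) t = (\<Sum>i<k. ?P i t) + ?P k t - indicator J t" .
  have "mean_step L v w t = c * (W * mean_step L v (chord \<phi>) t - mean_step L v (\<lambda>t. \<Sum>i<k. ?P i t) t)
      + \<kappa> * mean_step L v (\<lambda>t. sqrt (chord \<phi> t)) t"
    unfolding w_def [abs_def] mean_step_add mean_step_cmult mean_step_diff ..
  also have "mean_step L v (chord \<phi>) t = chord \<phi> t" by (rule mean_step_chord[OF L0 slope(1)])
  finally show ?thesis unfolding * w_def by (simp add: algebra_simps)
qed

text \<open>Near a corner the contraction of the square root produces the drift; elsewhere the
  delayed gain is of order \<open>chord\<close>, which is bounded below and dominates the square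
  root terms.\<close>

lemma drift:
  "\<kappa> / 4 * sqrt (chord \<phi> t) \<le> c * (mean_step L v ^^ k) (indicator J) t +
     \<kappa> * (sqrt (chord \<phi> t) - mean_step L v (\<lambda>t. sqrt (chord \<phi> t)) t)"
proof (cases "chord \<phi> t \<le> 1 / real L")
  case True
  \<comment> \<open>\<open>sqrt 2\<close> exceeds \<open>4 / 3\<close>, so the contraction factor is
    at most \<open>3 / 4\<close> and a quarter of the square root remains.\<close>
  have "4 / 3 \<le> sqrt (real L)" using L by (intro real_le_rsqrt) (simp add: power2_eq_square)
  then have "sqrt (chord \<phi> t) / sqrt (real L) \<le> sqrt (chord \<phi> t) / (4 / 3)"
    using chord_bounds(1)[OF slope(1), of t] L0 by (intro divide_left_mono mult_pos_pos) auto
  also have "sqrt (chord \<phi> t) / (4 / 3) = 3 / 4 * sqrt (chord \<phi> t)" by simp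
  finally have "mean_step L v (\<lambda>t. sqrt (chord \<phi> t)) t \<le> 3 / 4 * sqrt (chord \<phi> t)"
    by (rule order_trans[OF mean_step_sqrt_chord_corner[OF L slope True]])
  then have "1 / 4 * sqrt (chord \<phi> t) \<le> sqrt (chord \<phi> t) - mean_step L v (\<lambda>t. sqrt (chord \<phi> t)) t" by simp
  then have "\<kappa> * (1 / 4 * sqrt (chord \<phi> t)) \<le> \<kappa> * (sqrt (chord \<phi> t) - mean_step L v (\<lambda>t. sqrt (chord \<phi> t)) t)"
    using pos_consts by (intro mult_left_mono) auto
  moreover have "0 \<le> c * (mean_step L v ^^ k) (indicator J) t"
    using pos_consts funpow_indicator_nonneg by simp
  ultimately show ?thesis by simp
next
  case False
  define x where "x = sqrt (chord \<phi> t)"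
  have x: "0 \<le> x" "chord \<phi> t = x * x" using chord_bounds(1)[OF slope(1), of t] by (auto simp: x_def)
  have "1 / real L \<le> x" using False chord_le_sqrt[of t] by (simp add: x_def)
  then have xL: "1 \<le> real L * x" using L by (simp add: field_simps)
  \<comment> \<open>The trivial bound suffices: away from corners \<open>x >= 1 / L\<close>, so the
    constant \<open>L\<close> is at most \<open>L^2 * x\<close>.\<close>
  have "mean_step L v (\<lambda>t. sqrt (chord \<phi> t)) t \<le> mean_step L v (\<lambda>t. 1) t"
    using chord_bounds[OF slope(1)] by (intro mean_step_mono) simp
  also have "\<dots> = real L" using L by (simp add: mean_step_def card_grid)
  also have "\<dots> \<le> real L * (real L * x)" using xL by (simp add: mult_le_cancel_left1)
  finally have A: "mean_step L v (\<lambda>t. sqrt (chord \<phi> t)) t \<le> real L * (real L * x)" .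
  have "c * (\<rho> * chord \<phi> t) \<le> c * (mean_step L v ^^ k) (indicator J) t"
    using lower[of t] False pos_consts by (intro mult_left_mono) auto
  moreover have "2 * \<kappa> * real L ^ 2 * x \<le> c * (\<rho> * chord \<phi> t)"
  proof -
    have "2 * \<kappa> * real L ^ 2 * x = c * \<rho> * (x / real L)"
      using L by (simp add: \<kappa>_def power2_eq_square power3_eq_cube)
    also have "\<dots> \<le> c * \<rho> * (x * x)"
      using xL L x pos_consts params by (intro mult_left_mono) (auto simp: field_simps mult_le_cancel_left1)
    finally show ?thesis by (simp add: x mult.assoc)
  qed
  moreover have "\<kappa> * (mean_step L v (\<lambda>t. sqrt (chord \<phi> t)) t) \<le> \<kappa> * (real L * (real L * x))"
    using A pos_consts by (intro mult_left_mono) auto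
  moreover have "\<kappa> * (real L * (real L * x)) = \<kappa> * real L ^ 2 * x" by (simp add: power2_eq_square)
  moreover have "0 \<le> \<kappa> * real L ^ 2 * x" "0 \<le> \<kappa> * x" using pos_consts x by auto
  ultimately show ?thesis unfolding x_def[symmetric] right_diff_distrib by linarith
qed

text \<open>The gain on \<open>J\<close> cancels the term \<open>c * indicator J\<close> created by
  the corrector, and the drift remains. Lowering the amplitude costs at most one unit
  \<open>s * amp^2 * sqrt chord\<close> in the leading term and two in the corrector, and three
  units are exactly the drift.\<close>

lemma hit_step_super: "hit_step L \<mu> v (super n) t \<le> super (Suc n) t"
proof -
  let ?a = "amp n" and ?b = "amp (Suc n)"
  have b: "0 \<le> super n t \<and> super n t \<le> 1" for t using super_bounds by blast
  have "hit_step L \<mu> v (super n) t \<le> mean_step L v (super n) t - c * ?a\<^sup>2 * indicator J t"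
  proof (cases "t \<in> J")
    case True
    from pair[OF True] obtain G where G: "G \<subseteq> grid L 1" "\<eta> \<le> measure_pmf.prob \<mu> {A. 2 \<le> card (A \<inter> G)}"
      "\<And>d. d \<in> G \<Longrightarrow> 1 / 4 \<le> chord \<phi> (real L * t - v \<bullet> idx d)" by blast
    have "?a / 4 \<le> super n (real L * t - v \<bullet> idx d)" if "d \<in> G" for d
    proof -
      have "?a * (1 / 4) \<le> ?a * chord \<phi> (real L * t - v \<bullet> idx d)"
        using G(3)[OF that] amp(1)[of n] by (intro mult_left_mono) auto
      then show ?thesis using super_bounds(1)[of n "real L * t - v \<bullet> idx d"] by simp
    qed
    then have "hit_step L \<mu> v (super n) t \<le> mean_step L v (super n) t - measure_pmf.prob \<mu> {A. 2 \<le> card (A \<inter> G)} * (?a / 4)\<^sup>2"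
      using amp(1)[of n] by (intro hit_step_le_mean_step_pair[OF unif b G(1)]) auto
    also have "\<dots> \<le> mean_step L v (super n) t - \<eta> * (?a / 4)\<^sup>2"
      using G(2) by (intro diff_left_mono mult_right_mono) auto
    finally show ?thesis using True by (simp add: c_def power_divide)
  qed (use hit_step_le_mean_step[OF unif b] in simp)
  also have "mean_step L v (super n) t = ?a * mean_step L v (chord \<phi>) t + ?a\<^sup>2 * mean_step L v w t"
    unfolding super_def [abs_def] mean_step_add mean_step_cmult ..
  also have "mean_step L v (chord \<phi>) t = chord \<phi> t" by (rule mean_step_chord[OF L0 slope(1)])
  also have "?a * chord \<phi> t + ?a\<^sup>2 * mean_step L v w t - c * ?a\<^sup>2 * indicator J t =
    ?a * chord \<phi> t + ?a\<^sup>2 * w t - ?a\<^sup>2 * (c * (mean_step L v ^^ k) (indicator J) t +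
     \<kappa> * (sqrt (chord \<phi> t) - mean_step L v (\<lambda>t. sqrt (chord \<phi> t)) t))"
    unfolding mean_step_w by (simp add: algebra_simps)
  also have "\<dots> \<le> ?a * chord \<phi> t + ?a\<^sup>2 * w t - ?a\<^sup>2 * (\<kappa> / 4 * sqrt (chord \<phi> t))"
    using drift by (intro diff_left_mono mult_left_mono) auto
  also have "\<dots> \<le> super (Suc n) t"
  proof -
    define x where "x = sqrt (chord \<phi> t)"
    have x: "0 \<le> x" using chord_bounds(1)[OF slope(1), of t] by (simp add: x_def)
    have 1: "(?a - ?b) * chord \<phi> t \<le> s * ?a\<^sup>2 * x"
      using amp[of n] chord_le_sqrt[of t] chord_bounds(1)[OF slope(1), of t] pos_consts unfolding x_def by (intro mult_mono) auto
    have "?a\<^sup>2 - ?b\<^sup>2 = (?a - ?b) * (?a + ?b)" by (simp add: power2_eq_square algebra_simps)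
    also have "\<dots> \<le> s * ?a\<^sup>2 * (2 * ?a)"
      using amp[of n] amp(1)[of "Suc n"] pos_consts by (intro mult_mono) auto
    finally have "(?a\<^sup>2 - ?b\<^sup>2) * w t \<le> s * ?a\<^sup>2 * (2 * ?a) * ((c * W + \<kappa>) * x)"
      using w_bounds[of t] amp[of n] pos_consts unfolding x_def by (intro mult_mono) auto
    also have "\<dots> = 2 * s * ?a\<^sup>2 * x * (?a * (c * W + \<kappa>))" by (simp add: mult_ac)
    also have "\<dots> \<le> 2 * s * ?a\<^sup>2 * x * 1"
      using amp[of n] pos_consts x by (intro mult_left_mono) auto
    finally have 2: "(?a\<^sup>2 - ?b\<^sup>2) * w t \<le> 2 * (s * ?a\<^sup>2 * x)" by simp
    have "?a\<^sup>2 * (\<kappa> / 4 * x) = 3 * (s * ?a\<^sup>2 * x)" by (simp add: s_def)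
    with 1[unfolded left_diff_distrib] 2[unfolded left_diff_distrib] show ?thesis
      unfolding x_def[symmetric] super_def by linarith
  qed
  finally show ?thesis .
qed

text \<open>Comparison by monotonicity of \<open>hit_step\<close>. The initial function has to lie
  below \<open>super 0\<close>, which is guaranteed only at size \<open>chord / R\<close>, so the
  indicator of the full projection is not admissible.\<close>

lemma funpow_hit_step_le_super:
  assumes "\<And>t. 0 \<le> f t \<and> f t \<le> chord \<phi> t / R"
  shows "(hit_step L \<mu> v ^^ n) f t \<le> super n t"
proof (induction n arbitrary: t)
  case 0
  have "amp 0 = 1 / R" by (simp add: amp_def)
  then show ?case using assms[of t] super_bounds(1)[of 0 t] by simp
next
  case (Suc n)
  have f1: "0 \<le> f t \<and> f t \<le> 1" for t
  proof -
    have "chord \<phi> t / R \<le> 1" using chord_bounds[OF slope(1), of t] pos_consts by (simp add: divide_le_eq)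
    then show ?thesis using assms[of t] by linarith
  qed
  have "(hit_step L \<mu> v ^^ Suc n) f t \<le> hit_step L \<mu> v (super n) t"
    using funpow_hit_step_bounds[OF selection f1] Suc super_bounds(4) by (auto intro!: hit_step_mono)
  also have "\<dots> \<le> super (Suc n) t" by (rule hit_step_super)
  finally show ?case .
qed

lemma mid_le_chord:
  assumes "t \<in> {- \<phi> / 2..1 - \<phi> / 2}"
  shows "1 / 2 \<le> chord \<phi> t"
proof -
  have "\<phi> / 2 \<le> clamp01 (t + \<phi>) - clamp01 t"
    using assms slope by (auto simp: clamp01_def min_def max_def)
  then show ?thesis using slope by (simp add: chord_def field_simps)
qed

text \<open>The indicator of the projection is replaced by \<open>1 / (2 * R)\<close> on the middle
  interval \<open>K\<close>, where \<open>chord\<close> is at least one half. \<open>K\<close> has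
  length 1, and together with its two shifts by 1 it covers the projection, so the shadow is at most
  three times that of \<open>K\<close>. The factor \<open>24 * R\<close> collects 3 for the shifts,
  \<open>2 * R\<close> for the height, 2 from the bound on \<open>super\<close> and 2 for the length
  \<open>1 + \<phi>\<close> of its support.\<close>

lemma mean_shadow_le_amp: "mean_shadow L \<mu> n v \<le> ennreal (24 * R * amp n)"
proof -
  define K where "K = {- \<phi> / 2..1 - \<phi> / 2}"
  define f where "f t = (1 / (2 * R)) * indicator K t" for t
  define U where "U K A = (\<Union>q\<in>A. {t. real L ^ n * t - v \<bullet> idx q \<in> K})" for K :: "real set" and A
  have K [measurable]: "K \<in> sets borel" by (simp add: K_def)
  have fm [measurable]: "f \<in> borel_measurable borel" unfolding f_def by measurable
  have R: "0 < 1 / (2 * R)" "1 / (2 * R) \<le> 1" using pos_consts by auto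
  have f1: "0 \<le> f t \<and> f t \<le> 1" for t using R by (auto simp: f_def indicator_def)
  have fc: "0 \<le> f t \<and> f t \<le> chord \<phi> t / R" for t
  proof (cases "t \<in> K")
    case True
    have "1 / 2 / R \<le> chord \<phi> t / R" using True mid_le_chord[of t] pos_consts unfolding K_def by (intro divide_right_mono) auto
    then show ?thesis using True f1[of t] by (simp add: f_def)
  next
    case False
    then show ?thesis using chord_bounds(1)[OF slope(1), of t] pos_consts by (simp add: f_def)
  qed
  have pw: "real L ^ n > 0" using L0 by simp
  define \<epsilon> where "\<epsilon> = 1 / real L ^ n"
  have cover: "emeasure lebesgue ((\<bullet>) v ` (\<Union>q\<in>A. grid_square L n q)) \<le> 3 * emeasure lborel (U K A)"
    if A: "finite A" for A
  proof -
    have Um: "U K A \<in> sets borel" unfolding U_def using A by (intro sets.finite_UN) auto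
    define V where "V a = (\<lambda>x. a + x) ` U K A" for a
    have tr: "V a \<in> sets borel" "emeasure lborel (V a) = emeasure lborel (U K A)" for a
      unfolding V_def
    proof -
      have "(\<lambda>x. a + x) ` U K A = (\<lambda>x. x - a) -` U K A \<inter> space borel"
        by (auto simp: image_iff algebra_simps) (metis add.commute diff_add_cancel)
      also have "\<dots> \<in> sets borel" using Um by (intro measurable_sets[of _ borel borel]) auto
      finally show *: "(\<lambda>x. a + x) ` U K A \<in> sets borel" .
      have "emeasure lebesgue ((\<lambda>x. a + x) ` U K A) = emeasure lebesgue (U K A)" using emeasure_lebesgue_affine[of 1 a "U K A"] by (simp add: add.commute)
      then show "emeasure lborel ((\<lambda>x. a + x) ` U K A) = emeasure lborel (U K A)"
        using * Um by simp
    qed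
    have "U (proj_interval v) A \<subseteq> U K A \<union> V (- \<epsilon>) \<union> V \<epsilon>"
    proof
      fix t assume "t \<in> U (proj_interval v) A"
      then obtain q where q: "q \<in> A" "real L ^ n * t - v \<bullet> idx q \<in> proj_interval v" by (auto simp: U_def)
      then have "- \<phi> \<le> real L ^ n * t - v \<bullet> idx q" "real L ^ n * t - v \<bullet> idx q \<le> 1"
        using slope by (auto simp: proj_interval_def low_end_def high_end_def)
      then consider "real L ^ n * t - v \<bullet> idx q \<in> K" | "real L ^ n * t - v \<bullet> idx q + 1 \<in> K"
        | "real L ^ n * t - v \<bullet> idx q - 1 \<in> K" using slope by (force simp: K_def)
      moreover have "real L ^ n * (t + \<epsilon>) = real L ^ n * t + 1" "real L ^ n * (t - \<epsilon>) = real L ^ n * t - 1"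
        using pw by (simp_all add: \<epsilon>_def algebra_simps)
      ultimately have "t \<in> U K A \<or> t + \<epsilon> \<in> U K A \<or> t - \<epsilon> \<in> U K A"
        using q(1) unfolding U_def by (cases; fastforce simp: algebra_simps)
      then show "t \<in> U K A \<union> V (- \<epsilon>) \<union> V \<epsilon>"
        by (auto simp: V_def image_iff algebra_simps) (metis add.commute add_diff_cancel diff_add_cancel)+
    qed
    then have "emeasure lborel (U (proj_interval v) A) \<le>
        emeasure lborel (U K A \<union> V (- \<epsilon>) \<union> V \<epsilon>)"
      using tr Um by (intro emeasure_mono) auto
    also have "\<dots> \<le> emeasure lborel (U K A \<union> V (- \<epsilon>)) + emeasure lborel (V \<epsilon>)"
      using tr Um by (intro emeasure_subadditive) auto
    also have "\<dots> \<le> emeasure lborel (U K A) + emeasure lborel (V (- \<epsilon>)) + emeasure lborel (V \<epsilon>)"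
      using tr Um by (intro add_right_mono emeasure_subadditive) auto
    also have "\<dots> = 3 * emeasure lborel (U K A)"
    proof -
      have "(3 :: ennreal) = 1 + 1 + 1" by simp
      then show ?thesis unfolding tr(2) by (simp only: distrib_right mult_1)
    qed
    finally show ?thesis unfolding emeasure_image_grid_squares[OF L0 A] U_def .
  qed
  have hit: "ennreal (1 / (2 * R)) * emeasure lborel (U K A) \<le>
      (\<integral>\<^sup>+t. ennreal (1 - (\<Prod>q\<in>A. 1 - f (real L ^ n * t - v \<bullet> idx q))) \<partial>lborel)"
    if A: "finite A" for A
  proof -
    have Um: "U K A \<in> sets borel" unfolding U_def using A by (intro sets.finite_UN) auto
    have "ennreal (1 / (2 * R)) * emeasure lborel (U K A) = (\<integral>\<^sup>+t. ennreal (1 / (2 * R)) * indicator (U K A) t \<partial>lborel)"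
      using Um by (simp add: nn_integral_cmult)
    also have "\<dots> \<le> (\<integral>\<^sup>+t. ennreal (1 - (\<Prod>q\<in>A. 1 - f (real L ^ n * t - v \<bullet> idx q))) \<partial>lborel)"
    proof (intro nn_integral_mono)
      fix t
      show "ennreal (1 / (2 * R)) * indicator (U K A) t \<le> ennreal (1 - (\<Prod>q\<in>A. 1 - f (real L ^ n * t - v \<bullet> idx q)))"
      proof (cases "t \<in> U K A")
        case True
        then obtain q where q: "q \<in> A" "real L ^ n * t - v \<bullet> idx q \<in> K" by (auto simp: U_def)
        have "(\<Prod>q\<in>A. 1 - f (real L ^ n * t - v \<bullet> idx q)) =
          (1 - f (real L ^ n * t - v \<bullet> idx q)) * (\<Prod>q\<in>A - {q}. 1 - f (real L ^ n * t - v \<bullet> idx q))"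
          using A q by (simp add: prod.remove)
        also have "\<dots> \<le> (1 - f (real L ^ n * t - v \<bullet> idx q)) * 1"
          using f1 by (intro mult_left_mono prod_one_minus_bounds) auto
        finally have "1 / (2 * R) \<le> 1 - (\<Prod>q\<in>A. 1 - f (real L ^ n * t - v \<bullet> idx q))"
          using q(2) by (simp add: f_def)
        then show ?thesis using True by (simp add: ennreal_leI)
      qed simp
    qed
    finally show ?thesis .
  qed
  have "ennreal (1 / (2 * R)) * mean_shadow L \<mu> n v =
    (\<integral>\<^sup>+A. ennreal (1 / (2 * R)) * emeasure lebesgue ((\<bullet>) v ` (\<Union>q\<in>A. grid_square L n q)) \<partial>measure_pmf (chosen_squares L \<mu> n))"
    by (simp add: mean_shadow_def nn_integral_cmult)
  also have "\<dots> \<le> (\<integral>\<^sup>+A. 3 * (\<integral>\<^sup>+t. ennreal (1 - (\<Prod>q\<in>A. 1 - f (real L ^ n * t - v \<bullet> idx q))) \<partial>lborel)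
      \<partial>measure_pmf (chosen_squares L \<mu> n))"
  proof (intro nn_integral_mono_AE, unfold AE_measure_pmf_iff, intro ballI)
    fix A assume "A \<in> set_pmf (chosen_squares L \<mu> n)"
    then have A: "finite A" by (rule finite_chosen_squares[OF selection])
    have "ennreal (1 / (2 * R)) * emeasure lebesgue ((\<bullet>) v ` (\<Union>q\<in>A. grid_square L n q)) \<le>
      ennreal (1 / (2 * R)) * (3 * emeasure lborel (U K A))" by (intro mult_left_mono cover A) simp
    also have "\<dots> = 3 * (ennreal (1 / (2 * R)) * emeasure lborel (U K A))" by (simp only: mult_ac)
    also have "\<dots> \<le> 3 * (\<integral>\<^sup>+t. ennreal (1 - (\<Prod>q\<in>A. 1 - f (real L ^ n * t - v \<bullet> idx q))) \<partial>lborel)"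
      by (intro mult_left_mono hit A) simp
    finally show "ennreal (1 / (2 * R)) * emeasure lebesgue ((\<bullet>) v ` (\<Union>q\<in>A. grid_square L n q)) \<le>
       3 * (\<integral>\<^sup>+t. ennreal (1 - (\<Prod>q\<in>A. 1 - f (real L ^ n * t - v \<bullet> idx q))) \<partial>lborel)" .
  qed
  also have "\<dots> = 3 * (\<integral>\<^sup>+t. ennreal ((hit_step L \<mu> v ^^ n) f t) \<partial>lborel)"
    unfolding nn_integral_funpow_hit_step[OF selection f1 fm, symmetric]
    by (rule nn_integral_cmult) simp
  also have "\<dots> \<le> 3 * (\<integral>\<^sup>+t. ennreal (2 * amp n) * indicator {- \<phi>..1} t \<partial>lborel)"
  proof (intro mult_left_mono nn_integral_mono)
    fix t
    have "(hit_step L \<mu> v ^^ n) f t \<le> 2 * amp n * sqrt (chord \<phi> t)"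
      using funpow_hit_step_le_super[OF fc] super_bounds(3) by (rule order_trans)
    also have "\<dots> \<le> 2 * amp n * indicator {- \<phi>..1} t"
      using chord_eq_0[OF slope(1), of t] chord_bounds[OF slope(1), of t] amp(1)[of n]
      by (cases "t \<in> {- \<phi>..1}") auto
    finally show "ennreal ((hit_step L \<mu> v ^^ n) f t) \<le> ennreal (2 * amp n) * indicator {- \<phi>..1} t"
      by (auto simp: indicator_def ennreal_leI ennreal_neg split: if_splits)
  qed simp
  also have "\<dots> = 3 * (ennreal (2 * amp n) * ennreal (1 + \<phi>))"
    using slope by (simp add: nn_integral_cmult)
  also have "\<dots> \<le> 3 * (ennreal (2 * amp n) * ennreal 2)"
    using slope by (intro mult_left_mono ennreal_leI) auto
  also have "\<dots> = ennreal (12 * amp n)"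
    using amp(1)[of n] by (simp add: ennreal_mult[symmetric] ennreal_numeral[symmetric] del: ennreal_numeral)
  finally have *: "ennreal (1 / (2 * R)) * mean_shadow L \<mu> n v \<le> ennreal (12 * amp n)" .
  have "mean_shadow L \<mu> n v = ennreal (2 * R) * (ennreal (1 / (2 * R)) * mean_shadow L \<mu> n v)"
    using pos_consts by (simp add: mult.assoc[symmetric] ennreal_mult[symmetric])
  also have "\<dots> \<le> ennreal (2 * R) * ennreal (12 * amp n)"
    by (intro mult_left_mono *) simp
  also have "\<dots> = ennreal (24 * R * amp n)"
    using pos_consts amp(1)[of n] by (simp add: ennreal_mult[symmetric] mult_ac)
  finally show ?thesis .
qed

theorem mean_shadow_bound:
  assumes "n \<ge> 1"
  shows "mean_shadow L \<mu> n v \<le> ennreal (27648 * real L ^ 3 * (1 + W) / (\<eta> * \<rho> * real n))"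
proof -
  have R: "R \<le> 3 * (1 + W)"
    using pos_consts params mult_right_mono[of c 1 W] by (simp add: R_def)
  have n: "real n > 0" using assms by simp
  \<comment> \<open>The constant is \<open>24 * 3 * 384\<close>: \<open>R\<close> is at most
    \<open>3 * (1 + W)\<close>, and \<open>1 / s\<close> equals
    \<open>384 * L^3 / (\<eta> * \<rho>)\<close>.\<close>
  have "24 * R * amp n \<le> 24 * (3 * (1 + W)) * (1 / (s * real n))"
    using R n pos_consts params amp(1)[of n] unfolding amp_def
    by (intro mult_mono divide_left_mono) (auto intro: add_pos_pos add_nonneg_nonneg)
  also have "\<dots> = 27648 * real L ^ 3 * (1 + W) / (\<eta> * \<rho> * real n)"
    using params n L0 by (simp add: s_def \<kappa>_def c_def field_simps)
  finally show ?thesis using mean_shadow_le_amp[of n] by (meson ennreal_leI order_trans)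
qed

end

section \<open>Branching rates of lines\<close>

lemma floor_diff_indicator:
  fixes y w :: real
  assumes "0 \<le> w" "w \<le> 1"
  shows "of_int (\<lfloor>y\<rfloor> - \<lfloor>y - w\<rfloor>) \<le> (if \<exists>z::int. of_int z \<le> y \<and> y \<le> of_int z + w then 1 else 0 :: real)"
proof -
  have le1: "\<lfloor>y\<rfloor> - \<lfloor>y - w\<rfloor> \<le> 1" using assms by linarith
  show ?thesis
  proof (cases "\<lfloor>y\<rfloor> \<le> \<lfloor>y - w\<rfloor>")
    case False
    then have "of_int \<lfloor>y\<rfloor> \<le> y \<and> y \<le> of_int \<lfloor>y\<rfloor> + w" by linarith
    then have "\<exists>z::int. of_int z \<le> y \<and> y \<le> of_int z + w" by blast
    then show ?thesis using le1 by (simp only: if_True of_int_le_1_iff)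
  next
    case True
    then have "of_int (\<lfloor>y\<rfloor> - \<lfloor>y - w\<rfloor>) \<le> (0 :: real)" by simp
    then show ?thesis by (auto split: if_split)
  qed
qed

text \<open>The window of length \<open>\<l>\<close> is filled with \<open>g\<close> subwindows of
  length \<open>\<delta>\<close>. A progression with step \<open>\<delta>\<close> visits each of
  them once per turn, hence at least \<open>\<delta> * N - 1\<close> times; differences of floors
  count these visits and telescope.\<close>

lemma count_progression_pos:
  fixes x \<delta> \<alpha> \<l> :: real and N :: nat
  assumes \<delta>: "0 < \<delta>" "\<delta> \<le> \<l>" and \<l>: "\<l> \<le> 1" and N: "2 \<le> \<delta> * real N"
  shows "\<l> * real N / 4 \<le> real (card {s. s < N \<and> (\<exists>z::int. \<alpha> + of_int z \<le> x + \<delta> * real s \<and> x + \<delta> * real s \<le> \<alpha> + \<l> + of_int z)})"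
proof -
  let ?S = "{s. s < N \<and> (\<exists>z::int. \<alpha> + of_int z \<le> x + \<delta> * real s \<and> x + \<delta> * real s \<le> \<alpha> + \<l> + of_int z)}"
  define g where "g = nat \<lfloor>\<l> / \<delta>\<rfloor>"
  have ld: "1 \<le> \<l> / \<delta>" using \<delta> by simp
  then have fl: "1 \<le> \<lfloor>\<l> / \<delta>\<rfloor>" by linarith
  then have "real g = of_int \<lfloor>\<l> / \<delta>\<rfloor>" by (simp add: g_def)
  then have g: "real g \<le> \<l> / \<delta>" "\<l> / \<delta> < real g + 1" "1 \<le> real g" using fl by linarith+
  have g\<delta>: "real g * \<delta> \<le> \<l>" using g(1) \<delta> by (simp add: field_simps)
  define F where "F i s = \<lfloor>x + \<delta> * real s - \<alpha> - real i * \<delta>\<rfloor>" for i s :: nat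
  have row: "\<delta> * real N - 1 \<le> of_int (\<Sum>s<N. F i s - F (Suc i) s)" for i
  proof -
    define G where "G s = \<lfloor>x + \<delta> * (real s - 1) - \<alpha> - real i * \<delta>\<rfloor>" for s
    \<comment> \<open>a shift by \<open>\<delta>\<close> leads to the preceding term of the progression\<close>
    have "F i s - F (Suc i) s = G (Suc s) - G s" for s
      by (simp add: F_def G_def algebra_simps)
    then have "(\<Sum>s<N. F i s - F (Suc i) s) = G N - G 0"
      by (simp add: sum_lessThan_telescope)
    moreover have "\<delta> * real N - 1 \<le> of_int (G N - G 0)"
      unfolding G_def by (simp add: algebra_simps) linarith
    ultimately show ?thesis by simp
  qed
  have "real g * (\<delta> * real N - 1) \<le> (\<Sum>i<g. of_int (\<Sum>s<N. F i s - F (Suc i) s))"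
    using sum_mono[of "{..<g}" "\<lambda>_. \<delta> * real N - 1", OF row] by simp
  also have "\<dots> = of_int (\<Sum>s<N. \<Sum>i<g. F i s - F (Suc i) s)"
    by (simp only: of_int_sum sum.swap[of _ "{..<N}"])
  also have "\<dots> = (\<Sum>s<N. of_int (F 0 s - F g s))"
    unfolding sum_lessThan_telescope'[of "\<lambda>i. F i s" g for s] by simp
  also have "\<dots> \<le> (\<Sum>s<N. if s \<in> ?S then 1 else 0)"
  proof (intro sum_mono)
    fix s assume s: "s \<in> {..<N}"
    have "of_int (F 0 s - F g s) \<le> (if \<exists>z::int. of_int z \<le> x + \<delta> * real s - \<alpha> \<and> x + \<delta> * real s - \<alpha> \<le> of_int z + real g * \<delta> then 1 else 0 :: real)"
      unfolding F_def using floor_diff_indicator[of "real g * \<delta>" "x + \<delta> * real s - \<alpha>"] g\<delta> \<delta> \<l> by simp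
    also have "\<dots> \<le> (if s \<in> ?S then 1 else 0)"
    proof (cases "\<exists>z::int. of_int z \<le> x + \<delta> * real s - \<alpha> \<and> x + \<delta> * real s - \<alpha> \<le> of_int z + real g * \<delta>")
      case True
      then obtain z :: int where "of_int z \<le> x + \<delta> * real s - \<alpha>" "x + \<delta> * real s - \<alpha> \<le> of_int z + real g * \<delta>" by blast
      then have "s \<in> ?S" using s g\<delta> by (auto intro!: exI[of _ z])
      then show ?thesis by simp
    next
      case False
      then show ?thesis by (subst if_not_P) (assumption, simp)
    qed
    finally show "of_int (F 0 s - F g s) \<le> (if s \<in> ?S then 1 else 0 :: real)" .
  qed
  also have "\<dots> = real (card ?S)"
    by (subst sum.inter_filter[symmetric]) (auto intro!: arg_cong[where f = card])
  finally have A: "real g * (\<delta> * real N - 1) \<le> real (card ?S)" .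
  \<comment> \<open>Each factor loses at most a half: \<open>g >= 1\<close> controls the rounding in
    \<open>g\<close>, and \<open>\<delta> * N >= 2\<close> controls the subtracted 1.\<close>
  have "\<l> / \<delta> / 2 * (\<delta> * real N / 2) \<le> real g * (\<delta> * real N - 1)"
    using g N \<delta> by (intro mult_mono) auto
  moreover have "\<l> / \<delta> / 2 * (\<delta> * real N / 2) = \<l> * real N / 4" using \<delta> by simp
  ultimately show ?thesis using A by simp
qed

lemma count_progression:
  fixes x \<gamma> \<alpha> \<l> :: real and N :: nat
  assumes \<gamma>: "0 < \<bar>\<gamma>\<bar>" "\<bar>\<gamma>\<bar> \<le> \<l>" and \<l>: "\<l> \<le> 1" and N: "2 \<le> \<bar>\<gamma>\<bar> * real N"
  shows "\<l> * real N / 4 \<le> real (card {s. s < N \<and> (\<exists>z::int. \<alpha> + of_int z \<le> x + \<gamma> * real s \<and> x + \<gamma> * real s \<le> \<alpha> + \<l> + of_int z)})"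
proof (cases "\<gamma> > 0")
  case True
  then show ?thesis using count_progression_pos[of \<gamma> \<l> N \<alpha> x] assms by simp
next
  case False
  define P where "P y \<longleftrightarrow> (\<exists>z::int. \<alpha> + of_int z \<le> y \<and> y \<le> \<alpha> + \<l> + of_int z)" for y
  \<comment> \<open>A decreasing progression is read backwards.\<close>
  have "\<l> * real N / 4 \<le> real (card {s. s < N \<and> P (x + \<gamma> * real (N - 1) + (- \<gamma>) * real s)})"
    unfolding P_def using False assms by (intro count_progression_pos) auto
  also have "card {s. s < N \<and> P (x + \<gamma> * real (N - 1) + (- \<gamma>) * real s)} = card {s. s < N \<and> P (x + \<gamma> * real s)}"
  proof (rule bij_betw_same_card[of "\<lambda>s. N - 1 - s"], rule bij_betw_byWitness[of _ "\<lambda>s. N - 1 - s"])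
    have e: "x + \<gamma> * real (N - 1) + (- \<gamma>) * real s = x + \<gamma> * real (N - 1 - s)"
      "x + \<gamma> * real (N - 1) + (- \<gamma>) * real (N - 1 - s) = x + \<gamma> * real s" "N - 1 - s < N" if "s < N" for s
      using that by (simp_all add: of_nat_diff algebra_simps)
    show "(\<lambda>s. N - 1 - s) ` {s. s < N \<and> P (x + \<gamma> * real (N - 1) + (- \<gamma>) * real s)} \<subseteq> {s. s < N \<and> P (x + \<gamma> * real s)}"
      by (intro image_subsetI CollectI) (metis (no_types, lifting) e(1,3) mem_Collect_eq)
    show "(\<lambda>s. N - 1 - s) ` {s. s < N \<and> P (x + \<gamma> * real s)} \<subseteq> {s. s < N \<and> P (x + \<gamma> * real (N - 1) + (- \<gamma>) * real s)}"
      by (intro image_subsetI CollectI) (metis (no_types, lifting) e(2,3) mem_Collect_eq)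
  qed auto
  finally show ?thesis by (simp add: P_def)
qed

text \<open>Along the multiples of \<open>q\<close> the rotation by \<open>\<theta>\<close> moves by
  the small step \<open>q * \<theta> - p\<close> modulo 1, so these terms form a slow progression;
  using only them costs the factor \<open>q\<close>.\<close>

lemma count_rotation:
  fixes x \<theta> \<alpha> \<l> :: real and N q :: nat and p :: int
  assumes q: "0 < q" and \<gamma>: "0 < \<bar>real q * \<theta> - of_int p\<bar>" "\<bar>real q * \<theta> - of_int p\<bar> \<le> \<l>" and \<l>: "\<l> \<le> 1"
    and N: "2 * real q \<le> \<bar>real q * \<theta> - of_int p\<bar> * real N"
  shows "\<l> * real N / (4 * real q) \<le> real (card {c. c < N \<and> (\<exists>z::int. \<alpha> + of_int z \<le> x + \<theta> * real c \<and> x + \<theta> * real c \<le> \<alpha> + \<l> + of_int z)})"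
proof -
  define \<gamma> where "\<gamma> = real q * \<theta> - of_int p"
  define P where "P y \<longleftrightarrow> (\<exists>z::int. \<alpha> + of_int z \<le> y \<and> y \<le> \<alpha> + \<l> + of_int z)" for y
  have P: "P (y + of_int i)" if Py: "P y" for y i
  proof -
    from Py obtain z :: int where "\<alpha> + of_int z \<le> y" "y \<le> \<alpha> + \<l> + of_int z" by (auto simp: P_def)
    then show ?thesis unfolding P_def by (intro exI[of _ "z + i"]) simp
  qed
  \<comment> \<open>The number of multiples of \<open>q\<close> below a positive \<open>N\<close>,
    zero included.\<close>
  define N' where "N' = (N - 1) div q + 1"
  have N0: "N > 0" using N q by (cases N) auto
  have "N \<le> q * N'"
  proof -
    have "N - 1 = q * ((N - 1) div q) + (N - 1) mod q" by simp
    also have "\<dots> < q * ((N - 1) div q) + q" using q by (intro add_strict_left_mono) simp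
    finally show ?thesis unfolding N'_def distrib_left mult_1_right using N0 by linarith
  qed
  then have "real N \<le> real q * real N'" by (metis of_nat_le_iff of_nat_mult)
  then have N': "real N / real q \<le> real N'" using q by (simp add: field_simps)
  have "2 \<le> \<bar>\<gamma>\<bar> * (real N / real q)" using N q by (simp add: \<gamma>_def field_simps)
  also have "\<dots> \<le> \<bar>\<gamma>\<bar> * real N'" using N' by (intro mult_left_mono) auto
  finally have "\<l> * real N' / 4 \<le> real (card {s. s < N' \<and> P (x + \<gamma> * real s)})"
    unfolding P_def using \<gamma> \<l> by (intro count_progression) (auto simp: \<gamma>_def)
  also have "\<dots> \<le> real (card {c. c < N \<and> P (x + \<theta> * real c)})"
  proof (intro of_nat_mono card_inj_on_le)
    show "inj_on ((*) q) {s. s < N' \<and> P (x + \<gamma> * real s)}" using q by (auto intro!: inj_onI)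
    show "(*) q ` {s. s < N' \<and> P (x + \<gamma> * real s)} \<subseteq> {c. c < N \<and> P (x + \<theta> * real c)}"
    proof (intro image_subsetI CollectI conjI)
      fix s assume s: "s \<in> {s. s < N' \<and> P (x + \<gamma> * real s)}"
      have "q * s \<le> q * ((N - 1) div q)" using s by (intro mult_left_mono) (auto simp: N'_def)
      also have "\<dots> \<le> N - 1" by simp
      finally show "q * s < N" using N0 by linarith
      have "x + \<theta> * real (q * s) = (x + \<gamma> * real s) + of_int (p * int s)"
        by (simp add: \<gamma>_def algebra_simps)
      then show "P (x + \<theta> * real (q * s))" using P[of "x + \<gamma> * real s" "p * int s"] s by (simp only: mem_Collect_eq)
    qed
  qed auto
  finally have "\<l> * real N' / 4 \<le> real (card {c. c < N \<and> P (x + \<theta> * real c)})" .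
  moreover have "\<l> * (real N / real q) / 4 \<le> \<l> * real N' / 4"
    using N' \<gamma> by (intro divide_right_mono mult_left_mono) auto
  ultimately show ?thesis by (simp add: P_def field_simps)
qed

text \<open>An interval of length \<open>w - u\<close> contains at least \<open>w - u - 1\<close>
  consecutive admissible indices. The last premise makes the smallest of them non-negative, so that
  it is a natural number.\<close>

lemma count_rotation_interval:
  fixes \<theta> \<alpha> \<l> \<xi> u w e :: real and q :: nat and p :: int
  assumes q: "0 < q" and \<gamma>: "0 < \<bar>real q * \<theta> - of_int p\<bar>" "\<bar>real q * \<theta> - of_int p\<bar> \<le> \<l>" and \<l>: "\<l> \<le> 1"
    and N: "2 * real q \<le> \<bar>real q * \<theta> - of_int p\<bar> * (w - u - 1)" and u: "- 1 < u - e"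
  shows "\<l> * (w - u - 1) / (4 * real q) \<le> real (card {c::nat. u \<le> real c + e \<and> real c + e \<le> w \<and>
    (\<exists>z::int. \<alpha> + of_int z \<le> \<xi> + \<theta> * real c \<and> \<xi> + \<theta> * real c \<le> \<alpha> + \<l> + of_int z)})"
proof -
  define P where "P y \<longleftrightarrow> (\<exists>z::int. \<alpha> + of_int z \<le> y \<and> y \<le> \<alpha> + \<l> + of_int z)" for y
  define c0 where "c0 = nat \<lceil>u - e\<rceil>"
  define N where "N = nat \<lfloor>w - e - real c0 + 1\<rfloor>"
  have c0: "u - e \<le> real c0" "real c0 < u - e + 1" using u unfolding c0_def by linarith+
  have "0 < w - u - 1"
  proof (rule ccontr)
    assume "\<not> 0 < w - u - 1"
    then have "\<bar>real q * \<theta> - of_int p\<bar> * (w - u - 1) \<le> 0" by (simp add: mult_nonneg_nonpos)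
    then show False using N q by simp
  qed
  then have Nr: "w - u - 1 \<le> real N" "real N \<le> w - e - real c0 + 1" using c0 unfolding N_def by linarith+
  have "2 * real q \<le> \<bar>real q * \<theta> - of_int p\<bar> * real N"
    using N Nr(1) by (meson abs_ge_zero mult_left_mono order_trans)
  from count_rotation[OF q \<gamma> \<l> this, of \<alpha> "\<xi> + \<theta> * real c0"]
  have "\<l> * real N / (4 * real q) \<le> real (card {c. c < N \<and> P (\<xi> + \<theta> * real c0 + \<theta> * real c)})"
    by (simp add: P_def)
  also have "\<dots> \<le> real (card {c::nat. u \<le> real c + e \<and> real c + e \<le> w \<and> P (\<xi> + \<theta> * real c)})"
  proof (intro of_nat_mono card_inj_on_le)
    show "inj_on ((+) c0) {c. c < N \<and> P (\<xi> + \<theta> * real c0 + \<theta> * real c)}" by simp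
    show "(+) c0 ` {c. c < N \<and> P (\<xi> + \<theta> * real c0 + \<theta> * real c)} \<subseteq> {c::nat. u \<le> real c + e \<and> real c + e \<le> w \<and> P (\<xi> + \<theta> * real c)}"
    proof (intro image_subsetI CollectI conjI)
      fix c assume c: "c \<in> {c. c < N \<and> P (\<xi> + \<theta> * real c0 + \<theta> * real c)}"
      show "u \<le> real (c0 + c) + e" using c0 by simp
      have "real c + 1 \<le> real N" using c by simp
      then show "real (c0 + c) + e \<le> w" using Nr(2) by simp
      show "P (\<xi> + \<theta> * real (c0 + c))" using c by (simp add: algebra_simps)
    qed
    have "{c::nat. u \<le> real c + e \<and> real c + e \<le> w \<and> P (\<xi> + \<theta> * real c)} \<subseteq> {..nat \<lceil>w - e\<rceil>}"
      by (auto simp: le_nat_iff) linarith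
    then show "finite {c::nat. u \<le> real c + e \<and> real c + e \<le> w \<and> P (\<xi> + \<theta> * real c)}"
      by (rule finite_subset) simp
  qed
  finally have "\<l> * real N / (4 * real q) \<le> real (card {c::nat. u \<le> real c + e \<and> real c + e \<le> w \<and> P (\<xi> + \<theta> * real c)})" .
  moreover have "\<l> * (w - u - 1) / (4 * real q) \<le> \<l> * real N / (4 * real q)"
    using Nr(1) \<gamma> by (intro divide_right_mono mult_left_mono) auto
  ultimately show ?thesis by (simp add: P_def)
qed

lemma card_nat_interval_le:
  fixes u w e :: real
  assumes "u \<le> w"
  shows "finite {c::nat. u \<le> real c + e \<and> real c + e \<le> w}" (is "finite ?C")
    and "real (card {c::nat. u \<le> real c + e \<and> real c + e \<le> w}) \<le> w - u + 1"
proof -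
  have sub: "int ` ?C \<subseteq> {\<lceil>u - e\<rceil>..\<lfloor>w - e\<rfloor>}" by (auto simp: ceiling_le_iff le_floor_iff)
  then have "finite (int ` ?C)" by (rule finite_subset) simp
  then show "finite ?C" by (simp add: finite_image_iff)
  have "card ?C = card (int ` ?C)" by (simp add: card_image)
  also have "\<dots> \<le> card {\<lceil>u - e\<rceil>..\<lfloor>w - e\<rfloor>}" using sub by (intro card_mono) auto
  also have "\<dots> = nat (\<lfloor>w - e\<rfloor> - \<lceil>u - e\<rceil> + 1)" by simp
  finally have "real (card ?C) \<le> real (nat (\<lfloor>w - e\<rfloor> - \<lceil>u - e\<rceil> + 1))" by simp
  also have "\<dots> \<le> w - u + 1" using assms by linarith
  finally show "real (card ?C) \<le> w - u + 1" .
qed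

section \<open>Lines that cross a column boundary\<close>

lemma chord_ge_quarter:
  assumes "0 < \<phi>" "\<phi> \<le> 1" "- 3 * \<phi> / 4 \<le> t" "t \<le> 1 - \<phi> / 4"
  shows "1 / 4 \<le> chord \<phi> t"
proof -
  have "\<phi> / 4 \<le> clamp01 (t + \<phi>) - clamp01 t"
    using assms by (auto simp: clamp01_def min_def max_def)
  then show ?thesis using assms by (simp add: chord_def field_simps)
qed

lemma chord_eq_1:
  assumes "0 < \<phi>" "0 \<le> t" "t \<le> 1 - \<phi>"
  shows "chord \<phi> t = 1"
  using assms by (auto simp: chord_def clamp01_def)

text \<open>The mean number of selected squares in \<open>G\<close> is \<open>1 + 1 / L\<close>, and
  the number never exceeds \<open>L\<close>; hence it is at least 2 with probability at least
  \<open>1 / (L * (L - 1))\<close>.\<close>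

lemma prob_two_hits:
  assumes u: "uniform_selection L \<mu>" and L: "L \<ge> 2" and G: "G \<subseteq> grid L 1" "card G = L + 1"
  shows "1 / real L ^ 2 \<le> measure_pmf.prob \<mu> {A. 2 \<le> card (A \<inter> G)}"
proof -
  note sel = uniform_imp_selection[OF u]
  note int = integrable_measure_pmf_finite[OF finite_set_pmf_selection[OF sel]]
  have fG: "finite G" using G(1) by (rule finite_subset) simp
  have "real (card (A \<inter> G)) = (\<Sum>d\<in>G. indicator {A. d \<in> A} A)" for A
    using fG by (simp add: indicator_def sum.inter_restrict[symmetric] Int_def conj_commute)
  then have "measure_pmf.expectation \<mu> (\<lambda>A. real (card (A \<inter> G))) = (\<Sum>d\<in>G. measure_pmf.prob \<mu> {A. d \<in> A})"
    by (simp add: Bochner_Integration.integral_sum int)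
  also have "\<dots> = (\<Sum>d\<in>G. 1 / real L)"
    using u G(1) by (intro sum.cong) (auto simp: uniform_selection_def)
  also have "\<dots> = (real L + 1) / real L" using G(2) by simp
  finally have E: "measure_pmf.expectation \<mu> (\<lambda>A. real (card (A \<inter> G))) = (real L + 1) / real L" .
  have "real (card (A \<inter> G)) \<le> 1 + (real L - 1) * indicator {A. 2 \<le> card (A \<inter> G)} A" if A: "A \<in> set_pmf \<mu>" for A
  proof -
    have "card (A \<inter> G) \<le> L"
      using card_mono[OF selection_imp_finite[OF sel A], of "A \<inter> G"] selectionD(2)[OF sel A] by simp
    then show ?thesis by (auto simp: indicator_def)
  qed
  then have "measure_pmf.expectation \<mu> (\<lambda>A. real (card (A \<inter> G))) \<le>
      measure_pmf.expectation \<mu> (\<lambda>A. 1 + (real L - 1) * indicator {A. 2 \<le> card (A \<inter> G)} A)"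
    by (intro integral_mono_AE int) (simp add: AE_measure_pmf_iff)
  also have "\<dots> = 1 + (real L - 1) * measure_pmf.prob \<mu> {A. 2 \<le> card (A \<inter> G)}"
    by (subst Bochner_Integration.integral_add) (auto simp: int)
  finally have "1 / real L \<le> (real L - 1) * measure_pmf.prob \<mu> {A. 2 \<le> card (A \<inter> G)}"
    using L unfolding E by (simp add: field_simps)
  also have "\<dots> \<le> real L * measure_pmf.prob \<mu> {A. 2 \<le> card (A \<inter> G)}"
    by (intro mult_right_mono) auto
  finally show ?thesis using L by (simp add: field_simps power2_eq_square)
qed

text \<open>
  Parameters of the lines crossing the boundary between the first two columns in the middle half of
  the second row; such a line meets at least \<open>L + 1\<close> squares, while the selection has only \<open>L\<close>.
\<close>

definition crossing_set :: "nat \<Rightarrow> real \<Rightarrow> real set" where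
  "crossing_set L \<phi> = {1 / real L - 7 * \<phi> / (4 * real L)..1 / real L - 5 * \<phi> / (4 * real L)}"

lemma crossing_set_chord:
  assumes L: "L \<ge> 2" and \<phi>: "0 < \<phi>" "\<phi> \<le> 1" and t: "t \<in> crossing_set L \<phi>"
  shows "1 / 4 \<le> chord \<phi> t"
proof (rule chord_ge_quarter[OF \<phi>])
  have "- 3 * \<phi> / 4 \<le> - 3 * \<phi> / (4 * real L)" using L \<phi> by (simp add: field_simps)
  also have "\<dots> = \<phi> / real L - 7 * \<phi> / (4 * real L)" using L by (simp add: field_simps)
  also have "\<dots> \<le> 1 / real L - 7 * \<phi> / (4 * real L)" using \<phi> by (intro diff_right_mono divide_right_mono) auto
  also have "\<dots> \<le> t" using t by (simp add: crossing_set_def)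
  finally show "- 3 * \<phi> / 4 \<le> t" .
  have "t \<le> 1 / real L - 5 * \<phi> / (4 * real L)" using t by (simp add: crossing_set_def)
  also have "\<dots> \<le> 1 / real L" using \<phi> by simp
  also have "\<dots> \<le> 1 / 2" using L by (simp add: field_simps)
  finally show "t \<le> 1 - \<phi> / 4" using \<phi> by simp
qed

text \<open>Every row contributes one square in which the line has a quarter of the full extent, and
  the second row contributes two because the line changes column in its middle half.\<close>

lemma crossing_set_children:
  assumes L: "L \<ge> 2" and \<phi>: "0 < \<phi>" "\<phi> \<le> 1" and t: "t \<in> crossing_set L \<phi>"
  shows "\<exists>G\<subseteq>grid L 1. card G = L + 1 \<and> (\<forall>d\<in>G. 1 / 4 \<le> chord \<phi> (real L * t - (1, - \<phi>) \<bullet> idx d))"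
proof -
  define \<sigma> where "\<sigma> j = real L * t + \<phi> * real j" for j
  \<comment> \<open>The floor puts the offset \<open>\<sigma> j - g j\<close> between
    \<open>- 3 * \<phi> / 4\<close> and \<open>1 - 3 * \<phi> / 4\<close>, inside the range of
    \<open>chord_ge_quarter\<close>.\<close>
  define g where "g j = nat \<lfloor>\<sigma> j + 3 * \<phi> / 4\<rfloor>" for j
  have Lt: "1 - 7 * \<phi> / 4 \<le> real L * t" "real L * t \<le> 1 - 5 * \<phi> / 4"
    using t L unfolding crossing_set_def by (auto simp: field_simps)
  have idx: "real L * t - (1, - \<phi>) \<bullet> idx (i, j) = \<sigma> j - real i" for i j
    by (simp add: idx_def \<sigma>_def)
  have lo: "0 \<le> \<sigma> j + 3 * \<phi> / 4" for j
  proof -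
    have "0 \<le> \<phi> * real j" using \<phi> by simp
    then show ?thesis using Lt \<phi> unfolding \<sigma>_def by linarith
  qed
  then have g: "real (g j) \<le> \<sigma> j + 3 * \<phi> / 4" "\<sigma> j + 3 * \<phi> / 4 < real (g j) + 1" for j
    unfolding g_def using lo[of j] by linarith+
  have gL: "g j < L" if "j < L" for j
  proof -
    have "\<phi> * real j \<le> \<phi> * (real L - 1)" using that \<phi> by (intro mult_left_mono) auto
    moreover have "\<phi> * (real L - 3 / 2) \<le> 1 * (real L - 3 / 2)" using L \<phi> by (intro mult_right_mono) auto
    ultimately have "real (g j) < real L"
      using g(1)[of j] Lt unfolding \<sigma>_def right_diff_distrib by linarith
    then show ?thesis by simp
  qed
  \<comment> \<open>Rows are numbered from 0, so 1 is the second row; there \<open>g\<close> selects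
    a column other than 0, which makes \<open>(0, 1)\<close> an additional square.\<close>
  have g1: "g 1 \<noteq> 0" using g(2)[of 1] Lt \<phi> unfolding \<sigma>_def by (intro notI) simp
  define G where "G = insert (0, 1) ((\<lambda>j. (g j, j)) ` {..<L})"
  have "(0, 1) \<notin> (\<lambda>j. (g j, j)) ` {..<L}" using g1 by auto
  moreover have "inj_on (\<lambda>j. (g j, j)) {..<L}" by (auto intro: inj_onI)
  ultimately have "card G = L + 1" by (simp add: G_def card_image)
  moreover have "G \<subseteq> grid L 1" using gL L by (auto simp: G_def grid_def)
  moreover have "1 / 4 \<le> chord \<phi> (real L * t - (1, - \<phi>) \<bullet> idx d)" if d: "d \<in> G" for d
  proof -
    consider "d = (0, 1)" | j where "d = (g j, j)" using d by (auto simp: G_def)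
    then show ?thesis
    proof cases
      case 1
      show ?thesis unfolding 1 idx using Lt \<phi> by (intro chord_ge_quarter) (auto simp: \<sigma>_def)
    next
      case 2
      show ?thesis unfolding 2 idx using g[of j] \<phi> by (intro chord_ge_quarter) auto
    qed
  qed
  ultimately show ?thesis by blast
qed

lemma funpow_mean_step_indicator:
  assumes "L > 0"
  shows "(mean_step L v ^^ k) (indicator J) t = real (card {q \<in> grid L k. real L ^ k * t - v \<bullet> idx q \<in> J}) / real L ^ k"
  unfolding funpow_mean_step[OF assms]
  by (simp add: indicator_def sum.inter_filter[symmetric] Int_def)

text \<open>In units of generation \<open>k\<close> squares, the quotient is the height at which the
  line reaches the first interior column boundary \<open>fst q + 1 / L\<close> of the square
  \<open>q\<close>. Membership says that this height lies in the middle half of the second of the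
  \<open>L\<close> rows inside \<open>q\<close>.\<close>

lemma crossing_set_iff:
  assumes "L > 0" "0 < \<phi>"
  shows "real L ^ k * t - (1, - \<phi>) \<bullet> idx q \<in> crossing_set L \<phi> \<longleftrightarrow>
    5 / (4 * real L) + real (snd q) \<le> (real (fst q) + 1 / real L - real L ^ k * t) / \<phi> \<and>
    (real (fst q) + 1 / real L - real L ^ k * t) / \<phi> \<le> 7 / (4 * real L) + real (snd q)"
proof -
  have "5 / (4 * real L) + y \<le> x / \<phi> \<longleftrightarrow> \<phi> * y - x \<le> - 5 * \<phi> / (4 * real L)"
       "x / \<phi> \<le> 7 / (4 * real L) + y \<longleftrightarrow> - 7 * \<phi> / (4 * real L) \<le> \<phi> * y - x" for x y
    using assms by (auto simp: field_simps)
  then show ?thesis unfolding crossing_set_def by (auto simp: idx_def algebra_simps)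
qed

text \<open>A geometric sum is at most twice its largest admissible term; the induction rescales
  \<open>x\<close> by \<open>L\<close>.\<close>

lemma sum_small_powers:
  assumes "L \<ge> 2"
  shows "(\<Sum>i<k. if 1 / real L ^ i \<le> x then 1 / real L ^ i else 0) \<le> 2 * max 0 x"
proof (induction k arbitrary: x)
  case (Suc k)
  have L: "real L \<ge> 2" using assms by simp
  have *: "(if 1 / real L ^ Suc i \<le> x then 1 / real L ^ Suc i else 0) =
      (if 1 / real L ^ i \<le> real L * x then 1 / real L ^ i else 0) / real L" for i
    using L by (simp add: field_simps)
  have eq: "(\<Sum>i<Suc k. if 1 / real L ^ i \<le> x then 1 / real L ^ i else 0) =
    (if 1 \<le> x then 1 else 0) + (\<Sum>i<k. if 1 / real L ^ i \<le> real L * x then 1 / real L ^ i else 0) / real L"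
    unfolding sum.lessThan_Suc_shift * by (simp add: sum_divide_distrib)
  show ?case
  proof (cases "1 \<le> x")
    case True
    have "(\<Sum>i<k. if 1 / real L ^ i \<le> real L * x then 1 / real L ^ i else 0) \<le> (\<Sum>i<k. (1 / 2) ^ i)"
    proof (intro sum_mono)
      fix i
      have "(1 / real L) ^ i \<le> (1 / 2) ^ i" using L by (intro power_mono) (auto simp: field_simps)
      then show "(if 1 / real L ^ i \<le> real L * x then 1 / real L ^ i else 0) \<le> (1 / 2) ^ i"
        by (auto simp: power_one_over)
    qed
    also have "\<dots> = 2 - 2 * (1 / 2 :: real) ^ k" by (induction k) (simp_all add: field_simps)
    also have "\<dots> \<le> 2" by simp
    finally have "(\<Sum>i<k. if 1 / real L ^ i \<le> real L * x then 1 / real L ^ i else 0) / real L \<le> 1"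
      using L by (simp add: field_simps)
    then show ?thesis unfolding eq using True by simp
  next
    case False
    have "(\<Sum>i<k. if 1 / real L ^ i \<le> real L * x then 1 / real L ^ i else 0) / real L \<le> 2 * max 0 (real L * x) / real L"
      using Suc.IH[of "real L * x"] L by (intro divide_right_mono) auto
    also have "2 * max 0 (real L * x) / real L = 2 * max 0 x" using L by (simp add: max_def mult_le_0_iff zero_le_mult_iff)
    finally show ?thesis unfolding eq using False by simp
  qed
qed simp

text \<open>Each column contains at most one counted square, so their number is at most that of the
  columns under the line, which is \<open>L^i * \<phi> * chord\<close> up to a rounding error of 1.
  The rounding error matters only if some square is counted, and then the invariance of
  \<open>chord\<close> forces \<open>chord \<phi> t >= 1 / (4 * L^i)\<close>.\<close>

lemma crossing_set_upper:
  assumes L: "L \<ge> 2" and \<phi>: "0 < \<phi>" "\<phi> \<le> 1"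
  shows "(mean_step L (1, - \<phi>) ^^ i) (indicator (crossing_set L \<phi>)) t \<le>
    \<phi> * chord \<phi> t + (if 1 / real L ^ i \<le> 4 * chord \<phi> t then 1 / real L ^ i else 0)"
proof -
  let ?v = "(1, - \<phi>)"
  have L0: "L > 0" using L by simp
  have pw: "real L ^ i > 0" using L0 by simp
  define D where "D = {q \<in> grid L i. real L ^ i * t - ?v \<bullet> idx q \<in> crossing_set L \<phi>}"
  have fD: "finite D" unfolding D_def by simp
  have ch: "0 \<le> chord \<phi> t" by (rule chord_bounds(1)[OF \<phi>(1)])
  define Y where "Y c = (real c + 1 / real L - real L ^ i * t) / \<phi>" for c
  have L7: "7 / (4 * real L) < 1" "0 < 5 / (4 * real L)" "7 / (4 * real L) - 5 / (4 * real L) < 1"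
    using L by (simp_all add: field_simps)
  have D: "q \<in> grid L i" "5 / (4 * real L) + real (snd q) \<le> Y (fst q)" "Y (fst q) \<le> 7 / (4 * real L) + real (snd q)"
    if "q \<in> D" for q
    using that unfolding D_def mem_Collect_eq crossing_set_iff[OF L0 \<phi>(1)] Y_def by blast+
  \<comment> \<open>For one column the admissible rows lie in a window of height less than
    1.\<close>
  have inj: "inj_on fst D"
  proof (rule inj_onI)
    fix q r assume qr: "q \<in> D" "r \<in> D" "fst q = fst r"
    have "real (snd q) < real (snd r) + 1" "real (snd r) < real (snd q) + 1"
      using D(2,3)[OF qr(1)] D(2,3)[OF qr(2)] L7(3) unfolding qr(3) by linarith+
    then show "q = r" using qr(3) by (simp add: prod_eq_iff)
  qed
  define u w where "u = real L ^ i * clamp01 t" and "w = real L ^ i * clamp01 (t + \<phi>)"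
  have uw: "w - u = real L ^ i * (\<phi> * chord \<phi> t)" using \<phi> by (simp add: u_def w_def chord_def right_diff_distrib[symmetric])
  have "u \<le> w" using uw pw \<phi> ch by (metis diff_ge_0_iff_ge less_imp_le mult_nonneg_nonneg)
  have "fst ` D \<subseteq> {c::nat. u \<le> real c + 1 / real L \<and> real c + 1 / real L \<le> w}"
  proof (intro image_subsetI CollectI)
    fix q assume q: "q \<in> D"
    have g: "fst q < L ^ i" "snd q < L ^ i" using D(1)[OF q] by (auto simp: grid_def)
    then have g': "real (fst q) + 1 \<le> real L ^ i" "real (snd q) + 1 \<le> real L ^ i"
      by (metis of_nat_Suc Suc_leI of_nat_le_iff of_nat_power add.commute)+
    have "0 \<le> Y (fst q)" "Y (fst q) \<le> real L ^ i" using D[OF q] L7 g' by linarith+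
    then have Y: "real L ^ i * t \<le> real (fst q) + 1 / real L" "real (fst q) + 1 / real L \<le> real L ^ i * t + real L ^ i * \<phi>"
      using \<phi> by (simp_all add: Y_def field_simps)
    have L1: "1 / real L \<le> 1" "0 \<le> 1 / real L" using L0 by auto
    have gen: "B * max 0 (min 1 x) \<le> max 0 (B * x)" "min B (B * x) \<le> B * max 0 (min 1 x)" if "B > 0" for B x :: real
      using that mult_nonneg_nonpos[of B x] by (auto simp: max_def min_def)
    have "u \<le> max 0 (real L ^ i * t)"
      unfolding u_def clamp01_def by (rule gen(1)[OF pw])
    moreover have "min (real L ^ i) (real L ^ i * t + real L ^ i * \<phi>) \<le> w"
      unfolding w_def clamp01_def distrib_left[symmetric] by (rule gen(2)[OF pw])
    moreover have "max 0 (real L ^ i * t) \<le> real (fst q) + 1 / real L"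
      using Y(1) by (intro max.boundedI add_nonneg_nonneg L1(2)) auto
    moreover have "real (fst q) + 1 / real L \<le> min (real L ^ i) (real L ^ i * t + real L ^ i * \<phi>)"
      using Y(2) g'(1) L1(1) by (intro min.boundedI) linarith+
    ultimately show "u \<le> real (fst q) + 1 / real L \<and> real (fst q) + 1 / real L \<le> w"
      by linarith
  qed
  then have "card (fst ` D) \<le> card {c::nat. u \<le> real c + 1 / real L \<and> real c + 1 / real L \<le> w}"
    by (rule card_mono[OF card_nat_interval_le(1)[OF \<open>u \<le> w\<close>]])
  then have "real (card D) \<le> w - u + 1"
    using card_nat_interval_le(2)[OF \<open>u \<le> w\<close>, of "1 / real L"] card_image[OF inj] by linarith
  then have c1: "real (card D) / real L ^ i \<le> \<phi> * chord \<phi> t + 1 / real L ^ i"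
    using pw unfolding uw by (simp add: field_simps)
  have c2: "1 / real L ^ i \<le> 4 * chord \<phi> t" if ne: "D \<noteq> {}"
  proof -
    obtain q where q: "q \<in> D" using ne by blast
    have "1 / 4 \<le> chord \<phi> (real L ^ i * t - ?v \<bullet> idx q)"
      using q crossing_set_chord[OF L \<phi>] by (simp add: D_def)
    also have "\<dots> \<le> (\<Sum>q\<in>grid L i. chord \<phi> (real L ^ i * t - ?v \<bullet> idx q))"
      using q chord_bounds(1)[OF \<phi>(1)] by (intro member_le_sum) (auto simp: D_def)
    also have "\<dots> = real L ^ i * chord \<phi> t"
      using funpow_mean_step_chord[OF L0 \<phi>(1), of i] funpow_mean_step[OF L0, where v = ?v and k = i and f = "chord \<phi>" and t = t] pw
      by (simp add: field_simps del: inner_Pair)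
    finally show ?thesis using pw by (simp add: field_simps)
  qed
  show ?thesis
  proof (cases "D = {}")
    case True
    then show ?thesis unfolding funpow_mean_step_indicator[OF L0] D_def[symmetric] using ch \<phi> by simp
  next
    case False
    then show ?thesis unfolding funpow_mean_step_indicator[OF L0] D_def[symmetric] using c1 c2 by simp
  qed
qed

lemma crossing_set_upper_sum:
  assumes L: "L \<ge> 2" and \<phi>: "0 < \<phi>" "\<phi> \<le> 1"
  shows "(\<Sum>i<k. (mean_step L (1, - \<phi>) ^^ i) (indicator (crossing_set L \<phi>)) t) \<le> (\<phi> * real k + 8) * chord \<phi> t"
proof -
  have "(\<Sum>i<k. (mean_step L (1, - \<phi>) ^^ i) (indicator (crossing_set L \<phi>)) t) \<le>
    (\<Sum>i<k. \<phi> * chord \<phi> t + (if 1 / real L ^ i \<le> 4 * chord \<phi> t then 1 / real L ^ i else 0))"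
    by (intro sum_mono crossing_set_upper assms)
  also have "\<dots> \<le> real k * (\<phi> * chord \<phi> t) + 2 * max 0 (4 * chord \<phi> t)"
    using sum_small_powers[OF L, of "4 * chord \<phi> t" k] by (simp add: sum.distrib)
  also have "\<dots> = (\<phi> * real k + 8) * chord \<phi> t"
    using chord_bounds(1)[OF \<phi>(1), of t] by (simp add: algebra_simps)
  finally show ?thesis .
qed

text \<open>From column to column the crossing height moves by \<open>1 / \<phi>\<close>, and the
  windows have length \<open>1 / (2 * L)\<close>. The rotation count with denominator
  \<open>q <= 2 * L\<close> finds a proportion \<open>1 / (16 * L^2)\<close> of the columns; the
  bound \<open>M - 1 >= M / 2\<close> costs another factor 2.\<close>

lemma crossing_set_lower:
  fixes p :: int
  assumes L: "L \<ge> 2" and \<phi>: "0 < \<phi>" "\<phi> \<le> 1" and q: "0 < q" "q \<le> 2 * L"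
    and \<delta>: "0 < \<bar>real q * (1 / \<phi>) - of_int p\<bar>" "\<bar>real q * (1 / \<phi>) - of_int p\<bar> \<le> 1 / (2 * real L)"
    and k: "5 * real L ^ 2 \<le> \<bar>real q * (1 / \<phi>) - of_int p\<bar> * (\<phi> * real L ^ k)"
    and t: "1 / real L < chord \<phi> t"
  shows "\<phi> / (32 * real L ^ 2) * chord \<phi> t \<le> (mean_step L (1, - \<phi>) ^^ k) (indicator (crossing_set L \<phi>)) t"
proof -
  let ?v = "(1, - \<phi>)" and ?\<delta> = "\<bar>real q * (1 / \<phi>) - of_int p\<bar>"
  have L0: "L > 0" using L by simp
  have pw: "real L ^ k > 0" using L0 by simp
  have L2: "real L \<ge> 2" using L by simp
  have L7: "7 / (4 * real L) < 1" "0 < 5 / (4 * real L)" "5 / (4 * real L) + 1 / (2 * real L) = 7 / (4 * real L)" "1 / real L < 1" "0 < 1 / real L"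
    using L by (simp_all add: field_simps)
  have \<delta>1: "?\<delta> \<le> 1" using \<delta>(2) L2 by (rule_tac order_trans[OF \<delta>(2)]) (simp add: field_simps)
  have "0 < chord \<phi> t" using t L7(5) by linarith
  then have t01: "- \<phi> < t" "t < 1" using chord_pos_iff[OF \<phi>(1), of t] by auto
  define u w where "u = real L ^ k * clamp01 t" and "w = real L ^ k * clamp01 (t + \<phi>)"
  define M where "M = real L ^ k * (\<phi> * chord \<phi> t)"
  have uw: "w - u = M" using \<phi> by (simp add: u_def w_def chord_def M_def right_diff_distrib[symmetric])
  have u: "0 \<le> u" "real L ^ k * t \<le> u" using pw t01 by (auto simp: u_def clamp01_def)
  have w: "w \<le> real L ^ k" "w \<le> real L ^ k * (t + \<phi>)" using pw t01 by (auto simp: w_def clamp01_def)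
  \<comment> \<open>The premise on \<open>k\<close> together with \<open>chord > 1 / L\<close>
    leaves \<open>5 * L\<close>, enough for the required \<open>2 * q <= 4 * L\<close> and the loss
    at the ends of the interval.\<close>
  have "5 * real L = 5 * real L ^ 2 / real L" using L0 by (simp add: power2_eq_square)
  also have "\<dots> \<le> ?\<delta> * (\<phi> * real L ^ k) / real L" using k by (intro divide_right_mono) auto
  also have "\<dots> = ?\<delta> * (\<phi> * real L ^ k) * (1 / real L)" by simp
  also have "\<dots> \<le> ?\<delta> * (\<phi> * real L ^ k) * chord \<phi> t" using t \<phi> pw by (intro mult_left_mono) auto
  finally have M5: "5 * real L \<le> ?\<delta> * M" by (simp add: M_def mult_ac)
  then have M0: "0 \<le> M" using \<delta>(1) L2 by (smt (verit) mult_pos_neg)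
  have "?\<delta> * M \<le> 1 * M" using \<delta>1 M0 by (rule mult_right_mono)
  then have M2: "2 \<le> M" using M5 L2 by simp
  have "2 * real q \<le> ?\<delta> * M - ?\<delta>" using M5 \<delta>1 L2 q(2) by linarith
  then have N: "2 * real q \<le> ?\<delta> * (w - u - 1)" unfolding uw by (simp add: right_diff_distrib)
  \<comment> \<open>Columns whose crossing height lies in the window modulo 1; the integer
    \<open>z\<close> becomes the row.\<close>
  define C where "C = {c::nat. u \<le> real c + 1 / real L \<and> real c + 1 / real L \<le> w \<and>
    (\<exists>z::int. 5 / (4 * real L) + of_int z \<le> (1 / real L - real L ^ k * t) / \<phi> + 1 / \<phi> * real c \<and>
      (1 / real L - real L ^ k * t) / \<phi> + 1 / \<phi> * real c \<le> 5 / (4 * real L) + 1 / (2 * real L) + of_int z)}"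
  have cnt: "1 / (2 * real L) * (M - 1) / (4 * real q) \<le> real (card C)"
    unfolding C_def uw[symmetric]
  proof (rule count_rotation_interval[OF q(1) \<delta> _ N])
    show "1 / (2 * real L) \<le> 1" using L2 by simp
    show "- 1 < u - 1 / real L" using u(1) L7(4) by linarith
  qed
  define D where "D = {q \<in> grid L k. real L ^ k * t - ?v \<bullet> idx q \<in> crossing_set L \<phi>}"
  have "C \<subseteq> fst ` D"
  proof
    fix c assume "c \<in> C"
    then obtain z :: int where c: "u \<le> real c + 1 / real L" "real c + 1 / real L \<le> w" and
      z0: "5 / (4 * real L) + of_int z \<le> (1 / real L - real L ^ k * t) / \<phi> + 1 / \<phi> * real c"
         "(1 / real L - real L ^ k * t) / \<phi> + 1 / \<phi> * real c \<le> 5 / (4 * real L) + 1 / (2 * real L) + of_int z"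
      unfolding C_def by blast
    define Y where "Y = (real c + 1 / real L - real L ^ k * t) / \<phi>"
    have "(1 / real L - real L ^ k * t) / \<phi> + 1 / \<phi> * real c = Y"
      using \<phi> by (simp add: Y_def add_divide_distrib diff_divide_distrib)
    with z0 have z: "5 / (4 * real L) + of_int z \<le> Y" "Y \<le> 7 / (4 * real L) + of_int z"
      using L7(3) by simp_all
    have "0 \<le> Y" unfolding Y_def using c(1) u(2) \<phi> by (intro divide_nonneg_pos) auto
    have "Y \<le> (real L ^ k * \<phi>) / \<phi>"
      unfolding Y_def using c(2) w(2) \<phi> by (intro divide_right_mono) (auto simp: algebra_simps)
    then have "Y \<le> real L ^ k" using \<phi> by simp
    have "- 1 < (of_int z :: real)" using z(2) \<open>0 \<le> Y\<close> L7(1) by linarith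
    then have z0: "0 \<le> z" by simp
    then have zr: "real (nat z) = of_int z" by simp
    have "real (nat z) < real (L ^ k)"
      using z(1) \<open>Y \<le> real L ^ k\<close> L7(2) unfolding zr of_nat_power by linarith
    moreover have "real c < real (L ^ k)" using c(2) w(1) L7(5) unfolding of_nat_power by linarith
    ultimately have "(c, nat z) \<in> grid L k" by (simp add: grid_def del: of_nat_power)
    moreover have "real L ^ k * t - ?v \<bullet> idx (c, nat z) \<in> crossing_set L \<phi>"
      unfolding crossing_set_iff[OF L0 \<phi>(1)] using z zr by (simp add: Y_def)
    ultimately have "(c, nat z) \<in> D" by (simp only: D_def mem_Collect_eq)
    then show "c \<in> fst ` D" by (rule image_eqI[rotated]) simp
  qed
  moreover have fD: "finite D" unfolding D_def by simp
  ultimately have "card C \<le> card D" by (meson card_image_le card_mono finite_imageI order_trans)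
  with cnt have "1 / (2 * real L) * (M - 1) / (4 * real q) \<le> real (card D)" by linarith
  moreover have "M / (32 * real L ^ 2) \<le> 1 / (2 * real L) * (M - 1) / (4 * real q)"
  proof -
    have "M / (32 * real L ^ 2) = (M / 2) / (16 * real L ^ 2)" by simp
    also have "\<dots> \<le> (M - 1) / (16 * real L ^ 2)" using M2 by (intro divide_right_mono) auto
    also have "\<dots> \<le> (M - 1) / (8 * real L * real q)"
    proof (intro divide_left_mono)
      have "8 * real L * real q \<le> 8 * real L * (2 * real L)" using q(2) by (intro mult_left_mono) auto
      then show "8 * real L * real q \<le> 16 * real L ^ 2" by (simp add: power2_eq_square)
    qed (use M2 q(1) L0 in auto)
    also have "\<dots> = 1 / (2 * real L) * (M - 1) / (4 * real q)" by simp
    finally show ?thesis .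
  qed
  ultimately have "M / (32 * real L ^ 2) / real L ^ k \<le> real (card D) / real L ^ k"
    using pw by (intro divide_right_mono) auto
  moreover have "M / (32 * real L ^ 2) / real L ^ k = \<phi> / (32 * real L ^ 2) * chord \<phi> t"
    using pw by (simp add: M_def)
  ultimately show ?thesis unfolding funpow_mean_step_indicator[OF L0] D_def by simp
qed

text \<open>
  The heights at which a line crosses the column boundaries form an orbit of the rotation by \<open>1 / \<phi>\<close>.
  It may miss the middle halves of the rows when \<open>1 / \<phi>\<close> is too close to a rational \<open>p / q\<close> with small \<open>q\<close>.
\<close>

definition bad_slope :: "nat \<Rightarrow> nat \<Rightarrow> real \<Rightarrow> bool" where
  "bad_slope L k \<phi> \<longleftrightarrow> (\<exists>q\<in>{1..2 * L}. \<exists>p::nat. 1 \<le> p \<and> real p * \<phi> \<le> 3 * real L \<and>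
     \<bar>real q - real p * \<phi>\<bar> * real L ^ k < 5 * real L ^ 2)"

text \<open>Dirichlet approximation with denominators up to \<open>2 * L\<close> makes the rotation
  step shorter than the window \<open>1 / (2 * L)\<close>. The negation of \<open>bad_slope\<close>
  prevents the step from being so short that the orbit makes too few turns in \<open>k\<close>
  generations.\<close>

lemma not_bad_slope_approx:
  assumes L: "L \<ge> 2" and \<phi>: "0 < \<phi>" "\<phi> \<le> 1" and good: "\<not> bad_slope L k \<phi>"
  obtains q :: nat and p :: int where "0 < q" "q \<le> 2 * L" "0 < \<bar>real q * (1 / \<phi>) - of_int p\<bar>"
    "\<bar>real q * (1 / \<phi>) - of_int p\<bar> \<le> 1 / (2 * real L)"
    "5 * real L ^ 2 \<le> \<bar>real q * (1 / \<phi>) - of_int p\<bar> * (\<phi> * real L ^ k)"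
proof -
  have L2: "real L \<ge> 2" using L by simp
  have "0 < 2 * L" using L by simp
  then obtain h m where hm: "0 < m" "m \<le> int (2 * L)" "\<bar>of_int m * (1 / \<phi>) - of_int h\<bar> < 1 / real (2 * L)"
    by (rule Dirichlet_approx)
  define q where "q = nat m"
  have q: "0 < q" "q \<le> 2 * L" "of_int m = real q" using hm by (auto simp: q_def)
  have d: "\<bar>real q * (1 / \<phi>) - of_int h\<bar> < 1 / (2 * real L)" using hm(3) q(3) by simp
  have d1: "1 / (2 * real L) \<le> 1 / 4" using L2 by (simp add: field_simps)
  have "1 \<le> real q * (1 / \<phi>)" using q(1) \<phi> by (simp add: field_simps)
  then have h0: "0 < h" using d d1 by linarith
  define p where "p = nat h"
  have p: "1 \<le> p" "of_int h = real p" using h0 by (auto simp: p_def)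
  have e: "\<bar>real q * (1 / \<phi>) - of_int h\<bar> * \<phi> = \<bar>real q - real p * \<phi>\<bar>"
  proof -
    have "\<bar>real q * (1 / \<phi>) - of_int h\<bar> * \<phi> = \<bar>(real q * (1 / \<phi>) - of_int h) * \<phi>\<bar>" using \<phi> by (simp add: abs_mult)
    also have "(real q * (1 / \<phi>) - of_int h) * \<phi> = real q - real p * \<phi>" using \<phi> p(2) by (simp add: left_diff_distrib)
    finally show ?thesis .
  qed
  have "\<bar>real q - real p * \<phi>\<bar> \<le> 1 * 1" unfolding e[symmetric] using d d1 \<phi> by (intro mult_mono) auto
  \<comment> \<open>This is the origin of the bound \<open>3 * L\<close> in
    \<open>bad_slope\<close>: \<open>p * \<phi>\<close> differs from \<open>q <= 2 * L\<close> by at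
    most 1.\<close>
  then have p\<phi>: "real p * \<phi> \<le> 3 * real L" using q(2) L2 by linarith
  have "5 * real L ^ 2 \<le> \<bar>real q - real p * \<phi>\<bar> * real L ^ k"
  proof (rule ccontr)
    assume "\<not> ?thesis"
    then have lt: "\<bar>real q - real p * \<phi>\<bar> * real L ^ k < 5 * real L ^ 2" by (rule not_le_imp_less)
    have "q \<in> {1..2 * L}" using q by simp
    then have "bad_slope L k \<phi>"
      unfolding bad_slope_def by (rule bexI[rotated]) (intro exI[of _ p] conjI p(1) p\<phi> lt)
    then show False using good by contradiction
  qed
  then have f: "5 * real L ^ 2 \<le> \<bar>real q * (1 / \<phi>) - of_int h\<bar> * (\<phi> * real L ^ k)"
    unfolding e[symmetric] by (simp add: mult.assoc)
  then have "real q * (1 / \<phi>) - of_int h \<noteq> 0" using L by (intro notI) simp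
  then show thesis using that[of q h] q d f by simp
qed

text \<open>Here \<open>W\<close> is of order \<open>\<phi> * k + 1\<close> and
  \<open>\<rho>\<close> of order \<open>\<phi>\<close>, so \<open>(1 + W) / \<rho>\<close> is of
  order \<open>1 / \<phi> + k\<close>.\<close>

theorem mean_shadow_uniform_rate:
  assumes u: "uniform_selection L \<mu>" and L: "L \<ge> 2" and \<phi>: "0 < \<phi>" "\<phi> \<le> 1"
    and good: "\<not> bad_slope L k \<phi>" and n: "n \<ge> 1"
  shows "mean_shadow L \<mu> n (1, - \<phi>) \<le> ennreal (7962624 * real L ^ 7 * (1 / \<phi> + real k) / real n)"
proof -
  obtain q :: nat and p :: int where qp: "0 < q" "q \<le> 2 * L" "0 < \<bar>real q * (1 / \<phi>) - of_int p\<bar>"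
    "\<bar>real q * (1 / \<phi>) - of_int p\<bar> \<le> 1 / (2 * real L)"
    "5 * real L ^ 2 \<le> \<bar>real q * (1 / \<phi>) - of_int p\<bar> * (\<phi> * real L ^ k)"
    using not_bad_slope_approx[OF L \<phi> good] .
  have L2: "real L \<ge> 2" using L by simp
  have L4: "1 \<le> real L ^ 2" using L2 by (intro one_le_power) simp
  interpret branching_rate L \<mu> \<phi> "crossing_set L \<phi>" k "\<phi> * real k + 8" "\<phi> / (32 * real L ^ 2)" "1 / real L ^ 2"
  proof
    show "\<exists>G\<subseteq>grid L 1. 1 / real L ^ 2 \<le> measure_pmf.prob \<mu> {A. 2 \<le> card (A \<inter> G)} \<and>
        (\<forall>d\<in>G. 1 / 4 \<le> chord \<phi> (real L * t - (1, - \<phi>) \<bullet> idx d))" if "t \<in> crossing_set L \<phi>" for t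
      using crossing_set_children[OF L \<phi> that] prob_two_hits[OF u L] by blast
    show "(\<Sum>i<k. (mean_step L (1, - \<phi>) ^^ i) (indicator (crossing_set L \<phi>)) t) \<le> (\<phi> * real k + 8) * chord \<phi> t" for t
      by (rule crossing_set_upper_sum[OF L \<phi>])
    show "\<phi> / (32 * real L ^ 2) * chord \<phi> t \<le> (mean_step L (1, - \<phi>) ^^ k) (indicator (crossing_set L \<phi>)) t"
      if "1 / real L < chord \<phi> t" for t by (rule crossing_set_lower[OF L \<phi> qp that])
    show "\<phi> / (32 * real L ^ 2) \<le> 1" using \<phi> L4 by (simp add: divide_le_eq)
    show "1 / real L ^ 2 \<le> 1" using L4 by (simp add: divide_le_eq)
  qed (use u L \<phi> in auto)
  have n0: "real n > 0" using n by simp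
  \<comment> \<open>\<open>884736\<close> is \<open>27648 * 32\<close>, and the 9 is
    \<open>1 + 8\<close> from \<open>1 + W\<close>.\<close>
  have "27648 * real L ^ 3 * (1 + (\<phi> * real k + 8)) / (1 / real L ^ 2 * (\<phi> / (32 * real L ^ 2)) * real n) =
    884736 * real L ^ 7 * (9 / \<phi> + real k) / real n"
    using \<phi> n0 L2 by (simp add: field_simps eval_nat_numeral)
  also have "\<dots> \<le> 884736 * real L ^ 7 * (9 * (1 / \<phi> + real k)) / real n"
    using \<phi> by (intro divide_right_mono mult_left_mono) auto
  also have "\<dots> = 7962624 * real L ^ 7 * (1 / \<phi> + real k) / real n" by simp
  finally show ?thesis by (rule order_trans[OF mean_shadow_bound[OF n] ennreal_leI])
qed

text \<open>A line that stays in column \<open>i0\<close> has full extent in two squares of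
  \<open>A0\<close>. Visits are now counted by rows: from row to row the line moves sideways by
  \<open>\<phi>\<close>, which is itself a step no longer than the window, so the arithmetic of the
  slope does not enter and \<open>\<rho>\<close> is independent of \<open>\<phi>\<close>. The
  premise on \<open>k\<close> lets the line traverse enough columns of generation
  \<open>k\<close>.\<close>

theorem mean_shadow_column_rate:
  assumes u: "uniform_selection L \<mu>" and L: "L \<ge> 2"
    and A0: "A0 \<in> set_pmf \<mu>" "(i0, j1) \<in> A0" "(i0, j2) \<in> A0" "j1 \<noteq> j2"
    and \<phi>: "0 < \<phi>" "\<phi> \<le> 1 / (2 * real L)" and k: "4 * real L \<le> \<phi> * real L ^ k" and n: "n \<ge> 1"
  shows "mean_shadow L \<mu> n (1, - \<phi>) \<le> ennreal (442368 * real L ^ 4 / pmf \<mu> A0 * (1 + real k) / real n)"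
proof -
  let ?v = "(1, - \<phi>)"
  \<comment> \<open>the lines staying in column \<open>i0\<close> from bottom to top\<close>
  define J where "J = {real i0 / real L..(real i0 + 1) / real L - \<phi>}"
  have L0: "L > 0" and L2: "real L \<ge> 2" using L by simp_all
  have pw: "real L ^ k > 0" using L0 by simp
  have \<phi>L: "\<phi> * (2 * real L) \<le> 1" using \<phi>(2) L0 by (simp add: field_simps)
  moreover have "\<phi> * 4 \<le> \<phi> * (2 * real L)" using L2 \<phi>(1) by (intro mult_left_mono) auto
  ultimately have \<phi>14: "\<phi> \<le> 1 / 4" by linarith
  have A0g: "A0 \<subseteq> grid L 1" by (rule selectionD(1)[OF uniform_imp_selection[OF u] A0(1)])
  have "(i0, j1) \<in> grid L 1" using A0g A0(2) by (rule subsetD)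
  then have i0: "real i0 + 1 \<le> real L" by (simp add: grid_def)
  have Jc: "chord \<phi> t = 1" if "t \<in> J" for t
  proof (rule chord_eq_1[OF \<phi>(1)])
    show "0 \<le> t" using that by (intro order_trans[of 0 "real i0 / real L" t]) (auto simp: J_def)
    have "(real i0 + 1) / real L \<le> 1" using i0 L0 by simp
    then show "t \<le> 1 - \<phi>" using that by (simp add: J_def)
  qed
  interpret branching_rate L \<mu> \<phi> J k "real k" "1 / (16 * real L)" "pmf \<mu> A0"
  proof
    show "0 < pmf \<mu> A0" using A0(1) by (simp add: pmf_positive)
    show "pmf \<mu> A0 \<le> 1" by (rule pmf_le_1)
    show "\<exists>G\<subseteq>grid L 1. pmf \<mu> A0 \<le> measure_pmf.prob \<mu> {A. 2 \<le> card (A \<inter> G)} \<and>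
        (\<forall>d\<in>G. 1 / 4 \<le> chord \<phi> (real L * t - ?v \<bullet> idx d))" if t: "t \<in> J" for t
    proof (intro exI conjI ballI)
      show "{(i0, j1), (i0, j2)} \<subseteq> grid L 1" using A0g A0(2,3) by auto
      have "A0 \<inter> {(i0, j1), (i0, j2)} = {(i0, j1), (i0, j2)}" using A0(2,3) by auto
      then have "2 \<le> card (A0 \<inter> {(i0, j1), (i0, j2)})" using A0(4) by simp
      then have "measure_pmf.prob \<mu> {A0} \<le> measure_pmf.prob \<mu> {A. 2 \<le> card (A \<inter> {(i0, j1), (i0, j2)})}"
        by (intro measure_pmf.finite_measure_mono) auto
      then show "pmf \<mu> A0 \<le> measure_pmf.prob \<mu> {A. 2 \<le> card (A \<inter> {(i0, j1), (i0, j2)})}"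
        by (simp add: measure_pmf_single)
      fix d assume d: "d \<in> {(i0, j1), (i0, j2)}"
      then have "d \<in> grid L 1" using A0g A0(2,3) by auto
      then have s: "real (snd d) + 1 \<le> real L" by (auto simp: grid_def)
      have f: "fst d = i0" using d by auto
      have t': "real i0 \<le> real L * t" "real L * t \<le> real i0 + 1 - real L * \<phi>"
        using t L0 by (auto simp: J_def field_simps)
      have "\<phi> * (real (snd d) + 1) \<le> \<phi> * real L" using s \<phi> by (intro mult_left_mono) auto
      moreover have "0 \<le> \<phi> * real (snd d)" using \<phi> by simp
      moreover have "real L * t - ?v \<bullet> idx d = real L * t - real i0 + \<phi> * real (snd d)"
        by (simp add: idx_def f)
      ultimately have "0 \<le> real L * t - ?v \<bullet> idx d" "real L * t - ?v \<bullet> idx d \<le> 1 - \<phi>"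
        using t' unfolding distrib_left mult.commute[of "real L" \<phi>] by linarith+
      then have "chord \<phi> (real L * t - ?v \<bullet> idx d) = 1" by (rule chord_eq_1[OF \<phi>(1)])
      then show "1 / 4 \<le> chord \<phi> (real L * t - ?v \<bullet> idx d)" by simp
    qed
    show "(\<Sum>i<k. (mean_step L ?v ^^ i) (indicator J) t) \<le> real k * chord \<phi> t" for t
    proof -
      \<comment> \<open>\<open>chord\<close> equals 1 on \<open>J\<close>, so its invariance bounds
        every iterate.\<close>
      have "(mean_step L ?v ^^ i) (indicator J) t \<le> chord \<phi> t" for i
      proof -
        have "(mean_step L ?v ^^ i) (indicator J) t \<le> (mean_step L ?v ^^ i) (chord \<phi>) t"
          unfolding funpow_mean_step[OF L0] using Jc chord_bounds(1)[OF \<phi>(1)] pw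
          by (intro divide_right_mono sum_mono) (auto simp: indicator_def)
        then show ?thesis by (simp add: funpow_mean_step_chord[OF L0 \<phi>(1)])
      qed
      from sum_mono[of "{..<k}", OF this] show ?thesis by simp
    qed
    show "1 / (16 * real L) * chord \<phi> t \<le> (mean_step L ?v ^^ k) (indicator J) t" if t: "1 / real L < chord \<phi> t" for t
    proof -
      have "0 < chord \<phi> t" using t L0 by (meson less_trans of_nat_0_less_iff zero_less_divide_1_iff)
      then have t01: "- \<phi> < t" "t < 1" using chord_pos_iff[OF \<phi>(1), of t] by auto
      define u w where "u = real L ^ k * ((max 0 t - t) / \<phi>)" and "w = real L ^ k * ((min 1 (t + \<phi>) - t) / \<phi>)"
      define M where "M = real L ^ k * chord \<phi> t"
      have uw: "w - u = M"
        using t01 by (simp add: u_def w_def M_def chord_def clamp01_def right_diff_distrib[symmetric] diff_divide_distrib[symmetric])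
      have u: "0 \<le> u" "0 \<le> real L ^ k * t + \<phi> * u"
      proof -
        show "0 \<le> u" unfolding u_def using pw \<phi> by (intro mult_nonneg_nonneg divide_nonneg_pos) auto
        have "\<phi> * u = real L ^ k * (max 0 t - t)" using \<phi> by (simp add: u_def)
        then show "0 \<le> real L ^ k * t + \<phi> * u" using pw by (simp add: algebra_simps)
      qed
      have w: "w \<le> real L ^ k" "real L ^ k * t + \<phi> * w \<le> real L ^ k"
      proof -
        have "(min 1 (t + \<phi>) - t) / \<phi> \<le> 1" using \<phi> by (simp add: divide_le_eq)
        then have "real L ^ k * ((min 1 (t + \<phi>) - t) / \<phi>) \<le> real L ^ k * 1"
          using pw by (intro mult_left_mono) auto
        then show "w \<le> real L ^ k" unfolding w_def by (simp only: mult_1_right)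
        have "\<phi> * w = real L ^ k * (min 1 (t + \<phi>) - t)" using \<phi> by (simp add: w_def)
        then have "real L ^ k * t + \<phi> * w = real L ^ k * min 1 (t + \<phi>)" by (simp add: algebra_simps)
        also have "\<dots> \<le> real L ^ k * 1" using pw by (intro mult_left_mono) auto
        finally show "real L ^ k * t + \<phi> * w \<le> real L ^ k" by simp
      qed
      have "4 = 4 * real L * (1 / real L)" using L0 by simp
      also have "\<dots> \<le> \<phi> * real L ^ k * chord \<phi> t" using \<phi> pw by (intro mult_mono[OF k less_imp_le[OF t]]) auto
      finally have M4: "4 \<le> \<phi> * M" by (simp add: M_def mult.assoc)
      have "0 < M" using \<open>0 < chord \<phi> t\<close> pw by (simp add: M_def)
      then have "\<phi> * M \<le> 1 * M" using \<phi>14 by (intro mult_right_mono) auto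
      then have M4': "4 \<le> M" using M4 by simp
      \<comment> \<open>Half of the column width; the other half leaves room for the sideways drift
        \<open>\<phi>\<close> within the square.\<close>
      define l where "l = 1 / (2 * real L)"
      have l: "\<phi> \<le> l" "l \<le> 1" "0 < l" using \<phi>(2) L2 by (auto simp: l_def field_simps)
      \<comment> \<open>The rotation by \<open>\<phi>\<close> is used directly, that is with
        \<open>q = 1\<close> and \<open>p = 0\<close>; the bound \<open>w - 1\<close> keeps row
        \<open>m\<close> inside the grid.\<close>
      define C where "C = {m::nat. u \<le> real m + 0 \<and> real m + 0 \<le> w - 1 \<and>
        (\<exists>z::int. real i0 / real L + of_int z \<le> real L ^ k * t + \<phi> * real m \<and> real L ^ k * t + \<phi> * real m \<le> real i0 / real L + l + of_int z)}"
      have "l * ((w - 1) - u - 1) / (4 * real 1) \<le> real (card C)"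
        unfolding C_def
      proof (intro count_rotation_interval)
        show "0 < \<bar>real 1 * \<phi> - of_int 0\<bar>" "\<bar>real 1 * \<phi> - of_int 0\<bar> \<le> l" using \<phi> l by auto
        have "w - 1 - u - 1 = M - 2" using uw by simp
        then show "2 * real 1 \<le> \<bar>real 1 * \<phi> - of_int 0\<bar> * (w - 1 - u - 1)"
          using M4 \<phi> \<phi>14 by (simp add: right_diff_distrib)
      qed (use l u in auto)
      also have "(w - 1) - u - 1 = M - 2" using uw by simp
      finally have cnt: "l * (M - 2) / 4 \<le> real (card C)" by simp
      define D where "D = {q \<in> grid L k. real L ^ k * t - ?v \<bullet> idx q \<in> J}"
      have il: "real i0 / real L + l < 1" using i0 L0 by (simp add: l_def field_simps)
      have "C \<subseteq> snd ` D"
      proof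
        fix m assume "m \<in> C"
        then obtain z :: int where m: "u \<le> real m" "real m \<le> w - 1" and
          z: "real i0 / real L + of_int z \<le> real L ^ k * t + \<phi> * real m" "real L ^ k * t + \<phi> * real m \<le> real i0 / real L + l + of_int z"
          unfolding C_def by auto
        define y where "y = real L ^ k * t + \<phi> * real m"
        have "\<phi> * u \<le> \<phi> * real m" "\<phi> * real m \<le> \<phi> * (w - 1)" using m \<phi> by (auto intro!: mult_left_mono)
        then have y: "0 \<le> y" "y < real L ^ k"
          using u(2) w(2) \<phi>(1) unfolding y_def right_diff_distrib mult_1_right by linarith+
        have "- 1 < (of_int z :: real)" using z(2) y(1) il unfolding y_def by linarith
        then have z0: "0 \<le> z" by simp
        then have zr: "real (nat z) = of_int z" by simp
        have "0 \<le> real i0 / real L" by simp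
        then have "real (nat z) < real (L ^ k)" using z(1) y(2) unfolding y_def zr of_nat_power by linarith
        moreover have "real m < real (L ^ k)" using m(2) w(1) unfolding of_nat_power by linarith
        ultimately have "(nat z, m) \<in> grid L k" by (simp add: grid_def del: of_nat_power)
        moreover have "real L ^ k * t - ?v \<bullet> idx (nat z, m) \<in> J"
        proof -
          have "real i0 / real L + l + \<phi> \<le> (real i0 + 1) / real L"
            using \<phi>L L0 by (simp add: l_def field_simps)
          moreover have "real L ^ k * t - ?v \<bullet> idx (nat z, m) = y - of_int z" by (simp add: idx_def y_def zr)
          ultimately show ?thesis using z unfolding J_def y_def by simp
        qed
        ultimately have "(nat z, m) \<in> D" by (simp only: D_def mem_Collect_eq)
        then show "m \<in> snd ` D" by (rule image_eqI[rotated]) simp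
      qed
      moreover have fD: "finite D" unfolding D_def by simp
      ultimately have "card C \<le> card D" by (meson card_image_le card_mono finite_imageI order_trans)
      then have "l * (M - 2) / 4 \<le> real (card D)" using cnt by linarith
      moreover have "l * (M / 2) / 4 \<le> l * (M - 2) / 4" using M4' l by (intro divide_right_mono mult_left_mono) auto
      ultimately have "l * (M / 2) / 4 \<le> real (card D)" by linarith
      then have "l * (M / 2) / 4 / real L ^ k \<le> real (card D) / real L ^ k"
        by (rule divide_right_mono) simp
      moreover have "l * (M / 2) / 4 / real L ^ k = 1 / (16 * real L) * chord \<phi> t" using pw by (simp add: M_def l_def)
      ultimately show ?thesis unfolding funpow_mean_step_indicator[OF L0] D_def by simp
    qed
  qed (use u L \<phi> \<phi>14 L2 in auto)
  have eq: "27648 * real L ^ 3 * (1 + real k) / (pmf \<mu> A0 * (1 / (16 * real L)) * real n) =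
    442368 * real L ^ 4 / pmf \<mu> A0 * (1 + real k) / real n"
    using L0 by (simp add: field_simps eval_nat_numeral)
  show ?thesis using mean_shadow_bound[OF n] unfolding eq .
qed

section \<open>Integration over all directions\<close>

lemma measurable_bad_slope [measurable]: "Measurable.pred borel (bad_slope L k)"
  unfolding bad_slope_def [abs_def] by measurable

text \<open>Slopes below \<open>L^-j\<close> are discarded. Above that only
  \<open>p <= 3 * L^(j + 1)\<close> can occur, which leaves at most \<open>6 * L^(j + 2)\<close>
  neighbourhoods of points \<open>q / p\<close>, each of radius \<open>r\<close> of order
  \<open>L^-k\<close>. The choice \<open>j = k div 2\<close> balances the two parts at about
  \<open>L^-(k / 2)\<close>.\<close>

lemma emeasure_bad_slope:
  assumes L: "L \<ge> 2"
  shows "emeasure lborel ({0..1} \<inter> {\<phi>. bad_slope L k \<phi>}) \<le> ennreal (82 * real L ^ 4 * (3 / 4) ^ k)"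
proof -
  define j where "j = k div 2"
  have L2: "real L \<ge> 2" using L by simp
  have pj: "real L ^ j > 0" and pk: "real L ^ k > 0" using L2 by simp_all
  define r where "r = 5 * real L ^ 2 / real L ^ k"
  have r: "0 \<le> r" by (simp add: r_def)
  define B where "B = (\<Union>(q, p)\<in>{1..2 * L} \<times> {1..3 * L ^ (j + 1)}. {real q / real p - r..real q / real p + r})"
  have sub: "{0..1} \<inter> {\<phi>. bad_slope L k \<phi>} \<subseteq> {0..1 / real L ^ j} \<union> B"
  proof
    fix \<phi> assume \<phi>: "\<phi> \<in> {0..1} \<inter> {\<phi>. bad_slope L k \<phi>}"
    then obtain q p where qp: "q \<in> {1..2 * L}" "1 \<le> p" "real p * \<phi> \<le> 3 * real L"
      "\<bar>real q - real p * \<phi>\<bar> * real L ^ k < 5 * real L ^ 2" by (auto simp: bad_slope_def)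
    show "\<phi> \<in> {0..1 / real L ^ j} \<union> B"
    proof (cases "\<phi> \<le> 1 / real L ^ j")
      case True then show ?thesis using \<phi> by simp
    next
      case False
      then have "real p * (1 / real L ^ j) \<le> real p * \<phi>" by (intro mult_left_mono) auto
      then have "real p * (1 / real L ^ j) \<le> 3 * real L" using qp(3) by linarith
      then have "real p * (1 / real L ^ j) * real L ^ j \<le> 3 * real L * real L ^ j"
        using pj by (intro mult_right_mono) auto
      then have "real p \<le> 3 * real L * real L ^ j" using L2 by simp
      then have "real p \<le> real (3 * L ^ (j + 1))" by simp
      then have p: "p \<in> {1..3 * L ^ (j + 1)}" using qp(2) by (simp only: of_nat_le_iff atLeastAtMost_iff simp_thms)
      have p1: "1 \<le> real p" using qp(2) by simp
      have "\<bar>real q / real p - \<phi>\<bar> * 1 \<le> \<bar>real q / real p - \<phi>\<bar> * real p" using p1 by (intro mult_left_mono) auto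
      also have "\<dots> = \<bar>(real q / real p - \<phi>) * real p\<bar>" using p1 by (simp add: abs_mult)
      also have "(real q / real p - \<phi>) * real p = real q - real p * \<phi>" using p1 by (simp add: field_simps)
      also have "\<bar>real q - real p * \<phi>\<bar> \<le> r" using qp(4) pk by (simp add: r_def field_simps)
      finally have "\<phi> \<in> {real q / real p - r..real q / real p + r}" by (auto simp: abs_le_iff)
      then have "\<phi> \<in> B" unfolding B_def using qp(1) p by blast
      then show ?thesis ..
    qed
  qed
  have "emeasure lborel B \<le> (\<Sum>(q, p)\<in>{1..2 * L} \<times> {1..3 * L ^ (j + 1)}. emeasure lborel {real q / real p - r..real q / real p + r})"
    unfolding B_def case_prod_beta by (rule emeasure_subadditive_finite) auto
  also have "\<dots> = (\<Sum>(q, p)\<in>{1..2 * L} \<times> {1..3 * L ^ (j + 1)}. ennreal (2 * r))"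
    using r by (intro sum.cong) auto
  also have "\<dots> = of_nat (2 * L * (3 * L ^ (j + 1))) * ennreal (2 * r)" by (simp add: card_cartesian_product)
  also have "\<dots> = ennreal (real (2 * L * (3 * L ^ (j + 1))) * (2 * r))"
    using r by (simp only: ennreal_of_nat_eq_real_of_nat ennreal_mult[symmetric] of_nat_0_le_iff mult_nonneg_nonneg zero_le_numeral)
  also have "real (2 * L * (3 * L ^ (j + 1))) * (2 * r) = 60 * real L ^ 4 * (real L ^ j / real L ^ k)"
    by (simp add: r_def eval_nat_numeral)
  finally have B: "emeasure lborel B \<le> ennreal (60 * real L ^ 4 * (real L ^ j / real L ^ k))" .
  have jk: "real L ^ j / real L ^ k \<le> 1 / real L ^ j"
  proof -
    have "real L ^ j * real L ^ j \<le> real L ^ k"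
      unfolding power_add[symmetric] using L2 by (intro power_increasing) (auto simp: j_def)
    then show ?thesis using pj pk by (simp add: field_simps)
  qed
  have j34: "1 / real L ^ j \<le> 4 / 3 * (3 / 4) ^ k"
  proof -
    have "1 / real L ^ j = (1 / real L) ^ j" by (simp add: power_one_over)
    \<comment> \<open>\<open>1 / L <= 1 / 2 <= 9 / 16 = (3 / 4)^2\<close>, which turns decay in
      \<open>j\<close> into decay in \<open>k\<close>.\<close>
    also have "\<dots> \<le> (9 / 16) ^ j" using L2 by (intro power_mono) (auto simp: field_simps)
    also have "\<dots> = (3 / 4) ^ (2 * j)" by (simp add: power_mult power2_eq_square)
    also have "\<dots> \<le> 4 / 3 * (3 / 4) ^ k"
    proof (cases "even k")
      case True then have "2 * j = k" by (simp add: j_def)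
      then show ?thesis by simp
    next
      case False
      then have "k = Suc (2 * j)" by (simp add: j_def)
      then show ?thesis by simp
    qed
    finally show ?thesis .
  qed
  have Bm: "B \<in> sets lborel" unfolding B_def case_prod_beta by (intro sets.finite_UN) auto
  have "emeasure lborel ({0..1} \<inter> {\<phi>. bad_slope L k \<phi>}) \<le> emeasure lborel ({0..1 / real L ^ j} \<union> B)"
    using sub Bm by (intro emeasure_mono sets.Un) auto
  also have "\<dots> \<le> emeasure lborel {0..1 / real L ^ j} + emeasure lborel B"
    using Bm by (intro emeasure_subadditive) auto
  also have "\<dots> \<le> ennreal (1 / real L ^ j) + ennreal (60 * real L ^ 4 * (real L ^ j / real L ^ k))"
    using pj by (intro add_mono B) simp
  also have "\<dots> = ennreal (1 / real L ^ j + 60 * real L ^ 4 * (real L ^ j / real L ^ k))"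
    by (simp add: ennreal_plus[symmetric] del: ennreal_plus)
  also have "\<dots> \<le> ennreal (82 * real L ^ 4 * (3 / 4) ^ k)"
  proof (rule ennreal_leI)
    have L4: "1 \<le> real L ^ 4" using L2 by (intro one_le_power) simp
    have "60 * real L ^ 4 * (real L ^ j / real L ^ k) \<le> 60 * real L ^ 4 * (1 / real L ^ j)"
      using jk by (intro mult_left_mono) auto
    moreover have "1 * (1 / real L ^ j) \<le> real L ^ 4 * (1 / real L ^ j)"
      using L4 pj by (intro mult_right_mono) auto
    moreover have "61 * real L ^ 4 * (1 / real L ^ j) \<le> 61 * real L ^ 4 * (4 / 3 * (3 / 4) ^ k)"
      using j34 by (intro mult_left_mono) auto
    moreover have "61 * real L ^ 4 * (4 / 3 * (3 / 4) ^ k) \<le> 82 * real L ^ 4 * (3 / 4) ^ k" by simp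
    ultimately show "1 / real L ^ j + 60 * real L ^ 4 * (real L ^ j / real L ^ k) \<le> 82 * real L ^ 4 * (3 / 4) ^ k"
      by linarith
  qed
  finally show ?thesis .
qed

text \<open>The least admissible \<open>k\<close> is at most the number of inadmissible ones. That
  number is a sum, which can be integrated term by term; if no \<open>k\<close> is admissible it is
  infinite, and \<open>c \<noteq> 0\<close> makes the bound infinite as well.\<close>

lemma least_index_bound:
  fixes X a c :: ennreal and P :: "nat \<Rightarrow> bool"
  assumes c: "c \<noteq> 0" and X: "\<And>k. \<not> P k \<Longrightarrow> X \<le> c * (a + of_nat k)"
  shows "X \<le> c * (a + (\<Sum>k. if P k then 1 else 0))"
proof -
  let ?S = "\<Sum>k. if P k then 1 else 0 :: ennreal"
  have ge: "of_nat k \<le> ?S" if "\<And>j. j < k \<Longrightarrow> P j" for k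
  proof -
    have "of_nat k = (\<Sum>j<k. if P j then 1 else 0 :: ennreal)" using that by simp
    also have "\<dots> \<le> ?S" by (intro sum_le_suminf) auto
    finally show ?thesis .
  qed
  show ?thesis
  proof (cases "\<exists>k. \<not> P k")
    case True
    define k where "k = (LEAST k. \<not> P k)"
    have "\<not> P k" unfolding k_def using True by (rule LeastI_ex)
    then have Xk: "X \<le> c * (a + of_nat k)" by (rule X)
    have "P j" if "j < k" for j
      using not_less_Least[of j "\<lambda>k. \<not> P k"] that unfolding k_def by blast
    then have "c * (a + of_nat k) \<le> c * (a + ?S)"
      by (intro mult_left_mono add_left_mono ge) simp_all
    with Xk show ?thesis by (rule order_trans)
  next
    case False
    have "?S = \<top>"
    proof (rule ccontr)
      assume "?S \<noteq> \<top>"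
      then obtain m where "?S < of_nat m" using ennreal_Ex_less_of_nat[of ?S] by (auto simp: less_top)
      with ge[of m] False show False by simp
    qed
    then show ?thesis using c by (simp add: ennreal_mult_top ennreal_top_mult)
  qed
qed

text \<open>The computation of the first Borel-Cantelli lemma: the mean number of events is the sum
  of their measures.\<close>

lemma nn_integral_suminf_indicator_le:
  fixes P :: "nat \<Rightarrow> real \<Rightarrow> bool"
  assumes [measurable]: "\<And>k. {x. P k x} \<in> sets borel"
    and b: "\<And>k. emeasure lborel ({0..1} \<inter> {x. P k x}) \<le> ennreal (b k)" and b0: "\<And>k. 0 \<le> b k" and s: "b sums S"
  shows "(\<integral>\<^sup>+x. (\<Sum>k. if P k x then 1 else 0) * indicator {0..1} x \<partial>lborel) \<le> ennreal S"
proof -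
  have e: "(if P k x then 1 else 0) * indicator {0..1} x = (indicator ({0..1} \<inter> {x. P k x}) x :: ennreal)" for k x
    by (auto simp: indicator_def)
  have "(\<integral>\<^sup>+x. (\<Sum>k. if P k x then 1 else 0) * indicator {0..1} x \<partial>lborel) =
    (\<integral>\<^sup>+x. (\<Sum>k. indicator ({0..1} \<inter> {x. P k x}) x) \<partial>lborel)"
    unfolding e[symmetric] by (simp add: ennreal_suminf_multc)
  also have "\<dots> = (\<Sum>k. \<integral>\<^sup>+x. indicator ({0..1} \<inter> {x. P k x}) x \<partial>lborel)"
    by (rule nn_integral_suminf) (auto intro!: borel_measurable_indicator)
  also have "\<dots> = (\<Sum>k. emeasure lborel ({0..1} \<inter> {x. P k x}))"
    by (intro suminf_cong nn_integral_indicator) auto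
  also have "\<dots> \<le> (\<Sum>k. ennreal (b k))" by (intro suminf_le b) auto
  also have "\<dots> = ennreal S" using b0 s by (intro suminf_ennreal_eq)
  finally show ?thesis .
qed

text \<open>Stands for the waiting time at slope \<open>\<phi>\<close>; it may be infinite but has a
  finite integral over \<open>{0..1}\<close>.\<close>

definition bad_count :: "nat \<Rightarrow> real \<Rightarrow> ennreal" where
  "bad_count L \<phi> = (\<Sum>k. if bad_slope L k \<phi> then 1 else 0)"

lemma nn_integral_bad_count:
  assumes "L \<ge> 2"
  shows "(\<integral>\<^sup>+\<phi>. bad_count L \<phi> * indicator {0..1} \<phi> \<partial>lborel) \<le> ennreal (328 * real L ^ 4)"
  unfolding bad_count_def
proof (rule nn_integral_suminf_indicator_le)
  have "(\<lambda>k. 82 * real L ^ 4 * (3 / 4) ^ k) sums (82 * real L ^ 4 * (1 / (1 - 3 / 4)))"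
    by (intro sums_mult geometric_sums) auto
  then show "(\<lambda>k. 82 * real L ^ 4 * (3 / 4) ^ k) sums (328 * real L ^ 4)" by simp
qed (use emeasure_bad_slope[OF assms] in auto)

lemma measurable_bad_count [measurable]: "bad_count L \<in> borel_measurable borel"
  unfolding bad_count_def [abs_def] by measurable

text \<open>The analogous waiting time for the column rate, whose premise on \<open>k\<close> is
  \<open>4 * L <= \<phi> * L^k\<close>.\<close>

definition steep_count :: "nat \<Rightarrow> real \<Rightarrow> ennreal" where
  "steep_count L \<phi> = (\<Sum>k. if \<phi> * real L ^ k < 4 * real L then 1 else 0)"

lemma measurable_steep_count [measurable]: "steep_count L \<in> borel_measurable borel"
  unfolding steep_count_def [abs_def] by measurable

lemma nn_integral_steep_count:
  assumes L: "L \<ge> 2"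
  shows "(\<integral>\<^sup>+\<phi>. steep_count L \<phi> * indicator {0..1} \<phi> \<partial>lborel) \<le> ennreal (8 * real L)"
  unfolding steep_count_def
proof (rule nn_integral_suminf_indicator_le)
  have "(\<lambda>k. 4 * real L * (1 / 2) ^ k) sums (4 * real L * (1 / (1 - 1 / 2)))"
    by (intro sums_mult geometric_sums) auto
  then show "(\<lambda>k. 4 * real L * (1 / 2) ^ k) sums (8 * real L)" by simp
  fix k
  have "\<phi> \<le> 4 * real L * (1 / 2) ^ k" if "0 \<le> \<phi>" "\<phi> * real L ^ k < 4 * real L" for \<phi>
  proof -
    have "\<phi> * 2 ^ k \<le> \<phi> * real L ^ k" using that L by (intro mult_left_mono power_mono) auto
    then have "\<phi> * 2 ^ k \<le> 4 * real L" using that by linarith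
    then show ?thesis by (simp add: field_simps power_one_over)
  qed
  then have "emeasure lborel ({0..1} \<inter> {\<phi>. \<phi> * real L ^ k < 4 * real L}) \<le> emeasure lborel {0..4 * real L * (1 / 2) ^ k}"
    by (intro emeasure_mono) auto
  then show "emeasure lborel ({0..1} \<inter> {\<phi>. \<phi> * real L ^ k < 4 * real L}) \<le> ennreal (4 * real L * (1 / 2) ^ k)"
    by simp
qed auto

text \<open>The substitution \<open>\<phi> = tan s\<close> has density \<open>1 / (cos s)^2\<close>,
  which is at least 1.\<close>

lemma nn_integral_tan_le:
  fixes H :: "real \<Rightarrow> ennreal"
  assumes [measurable]: "H \<in> borel_measurable borel"
  shows "(\<integral>\<^sup>+s. H (tan s) * indicator {0..pi / 4} s \<partial>lborel) \<le> (\<integral>\<^sup>+\<phi>. H \<phi> * indicator {0..1} \<phi> \<partial>lborel)"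
proof -
  have cos: "cos s \<noteq> 0" if "s \<in> {0..pi / 4}" for s
  proof -
    have "0 \<le> s" "s \<le> pi / 4" using that by auto
    then have "0 < cos s" using pi_gt_zero by (intro cos_gt_zero_pi) linarith+
    then show ?thesis by simp
  qed
  have "(\<integral>\<^sup>+s. H (tan s) * indicator {0..pi / 4} s \<partial>lborel) \<le>
      (\<integral>\<^sup>+s. H (tan s) * ennreal (inverse ((cos s)\<^sup>2)) * indicator {0..pi / 4} s \<partial>lborel)"
  proof (intro nn_integral_mono)
    fix s
    show "H (tan s) * indicator {0..pi / 4} s \<le> H (tan s) * ennreal (inverse ((cos s)\<^sup>2)) * indicator {0..pi / 4} s"
    proof (cases "s \<in> {0..pi / 4}")
      case True
      have "(cos s)\<^sup>2 \<le> 1" by (simp add: abs_square_le_1)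
      then have "1 \<le> ennreal (inverse ((cos s)\<^sup>2))"
        using cos[OF True] by (simp add: one_le_inverse_iff)
      then have "H (tan s) * 1 \<le> H (tan s) * ennreal (inverse ((cos s)\<^sup>2))" by (rule mult_left_mono) simp
      then show ?thesis using True by simp
    qed simp
  qed
  also have "\<dots> = (\<integral>\<^sup>+\<phi>. H \<phi> * indicator {tan 0..tan (pi / 4)} \<phi> \<partial>lborel)"
  proof (rule nn_integral_substitution_aux[symmetric])
    show "(tan has_real_derivative inverse ((cos x)\<^sup>2)) (at x)" if "x \<in> {0..pi / 4}" for x
      using DERIV_tan[OF cos[OF that]] .
    show "continuous_on {0..pi / 4} (\<lambda>x. inverse ((cos x)\<^sup>2))"
      using cos by (intro continuous_intros) auto
  qed auto
  finally show ?thesis by (simp add: tan_45)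
qed

text \<open>The half circle splits into four sectors, each parametrised by the tangent of the angle
  to the nearest axis. Homogeneity normalises the larger coordinate to absolute value 1; as this
  divides by a number of absolute value at most 1, it only increases \<open>F\<close>.\<close>

lemma nn_integral_directions_le:
  fixes F H :: "_ \<Rightarrow> ennreal"
  assumes [measurable]: "H \<in> borel_measurable borel"
    and scale: "\<And>c v. F (c *\<^sub>R v) = ennreal \<bar>c\<bar> * F v"
    and F: "\<And>\<phi>. 0 < \<phi> \<Longrightarrow> \<phi> \<le> 1 \<Longrightarrow> F (1, \<phi>) \<le> H \<phi> \<and> F (1, - \<phi>) \<le> H \<phi> \<and> F (\<phi>, 1) \<le> H \<phi> \<and> F (- \<phi>, 1) \<le> H \<phi>"
  shows "(\<integral>\<^sup>+\<theta>. F (cos \<theta>, sin \<theta>) * indicator {0..pi} \<theta> \<partial>lborel) \<le> 4 * (\<integral>\<^sup>+\<phi>. H \<phi> * indicator {0..1} \<phi> \<partial>lborel)"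
proof -
  define h where "h s = H (tan s) * indicator {0..pi / 4} s" for s :: real
  have [measurable]: "h \<in> borel_measurable borel" unfolding h_def tan_def by measurable
  have F1: "F (x, y) \<le> F (x / c, y / c)" if "\<bar>c\<bar> \<le> 1" "c \<noteq> 0" for x y c :: real
  proof -
    have "F (x, y) = ennreal \<bar>c\<bar> * F (x / c, y / c)" using scale[of c "(x / c, y / c)"] that(2) by simp
    also have "\<dots> \<le> 1 * F (x / c, y / c)" using that(1) by (intro mult_right_mono) (auto simp: ennreal_le_1)
    finally show ?thesis by simp
  qed
  have cs: "0 < tan s \<and> tan s \<le> 1 \<and> cos s \<noteq> 0" if "0 < s" "s \<le> pi / 4" for s :: real
  proof -
    have "0 < cos s" using that pi_gt_zero by (intro cos_gt_zero_pi) linarith+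
    moreover have "0 < tan s" using that pi_gt_zero by (intro tan_gt_zero) linarith+
    moreover have "tan s \<le> tan (pi / 4)"
    proof (cases "s = pi / 4")
      case False
      then have "tan s < tan (pi / 4)" using that pi_gt_zero by (intro tan_monotone) linarith+
      then show ?thesis by simp
    next
      case True
      show ?thesis unfolding True by (rule order_refl)
    qed
    ultimately show ?thesis by (simp add: tan_45)
  qed
  have A: "F (cos s, sin s) \<le> h s" "F (sin s, cos s) \<le> h s" "F (- sin s, cos s) \<le> h s" "F (- cos s, sin s) \<le> h s"
    if s: "0 < s" "s \<le> pi / 4" for s
  proof -
    note c = cs[OF s]
    have h: "h s = H (tan s)" using s by (simp add: h_def)
    have t: "sin s / cos s = tan s" by (simp add: tan_def)
    note b = F[of "tan s"]
    show "F (cos s, sin s) \<le> h s" using F1[of "cos s" "cos s" "sin s"] b c t h by (auto intro: order_trans)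
    show "F (sin s, cos s) \<le> h s" using F1[of "cos s" "sin s" "cos s"] b c t h by (auto intro: order_trans)
    show "F (- sin s, cos s) \<le> h s" using F1[of "cos s" "- sin s" "cos s"] b c t h by (auto intro: order_trans)
    show "F (- cos s, sin s) \<le> h s" using F1[of "- cos s" "- cos s" "sin s"] b c t h by (auto intro: order_trans)
  qed
  have "(\<integral>\<^sup>+\<theta>. F (cos \<theta>, sin \<theta>) * indicator {0..pi} \<theta> \<partial>lborel) \<le>
    (\<integral>\<^sup>+\<theta>. h (0 + 1 * \<theta>) + h (pi / 2 + (-1) * \<theta>) + h (- pi / 2 + 1 * \<theta>) + h (pi + (-1) * \<theta>) \<partial>lborel)"
  proof (rule nn_integral_mono_AE)
    \<comment> \<open>At these three angles the slope is 0, which the hypothesis on \<open>F\<close>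
      does not cover.\<close>
    have "AE \<theta> in lborel. \<theta> \<noteq> (0::real)" "AE \<theta> in lborel. \<theta> \<noteq> pi / 2" "AE \<theta> in lborel. \<theta> \<noteq> pi"
      by (rule AE_lborel_singleton)+
    then show "AE \<theta> in lborel. F (cos \<theta>, sin \<theta>) * indicator {0..pi} \<theta> \<le>
      h (0 + 1 * \<theta>) + h (pi / 2 + (-1) * \<theta>) + h (- pi / 2 + 1 * \<theta>) + h (pi + (-1) * \<theta>)"
    proof eventually_elim
      case (elim \<theta>)
      show ?case
      proof (cases "\<theta> \<in> {0..pi}")
        case True
        then consider "0 < \<theta>" "\<theta> \<le> pi / 4" | "0 < pi / 2 - \<theta>" "pi / 2 - \<theta> \<le> pi / 4"
          | "0 < \<theta> - pi / 2" "\<theta> - pi / 2 \<le> pi / 4" | "0 < pi - \<theta>" "pi - \<theta> \<le> pi / 4"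
          using elim by (simp, linarith)
        then show ?thesis
        proof cases
          case 1
          have "F (cos \<theta>, sin \<theta>) \<le> h \<theta>" using A(1)[OF 1] .
          then show ?thesis using True by (simp add: add_increasing2 add.assoc)
        next
          case 2
          have "F (cos \<theta>, sin \<theta>) \<le> h (pi / 2 - \<theta>)" using A(2)[OF 2] by (simp add: sin_diff cos_diff)
          then show ?thesis using True by (simp add: add_increasing add_increasing2)
        next
          case 3
          have "F (cos \<theta>, sin \<theta>) \<le> h (\<theta> - pi / 2)" using A(3)[OF 3] by (simp add: sin_diff cos_diff)
          then show ?thesis using True by (simp add: add_increasing add_increasing2)
        next
          case 4
          have "F (cos \<theta>, sin \<theta>) \<le> h (pi - \<theta>)" using A(4)[OF 4] by (simp add: sin_diff cos_diff)
          then show ?thesis using True by (simp add: add_increasing)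
        qed
      qed simp
    qed
  qed
  also have "\<dots> = (\<integral>\<^sup>+\<theta>. h (0 + 1 * \<theta>) \<partial>lborel) + (\<integral>\<^sup>+\<theta>. h (pi / 2 + (-1) * \<theta>) \<partial>lborel) +
     (\<integral>\<^sup>+\<theta>. h (- pi / 2 + 1 * \<theta>) \<partial>lborel) + (\<integral>\<^sup>+\<theta>. h (pi + (-1) * \<theta>) \<partial>lborel)"
    by (simp add: nn_integral_add)
  also have "\<dots> = 4 * (\<integral>\<^sup>+s. h s \<partial>lborel)"
  proof -
    have *: "(\<integral>\<^sup>+\<theta>. h (a + c * \<theta>) \<partial>lborel) = (\<integral>\<^sup>+s. h s \<partial>lborel)" if "\<bar>c\<bar> = 1" for a c
      using nn_integral_real_affine[of h c a] that by auto
    have e: "(\<integral>\<^sup>+\<theta>. h (0 + 1 * \<theta>) \<partial>lborel) = (\<integral>\<^sup>+s. h s \<partial>lborel)"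
      "(\<integral>\<^sup>+\<theta>. h (pi / 2 + (-1) * \<theta>) \<partial>lborel) = (\<integral>\<^sup>+s. h s \<partial>lborel)"
      "(\<integral>\<^sup>+\<theta>. h (- pi / 2 + 1 * \<theta>) \<partial>lborel) = (\<integral>\<^sup>+s. h s \<partial>lborel)"
      "(\<integral>\<^sup>+\<theta>. h (pi + (-1) * \<theta>) \<partial>lborel) = (\<integral>\<^sup>+s. h s \<partial>lborel)"
      by (rule *; simp)+
    have "(4 :: ennreal) = 1 + 1 + 1 + 1" by simp
    then show ?thesis unfolding e by (simp only: distrib_right mult_1)
  qed
  also have "\<dots> \<le> 4 * (\<integral>\<^sup>+\<phi>. H \<phi> * indicator {0..1} \<phi> \<partial>lborel)"
    unfolding h_def by (intro mult_left_mono nn_integral_tan_le) auto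
  finally show ?thesis .
qed

text \<open>Reflection and exchange of the axes turn the four kinds of directions into
  \<open>(1, - \<phi>)\<close> for one of four selection laws.\<close>

lemma expectation_favard_le:
  assumes sel: "selection L \<mu>" and L: "L > 0" and [measurable]: "H \<in> borel_measurable borel"
    and H: "\<And>\<nu> \<phi>. \<nu> \<in> {\<mu>, map_pmf ((`) (reflect L)) \<mu>, map_pmf ((`) prod.swap) \<mu>,
        map_pmf ((`) (reflect L)) (map_pmf ((`) prod.swap) \<mu>)} \<Longrightarrow> 0 < \<phi> \<Longrightarrow> \<phi> \<le> 1 \<Longrightarrow>
        mean_shadow L \<nu> n (1, - \<phi>) \<le> H \<phi>"
  shows "expectation_of (random_set L \<mu> n) favard \<le> 4 * (\<integral>\<^sup>+\<phi>. H \<phi> * indicator {0..1} \<phi> \<partial>lborel)"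
  unfolding expectation_favard[OF sel L]
proof (rule nn_integral_directions_le)
  fix \<phi> :: real assume \<phi>: "0 < \<phi>" "\<phi> \<le> 1"
  note sw = swap.selection_image[OF sel]
  have "mean_shadow L \<mu> n (1, \<phi>) \<le> H \<phi>"
    unfolding mean_shadow_reflect[OF sel L, symmetric] by (rule H[OF _ \<phi>]) simp
  moreover have "mean_shadow L \<mu> n (1, - \<phi>) \<le> H \<phi>" by (rule H[OF _ \<phi>]) simp
  moreover have "mean_shadow L \<mu> n (\<phi>, 1) \<le> H \<phi>"
    unfolding mean_shadow_swap[OF sel L, symmetric] mean_shadow_reflect[OF sw L, symmetric] by (rule H[OF _ \<phi>]) simp
  moreover have "mean_shadow L \<mu> n (- \<phi>, 1) \<le> H \<phi>"
    unfolding mean_shadow_swap[OF sel L, symmetric] by (rule H[OF _ \<phi>]) simp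
  ultimately show "mean_shadow L \<mu> n (1, \<phi>) \<le> H \<phi> \<and> mean_shadow L \<mu> n (1, - \<phi>) \<le> H \<phi> \<and>
      mean_shadow L \<mu> n (\<phi>, 1) \<le> H \<phi> \<and> mean_shadow L \<mu> n (- \<phi>, 1) \<le> H \<phi>" by blast
qed (auto simp: mean_shadow_scaleR)

lemma ennreal_mult_add_nat:
  assumes "0 \<le> c" "0 \<le> a"
  shows "ennreal (c * (a + real k)) = ennreal c * (ennreal a + of_nat k)"
  using assms by (simp add: ennreal_mult ennreal_plus ennreal_of_nat_eq_real_of_nat)

lemma mean_shadow_bad_count:
  assumes u: "uniform_selection L \<mu>" and L: "L \<ge> 2" and \<phi>: "0 < \<phi>" "\<phi> \<le> 1" and n: "n \<ge> 1"
  shows "mean_shadow L \<mu> n (1, - \<phi>) \<le>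
    ennreal (7962624 * real L ^ 7 / real n) * (ennreal (1 / \<phi>) + bad_count L \<phi>)"
  unfolding bad_count_def
proof (rule least_index_bound)
  show "ennreal (7962624 * real L ^ 7 / real n) \<noteq> 0" using L n by simp
  fix k assume "\<not> bad_slope L k \<phi>"
  from mean_shadow_uniform_rate[OF u L \<phi> this n]
  have "mean_shadow L \<mu> n (1, - \<phi>) \<le> ennreal (7962624 * real L ^ 7 / real n * (1 / \<phi> + real k))" by simp
  also have "\<dots> = ennreal (7962624 * real L ^ 7 / real n) * (ennreal (1 / \<phi>) + of_nat k)"
    using \<phi> by (intro ennreal_mult_add_nat) auto
  finally show "mean_shadow L \<mu> n (1, - \<phi>) \<le> ennreal (7962624 * real L ^ 7 / real n) * (ennreal (1 / \<phi>) + of_nat k)" .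
qed

text \<open>Slopes below \<open>1 / n\<close> contribute order \<open>1 / n\<close> by the trivial
  bound, the others the integral of \<open>1 / \<phi>\<close>, which is \<open>ln n\<close>; the
  waiting times add a constant. No information about which pairs of squares occur together enters,
  so the constant depends on \<open>L\<close> only.\<close>

theorem favard_uniform_bound:
  assumes L: "L \<ge> 2"
  shows "\<exists>C>0. \<forall>\<mu> n. uniform_selection L \<mu> \<longrightarrow> n \<ge> 1 \<longrightarrow>
    expectation_of (random_set L \<mu> n) favard \<le> ennreal (C * (1 + ln (real n)) / real n)"
proof -
  define c where "c = 7962624 * real L ^ 7"
  have c: "0 < c" using L by (simp add: c_def)
  define C where "C = 4 * (2 + c * (328 * real L ^ 4) + c)"
  have C: "0 < C" using c by (simp add: C_def add_pos_nonneg)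
  have "expectation_of (random_set L \<mu> n) favard \<le> ennreal (C * (1 + ln (real n)) / real n)"
    if u: "uniform_selection L \<mu>" and n: "n \<ge> 1" for \<mu> n
  proof -
    note sel = uniform_imp_selection[OF u]
    have L0: "L > 0" using L by simp
    have n0: "real n > 0" "1 / real n \<le> 1" "0 \<le> ln (real n)" using n by auto
    define H where "H \<phi> = (if \<phi> < 1 / real n then 2 else ennreal (c / real n) * (ennreal (1 / \<phi>) + bad_count L \<phi>))" for \<phi>
    have [measurable]: "H \<in> borel_measurable borel" unfolding H_def by measurable
    have E: "expectation_of (random_set L \<mu> n) favard \<le> 4 * (\<integral>\<^sup>+\<phi>. H \<phi> * indicator {0..1} \<phi> \<partial>lborel)"
    proof (rule expectation_favard_le[OF sel L0])
      fix \<nu> \<phi> assume \<nu>: "\<nu> \<in> {\<mu>, map_pmf ((`) (reflect L)) \<mu>, map_pmf ((`) prod.swap) \<mu>,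
        map_pmf ((`) (reflect L)) (map_pmf ((`) prod.swap) \<mu>)}" and \<phi>: "0 < \<phi>" "\<phi> \<le> (1 :: real)"
      have u\<nu>: "uniform_selection L \<nu>"
        using \<nu> u reflect.uniform_selection_image swap.uniform_selection_image by auto
      show "mean_shadow L \<nu> n (1, - \<phi>) \<le> H \<phi>"
      proof (cases "\<phi> < 1 / real n")
        case True
        have "mean_shadow L \<nu> n (1, - \<phi>) \<le> ennreal (1 + \<phi>)"
          using mean_shadow_le[OF uniform_imp_selection[OF u\<nu>] L0, of n "(1, - \<phi>)"] \<phi> by simp
        also have "\<dots> \<le> ennreal 2" using \<phi> by (intro ennreal_leI) simp
        finally show ?thesis using True by (simp add: H_def)
      next
        case False
        then show ?thesis using mean_shadow_bad_count[OF u\<nu> L \<phi> n] by (simp add: H_def c_def)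
      qed
    qed simp
    have "(\<integral>\<^sup>+\<phi>. H \<phi> * indicator {0..1} \<phi> \<partial>lborel) \<le>
      (\<integral>\<^sup>+\<phi>. 2 * indicator {0..1 / real n} \<phi> + (ennreal (c / real n) * (ennreal (1 / \<phi>) * indicator {1 / real n..1} \<phi>) +
        ennreal (c / real n) * (bad_count L \<phi> * indicator {0..1} \<phi>)) \<partial>lborel)"
    proof (intro nn_integral_mono)
      fix \<phi> :: real
      show "H \<phi> * indicator {0..1} \<phi> \<le> 2 * indicator {0..1 / real n} \<phi> + (ennreal (c / real n) * (ennreal (1 / \<phi>) * indicator {1 / real n..1} \<phi>) +
        ennreal (c / real n) * (bad_count L \<phi> * indicator {0..1} \<phi>))"
      proof (cases "\<phi> < 1 / real n")
        case True then show ?thesis by (auto simp: H_def indicator_def add_increasing2)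
      next
        case False
        then show ?thesis by (auto simp: H_def indicator_def distrib_left add_increasing)
      qed
    qed
    also have "\<dots> = (\<integral>\<^sup>+\<phi>. 2 * indicator {0..1 / real n} \<phi> \<partial>lborel) +
       (ennreal (c / real n) * (\<integral>\<^sup>+\<phi>. ennreal (1 / \<phi>) * indicator {1 / real n..1} \<phi> \<partial>lborel) +
        ennreal (c / real n) * (\<integral>\<^sup>+\<phi>. bad_count L \<phi> * indicator {0..1} \<phi> \<partial>lborel))"
      by (simp add: nn_integral_add nn_integral_cmult)
    also have "\<dots> \<le> ennreal (2 / real n) + (ennreal (c / real n) * ennreal (ln (real n)) + ennreal (c / real n) * ennreal (328 * real L ^ 4))"
    proof (intro add_mono mult_left_mono nn_integral_bad_count[OF L])
      have "2 * ennreal (1 / real n) = ennreal (2 / real n)"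
        using ennreal_mult[of 2 "1 / real n"] by simp
      then show "(\<integral>\<^sup>+\<phi>. 2 * indicator {0..1 / real n} \<phi> \<partial>lborel) \<le> ennreal (2 / real n)"
        by (simp add: nn_integral_cmult)
      have "(\<integral>\<^sup>+\<phi>. ennreal (1 / \<phi>) * indicator {1 / real n..1} \<phi> \<partial>lborel) = ennreal (ln 1 - ln (1 / real n))"
      proof (rule nn_integral_FTC_Icc)
        fix x assume "x \<in> {1 / real n..1}"
        then have "1 / real n \<le> x" by simp
        then have "0 < x" using n0(1) by (meson less_le_trans zero_less_divide_1_iff)
        then show "(ln has_real_derivative 1 / x) (at x)" "0 \<le> 1 / x" by (auto intro!: derivative_eq_intros)
      qed (use n0 in auto)
      then show "(\<integral>\<^sup>+\<phi>. ennreal (1 / \<phi>) * indicator {1 / real n..1} \<phi> \<partial>lborel) \<le> ennreal (ln (real n))"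
        using n0 by (simp add: ln_div)
    qed auto
    also have "\<dots> = ennreal (2 / real n + (c / real n * ln (real n) + c / real n * (328 * real L ^ 4)))"
      using c n0 by (simp add: ennreal_mult[symmetric] ennreal_plus[symmetric] del: ennreal_plus)
    finally have "expectation_of (random_set L \<mu> n) favard \<le>
        4 * ennreal (2 / real n + (c / real n * ln (real n) + c / real n * (328 * real L ^ 4)))"
      by (intro order_trans[OF E] mult_left_mono) simp_all
    also have "4 * ennreal (2 / real n + (c / real n * ln (real n) + c / real n * (328 * real L ^ 4))) =
      ennreal (4 * (2 / real n + (c / real n * ln (real n) + c / real n * (328 * real L ^ 4))))"
      using c n0 by (subst ennreal_mult) auto
    also have "\<dots> \<le> ennreal (C * (1 + ln (real n)) / real n)"
    proof (rule ennreal_leI)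
      have "4 * (2 + c * ln (real n) + c * (328 * real L ^ 4)) \<le> C * (1 + ln (real n))"
        using c n0 unfolding C_def by (simp add: algebra_simps)
      then have "4 * (2 + c * ln (real n) + c * (328 * real L ^ 4)) / real n \<le> C * (1 + ln (real n)) / real n"
        using n0 by (intro divide_right_mono) auto
      moreover have "4 * (2 + c * ln (real n) + c * (328 * real L ^ 4)) / real n =
        4 * (2 / real n + (c / real n * ln (real n) + c / real n * (328 * real L ^ 4)))"
        using n0 by (simp add: field_simps)
      ultimately show "4 * (2 / real n + (c / real n * ln (real n) + c / real n * (328 * real L ^ 4))) \<le> C * (1 + ln (real n)) / real n" by simp
    qed
    finally show ?thesis .
  qed
  then show ?thesis using C by blast
qed

section \<open>Non-degenerate selections\<close>

definition column_branching :: "(nat \<times> nat) set pmf \<Rightarrow> bool" where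
  "column_branching \<mu> \<longleftrightarrow> (\<exists>A\<in>set_pmf \<mu>. \<exists>i j j'. (i, j) \<in> A \<and> (i, j') \<in> A \<and> j \<noteq> j')"

lemma column_branching_reflect:
  assumes sel: "selection L \<mu>" and "column_branching \<mu>"
  shows "column_branching (map_pmf ((`) (reflect L)) \<mu>)"
proof -
  obtain A i j j' where A: "A \<in> set_pmf \<mu>" "(i, j) \<in> A" "(i, j') \<in> A" "j \<noteq> j'"
    using assms(2) by (auto simp: column_branching_def)
  have "(i, j) \<in> grid L 1" "(i, j') \<in> grid L 1" using selectionD(1)[OF sel A(1)] A(2,3) by (metis subsetD)+
  then have "L - 1 - j \<noteq> L - 1 - j'" using A(4) by (auto simp: grid_def)
  moreover have "(i, L - 1 - j) \<in> reflect L ` A" "(i, L - 1 - j') \<in> reflect L ` A"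
    using A(2,3)[THEN imageI[of _ _ "reflect L"]] by (simp_all add: reflect_def)
  moreover have "reflect L ` A \<in> set_pmf (map_pmf ((`) (reflect L)) \<mu>)" using A(1) by simp
  ultimately show ?thesis unfolding column_branching_def by (intro bexI[of _ "reflect L ` A"] exI conjI)
qed

text \<open>Pigeonhole: \<open>L\<close> squares in \<open>L\<close> columns, no two of them in one
  column, occupy every column exactly once.\<close>

lemma not_degenerate_columns:
  assumes sel: "selection L \<mu>" and nd: "\<not> (AE A in measure_pmf \<mu>. \<forall>i<L. \<exists>!j. (i, j) \<in> A)"
  shows "column_branching \<mu>"
proof (rule ccontr)
  assume no: "\<not> column_branching \<mu>"
  obtain A where A: "A \<in> set_pmf \<mu>" "\<not> (\<forall>i<L. \<exists>!j. (i, j) \<in> A)"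
    using nd unfolding AE_measure_pmf_iff by blast
  have "inj_on fst A"
  proof (rule inj_onI)
    fix x y assume "x \<in> A" "y \<in> A" "fst x = fst y"
    have "(fst x, snd x) \<in> A" using \<open>x \<in> A\<close> by simp
    moreover have "(fst x, snd y) \<in> A" unfolding \<open>fst x = fst y\<close> using \<open>y \<in> A\<close> by simp
    ultimately have "snd x = snd y" using no A(1) unfolding column_branching_def by blast
    then show "x = y" using \<open>fst x = fst y\<close> by (rule prod_eqI[rotated])
  qed
  then have "card (fst ` A) = L" using selectionD(2)[OF sel A(1)] by (simp add: card_image)
  moreover have "fst ` A \<subseteq> {..<L}" using selectionD(1)[OF sel A(1)] by (auto simp: grid_def)
  ultimately have "fst ` A = {..<L}" by (intro card_subset_eq) auto
  then have ex: "\<exists>j. (i, j) \<in> A" if "i < L" for i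
  proof -
    have "i \<in> fst ` A" using \<open>fst ` A = {..<L}\<close> that by simp
    then obtain x where "x \<in> A" "i = fst x" by (rule imageE)
    then have "(i, snd x) \<in> A" by simp
    then show ?thesis by (rule exI)
  qed
  have "\<exists>!j. (i, j) \<in> A" if "i < L" for i
    using ex[OF that] no A(1) unfolding column_branching_def by blast
  then show False using A(2) by blast
qed

lemma column_branching_swap:
  assumes sel: "selection L \<mu>" and nd: "\<not> horizontally_degenerate L \<mu>"
  shows "column_branching (map_pmf ((`) prod.swap) \<mu>)"
proof (rule not_degenerate_columns[OF swap.selection_image[OF sel]])
  have "(i, j) \<in> prod.swap ` A \<longleftrightarrow> (j, i) \<in> A" for i j :: nat and A by force
  then show "\<not> (AE A in measure_pmf (map_pmf ((`) prod.swap) \<mu>). \<forall>i<L. \<exists>!j. (i, j) \<in> A)"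
    using nd by (simp add: horizontally_degenerate_def AE_measure_pmf_iff)
qed

text \<open>For \<open>\<phi> <= 1 / (2 * L)\<close> the column rate applies; for larger slopes
  \<open>1 / \<phi>\<close> is at most \<open>2 * L\<close>, and the rate of the crossing lines is
  already of order \<open>1 / n\<close> up to the waiting time.\<close>

lemma column_branching_rate:
  assumes u: "uniform_selection L \<mu>" and L: "L \<ge> 2" and "column_branching \<mu>"
  shows "\<exists>C>0. \<forall>\<phi> n. 0 < \<phi> \<longrightarrow> \<phi> \<le> 1 \<longrightarrow> n \<ge> 1 \<longrightarrow>
    mean_shadow L \<mu> n (1, - \<phi>) \<le> ennreal (C / real n) * (1 + bad_count L \<phi> + steep_count L \<phi>)"
proof -
  obtain A i j j' where A: "A \<in> set_pmf \<mu>" "(i, j) \<in> A" "(i, j') \<in> A" "j \<noteq> j'"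
    using assms(3) by (auto simp: column_branching_def)
  define C1 where "C1 = 442368 * real L ^ 4 / pmf \<mu> A"
  define C2 where "C2 = 7962624 * real L ^ 7 * (2 * real L)"
  have C: "0 < C1" "0 < C2" using A(1) L by (auto simp: C1_def C2_def pmf_positive)
  have L2: "1 \<le> 2 * real L" using L by simp
  have "mean_shadow L \<mu> n (1, - \<phi>) \<le> ennreal ((C1 + C2) / real n) * (1 + bad_count L \<phi> + steep_count L \<phi>)"
    if \<phi>: "0 < \<phi>" "\<phi> \<le> 1" and n: "n \<ge> 1" for \<phi> n
  proof (cases "\<phi> \<le> 1 / (2 * real L)")
    case True
    have n0: "real n > 0" using n by simp
    have "mean_shadow L \<mu> n (1, - \<phi>) \<le> ennreal (C1 / real n) * (1 + steep_count L \<phi>)"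
      unfolding steep_count_def
    proof (rule least_index_bound)
      show "ennreal (C1 / real n) \<noteq> 0" using C n0 by simp
      fix k assume "\<not> \<phi> * real L ^ k < 4 * real L"
      then have "4 * real L \<le> \<phi> * real L ^ k" by simp
      from mean_shadow_column_rate[OF u L A \<phi>(1) True this n]
      have "mean_shadow L \<mu> n (1, - \<phi>) \<le> ennreal (C1 / real n * (1 + real k))" by (simp add: C1_def)
      also have "\<dots> = ennreal (C1 / real n) * (1 + of_nat k)"
        using C n0 ennreal_mult_add_nat[of "C1 / real n" 1 k] by simp
      finally show "mean_shadow L \<mu> n (1, - \<phi>) \<le> ennreal (C1 / real n) * (1 + of_nat k)" .
    qed
    also have "\<dots> \<le> ennreal ((C1 + C2) / real n) * (1 + bad_count L \<phi> + steep_count L \<phi>)"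
      using C n0 by (intro mult_mono ennreal_leI divide_right_mono add_mono) (auto simp: add_increasing2)
    finally show ?thesis .
  next
    case False
    have n0: "real n > 0" using n by simp
    have "1 / \<phi> \<le> 2 * real L" using False \<phi> L by (simp add: field_simps)
    then have "ennreal (1 / \<phi>) + bad_count L \<phi> \<le> ennreal (2 * real L) * 1 + ennreal (2 * real L) * bad_count L \<phi>"
      using L2 mult_right_mono[of 1 "ennreal (2 * real L)" "bad_count L \<phi>"]
      by (intro add_mono) (auto intro: ennreal_leI simp: ennreal_le_1)
    then have "ennreal (1 / \<phi>) + bad_count L \<phi> \<le> ennreal (2 * real L) * (1 + bad_count L \<phi>)"
      unfolding distrib_left .
    then have "mean_shadow L \<mu> n (1, - \<phi>) \<le> ennreal (7962624 * real L ^ 7 / real n) * (ennreal (2 * real L) * (1 + bad_count L \<phi>))"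
      by (intro order_trans[OF mean_shadow_bad_count[OF u L \<phi> n]] mult_left_mono) auto
    also have "\<dots> = ennreal (C2 / real n) * (1 + bad_count L \<phi>)"
      using n0 L by (simp add: mult.assoc[symmetric] ennreal_mult[symmetric] C2_def)
    also have "\<dots> \<le> ennreal ((C1 + C2) / real n) * (1 + bad_count L \<phi> + steep_count L \<phi>)"
      using C n0 by (intro mult_mono ennreal_leI divide_right_mono) (auto simp: add_increasing2)
    finally show ?thesis .
  qed
  then show ?thesis using C by (intro exI[of _ "C1 + C2"]) auto
qed

text \<open>The failure of vertical degeneracy serves the lines close to vertical, that of
  horizontal degeneracy the lines close to horizontal, after exchanging the axes. The constant
  depends on \<open>\<mu>\<close> through the probability of a branching selection.\<close>

theorem favard_nondegenerate_bound:
  assumes u: "uniform_selection L \<mu>" and L: "L \<ge> 2" and nd: "\<not> degenerate L \<mu>"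
  shows "\<exists>C>0. \<forall>n\<ge>1. expectation_of (random_set L \<mu> n) favard \<le> ennreal (C / real n)"
proof -
  note sel = uniform_imp_selection[OF u]
  have L0: "L > 0" using L by simp
  let ?r = "map_pmf ((`) (reflect L))" and ?s = "map_pmf ((`) prod.swap)"
  let ?N = "{\<mu>, ?r \<mu>, ?s \<mu>, ?r (?s \<mu>)}"
  have cb: "column_branching \<mu>" "column_branching (?s \<mu>)"
    using nd not_degenerate_columns[OF sel] column_branching_swap[OF sel]
    by (auto simp: degenerate_def vertically_degenerate_def)
  have cb': "column_branching (?r \<mu>)" "column_branching (?r (?s \<mu>))"
    using column_branching_reflect[OF sel cb(1)] column_branching_reflect[OF swap.selection_image[OF sel] cb(2)] by auto
  have "uniform_selection L \<nu> \<and> column_branching \<nu>" if "\<nu> \<in> ?N" for \<nu>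
    using that cb cb' u reflect.uniform_selection_image swap.uniform_selection_image by auto
  then have "\<forall>\<nu>\<in>?N. \<exists>C>0. \<forall>\<phi> n. 0 < \<phi> \<longrightarrow> \<phi> \<le> 1 \<longrightarrow> n \<ge> 1 \<longrightarrow>
    mean_shadow L \<nu> n (1, - \<phi>) \<le> ennreal (C / real n) * (1 + bad_count L \<phi> + steep_count L \<phi>)"
    by (intro ballI column_branching_rate[OF _ L]) simp_all
  then obtain c where c: "\<And>\<nu>. \<nu> \<in> ?N \<Longrightarrow> 0 < c \<nu>"
    "\<And>\<nu> \<phi> n. \<nu> \<in> ?N \<Longrightarrow> 0 < \<phi> \<Longrightarrow> \<phi> \<le> 1 \<Longrightarrow> n \<ge> 1 \<Longrightarrow>
      mean_shadow L \<nu> n (1, - \<phi>) \<le> ennreal (c \<nu> / real n) * (1 + bad_count L \<phi> + steep_count L \<phi>)"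
    unfolding bchoice_iff by metis
  define C where "C = c \<mu> + c (?r \<mu>) + c (?s \<mu>) + c (?r (?s \<mu>))"
  have pos: "0 < c \<mu>" "0 < c (?r \<mu>)" "0 < c (?s \<mu>)" "0 < c (?r (?s \<mu>))" using c(1) by auto
  then have C0: "0 < C" by (simp add: C_def)
  have cC: "c \<nu> \<le> C" if "\<nu> \<in> ?N" for \<nu> using that pos by (auto simp: C_def)
  define K where "K = 1 + (328 * real L ^ 4 + 8 * real L)"
  have K0: "0 < K" by (simp add: K_def add_pos_nonneg)
  have "expectation_of (random_set L \<mu> n) favard \<le> ennreal (4 * C * K / real n)" if n: "n \<ge> 1" for n
  proof -
    have n0: "real n > 0" using n by simp
    have E: "expectation_of (random_set L \<mu> n) favard \<le>
      4 * (\<integral>\<^sup>+\<phi>. (ennreal (C / real n) * (1 + bad_count L \<phi> + steep_count L \<phi>)) * indicator {0..1} \<phi> \<partial>lborel)"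
    proof (rule expectation_favard_le[OF sel L0])
      fix \<nu> \<phi> assume \<nu>: "\<nu> \<in> ?N" and \<phi>: "0 < \<phi>" "\<phi> \<le> (1 :: real)"
      show "mean_shadow L \<nu> n (1, - \<phi>) \<le> ennreal (C / real n) * (1 + bad_count L \<phi> + steep_count L \<phi>)"
        using c(2)[OF \<nu> \<phi> n] cC[OF \<nu>] n0
        by (elim order_trans) (intro mult_right_mono ennreal_leI divide_right_mono, auto)
    qed measurable
    have "(\<integral>\<^sup>+\<phi>. (ennreal (C / real n) * (1 + bad_count L \<phi> + steep_count L \<phi>)) * indicator {0..1} \<phi> \<partial>lborel) =
      (\<integral>\<^sup>+\<phi>. ennreal (C / real n) * (indicator {0..1} \<phi> + (bad_count L \<phi> * indicator {0..1} \<phi> + steep_count L \<phi> * indicator {0..1} \<phi>)) \<partial>lborel)"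
      by (intro nn_integral_cong) (simp add: algebra_simps)
    also have "\<dots> = ennreal (C / real n) * ((\<integral>\<^sup>+\<phi>. indicator {0..1::real} \<phi> \<partial>lborel) +
       ((\<integral>\<^sup>+\<phi>. bad_count L \<phi> * indicator {0..1} \<phi> \<partial>lborel) + (\<integral>\<^sup>+\<phi>. steep_count L \<phi> * indicator {0..1} \<phi> \<partial>lborel)))"
      by (simp add: nn_integral_cmult nn_integral_add)
    also have "\<dots> \<le> ennreal (C / real n) * (ennreal 1 + (ennreal (328 * real L ^ 4) + ennreal (8 * real L)))"
      by (intro mult_left_mono add_mono nn_integral_bad_count nn_integral_steep_count L) auto
    also have "\<dots> = ennreal (C / real n * K)"
      unfolding K_def using C0 n0 by (subst ennreal_mult) (auto simp: ennreal_plus)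
    finally have "expectation_of (random_set L \<mu> n) favard \<le> 4 * ennreal (C / real n * K)"
      by (intro order_trans[OF E] mult_left_mono) simp_all
    also have "4 * ennreal (C / real n * K) = ennreal (4 * (C / real n * K))"
      using C0 n0 K0 by (subst ennreal_mult) auto
    finally show ?thesis by (simp add: mult_ac)
  qed
  then show ?thesis using C0 K0 by (intro exI[of _ "4 * C * K"]) auto
qed

section \<open>Directions along a curve of gradients\<close>

text \<open>The interval meets at most its length divided by \<open>pi\<close>, plus 2, of the
  period cells.\<close>

lemma nn_integral_periodic_le:
  fixes f :: "real \<Rightarrow> ennreal"
  assumes [measurable]: "f \<in> borel_measurable borel" and per: "\<And>x. f (x + pi) = f x" and cd: "c \<le> d"
  shows "(\<integral>\<^sup>+x. f x * indicator {c..d} x \<partial>lborel) \<le>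
    ennreal ((d - c) / pi + 2) * (\<integral>\<^sup>+x. f x * indicator {0..pi} x \<partial>lborel)"
proof -
  let ?I = "\<integral>\<^sup>+x. f x * indicator {0..pi} x \<partial>lborel"
  have pern: "f (x + real k * pi) = f x" for x k
    using per[of "x + real k * pi" for k] by (induction k) (simp_all add: algebra_simps)
  have peri: "f (x + of_int j * pi) = f x" for x j
  proof (cases "j \<ge> 0")
    case True
    then show ?thesis using pern[of x "nat j"] by simp
  next
    case False
    then show ?thesis using pern[of "x + of_int j * pi" "nat (- j)"] by simp
  qed
  have piece: "(\<integral>\<^sup>+x. f x * indicator {of_int j * pi..(of_int j + 1) * pi} x \<partial>lborel) = ?I" for j :: int
  proof -
    have "(\<integral>\<^sup>+x. f x * indicator {of_int j * pi..(of_int j + 1) * pi} x \<partial>lborel) =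
      (\<integral>\<^sup>+x. f (of_int j * pi + 1 * x) * indicator {of_int j * pi..(of_int j + 1) * pi} (of_int j * pi + 1 * x) \<partial>lborel)"
      by (subst nn_integral_real_affine[of _ 1 "of_int j * pi"]) auto
    also have "\<dots> = ?I"
      using peri by (intro nn_integral_cong) (auto simp: indicator_def algebra_simps)
    finally show ?thesis .
  qed
  define K where "K = {\<lfloor>c / pi\<rfloor>..\<lfloor>d / pi\<rfloor>}"
  have "(\<integral>\<^sup>+x. f x * indicator {c..d} x \<partial>lborel) \<le>
      (\<integral>\<^sup>+x. (\<Sum>j\<in>K. f x * indicator {of_int j * pi..(of_int j + 1) * pi} x) \<partial>lborel)"
  proof (intro nn_integral_mono)
    fix x
    show "f x * indicator {c..d} x \<le> (\<Sum>j\<in>K. f x * indicator {of_int j * pi..(of_int j + 1) * pi} x)"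
    proof (cases "x \<in> {c..d}")
      case True
      define j where "j = \<lfloor>x / pi\<rfloor>"
      have j: "j \<in> K" using True by (auto simp: j_def K_def intro!: floor_mono divide_right_mono)
      have "of_int j \<le> x / pi" "x / pi < of_int j + 1" by (simp_all add: j_def)
      then have "x \<in> {of_int j * pi..(of_int j + 1) * pi}" by (auto simp: field_simps)
      then have "f x * indicator {c..d} x = f x * indicator {of_int j * pi..(of_int j + 1) * pi} x" using True by simp
      also have "\<dots> \<le> (\<Sum>j\<in>K. f x * indicator {of_int j * pi..(of_int j + 1) * pi} x)"
        using j by (intro member_le_sum) (auto simp: K_def)
      finally show ?thesis .
    qed simp
  qed
  also have "\<dots> = (\<Sum>j\<in>K. ?I)" by (subst nn_integral_sum) (auto simp: piece)
  also have "\<dots> = ennreal (real (card K)) * ?I" by (simp add: ennreal_of_nat_eq_real_of_nat)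
  also have "\<dots> \<le> ennreal ((d - c) / pi + 2) * ?I"
  proof (intro mult_right_mono ennreal_leI)
    have "c / pi \<le> d / pi" using cd by (simp add: divide_right_mono)
    then have "real (card K) = of_int \<lfloor>d / pi\<rfloor> - of_int \<lfloor>c / pi\<rfloor> + 1"
      unfolding K_def using floor_mono[of "c / pi" "d / pi"] by simp
    also have "\<dots> \<le> d / pi - c / pi + 2" by linarith
    finally show "real (card K) \<le> (d - c) / pi + 2" by (simp add: diff_divide_distrib)
  qed simp
  finally show ?thesis .
qed

text \<open>A continuous angle along a curve avoiding 0, taken from a complex logarithm: if
  \<open>g\<close> is an antiderivative of \<open>w' / w\<close>, then \<open>w * exp (- g)\<close>
  has derivative 0, so \<open>g\<close> is a logarithm of \<open>w\<close> up to a constant.\<close>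

lemma polar_lift:
  fixes x y x' y' :: "real \<Rightarrow> real"
  assumes ab: "a < b"
    and x: "\<And>t. t \<in> {a..b} \<Longrightarrow> (x has_real_derivative x' t) (at t)"
    and y: "\<And>t. t \<in> {a..b} \<Longrightarrow> (y has_real_derivative y' t) (at t)"
    and cont: "continuous_on {a..b} x'" "continuous_on {a..b} y'"
    and nz: "\<And>t. t \<in> {a..b} \<Longrightarrow> (x t, y t) \<noteq> 0"
  shows "\<exists>\<theta>. (\<forall>t\<in>{a..b}. x t = norm (x t, y t) * cos (\<theta> t) \<and> y t = norm (x t, y t) * sin (\<theta> t)) \<and>
    (\<forall>t\<in>{a<..<b}. (\<theta> has_real_derivative (x t * y' t - x' t * y t) / (norm (x t, y t))\<^sup>2) (at t))"
proof -
  define w where "w t = of_real (x t) + \<i> * of_real (y t)" for t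
  define w' where "w' t = of_real (x' t) + \<i> * of_real (y' t)" for t
  have cx: "continuous_on {a..b} x" "continuous_on {a..b} y"
    by (rule continuous_at_imp_continuous_on, rule ballI, rule DERIV_isCont, erule x y)+
  have wnz: "w t \<noteq> 0" if "t \<in> {a..b}" for t
    using nz[OF that] by (auto simp: w_def complex_eq_iff zero_prod_def)
  have dw: "(w has_vector_derivative w' t) (at t within {a..b})" if "t \<in> {a..b}" for t
  proof -
    have "(x has_real_derivative x' t) (at t within {a..b})" "(y has_real_derivative y' t) (at t within {a..b})"
      using x[OF that] y[OF that] by (auto intro: has_field_derivative_at_within)
    then show ?thesis unfolding w_def [abs_def] w'_def
      by (intro has_vector_derivative_add has_vector_derivative_mult_right has_vector_derivative_of_real)
  qed
  have "continuous_on {a..b} (\<lambda>t. w' t / w t)"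
    using cont cx wnz unfolding w'_def [abs_def] w_def [abs_def] by (intro continuous_intros) auto
  then obtain g where g: "\<And>t. t \<in> {a..b} \<Longrightarrow> (g has_vector_derivative w' t / w t) (at t within {a..b})"
    using antiderivative_continuous by blast
  have "((\<lambda>t. w t * exp (- g t)) has_vector_derivative 0) (at t within {a..b})" if t: "t \<in> {a..b}" for t
  proof -
    have e: "((\<lambda>t. exp (- g t)) has_vector_derivative (- (w' t / w t)) * exp (- g t)) (at t within {a..b})"
      using field_vector_diff_chain_within[OF has_vector_derivative_minus[OF g[OF t]]
          has_field_derivative_at_within[OF DERIV_exp[of "- g t"]]] by (simp add: o_def)
    show ?thesis
      using has_vector_derivative_mult[OF dw[OF t] e] wnz[OF t] by (simp add: field_simps)
  qed
  then obtain c where c: "\<And>t. t \<in> {a..b} \<Longrightarrow> w t * exp (- g t) = c"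
    using has_vector_derivative_zero_constant[of "{a..b}" "\<lambda>t. w t * exp (- g t)"] by auto
  have c0: "c \<noteq> 0" using c[of a] wnz[of a] ab by auto
  \<comment> \<open>\<open>Ln c\<close> absorbs the integration constant, so that
    \<open>exp (h t)\<close> is \<open>w t\<close> itself.\<close>
  define h where "h t = g t + Ln c" for t
  have wh: "w t = exp (h t)" if "t \<in> {a..b}" for t
  proof -
    have "exp (h t) = exp (g t) * (w t * exp (- g t))" using c[OF that] c0 by (simp add: h_def exp_add)
    also have "\<dots> = w t * (exp (g t) * exp (- g t))" by simp
    also have "\<dots> = w t" by (simp add: exp_minus)
    finally show ?thesis ..
  qed
  define \<theta> where "\<theta> t = Im (h t)" for t
  have nw: "norm (x t, y t) = cmod (w t)" for t by (simp add: norm_Pair w_def cmod_def)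
  have "x t = norm (x t, y t) * cos (\<theta> t) \<and> y t = norm (x t, y t) * sin (\<theta> t)" if t: "t \<in> {a..b}" for t
  proof -
    have "w t = of_real (exp (Re (h t))) * cis (\<theta> t)" unfolding wh[OF t] \<theta>_def by (rule exp_eq_polar)
    then have "Re (w t) = exp (Re (h t)) * cos (\<theta> t)" "Im (w t) = exp (Re (h t)) * sin (\<theta> t)" by simp_all
    moreover have "norm (x t, y t) = exp (Re (h t))" unfolding nw wh[OF t] by simp
    ultimately show ?thesis by (simp add: w_def)
  qed
  moreover have "(\<theta> has_real_derivative (x t * y' t - x' t * y t) / (norm (x t, y t))\<^sup>2) (at t)" if t: "t \<in> {a<..<b}" for t
  proof -
    have t': "t \<in> {a..b}" using t by simp
    have "(g has_vector_derivative w' t / w t) (at t)"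
      using g[OF t'] at_within_Icc_at[of a t b] t by simp
    then have "(h has_vector_derivative w' t / w t) (at t)"
      unfolding h_def [abs_def] by (rule has_vector_derivative_add_const[THEN iffD2])
    then have "(\<theta> has_vector_derivative Im (w' t / w t)) (at t)"
      unfolding \<theta>_def [abs_def] by (rule bounded_linear.has_vector_derivative[OF bounded_linear_Im])
    moreover have "Im (w' t / w t) = (x t * y' t - x' t * y t) / (norm (x t, y t))\<^sup>2"
      by (simp add: Im_divide w_def w'_def norm_Pair algebra_simps)
    ultimately show ?thesis by (simp add: has_real_derivative_iff_has_vector_derivative)
  qed
  ultimately show ?thesis by blast
qed

text \<open>Change of variables from the parameter to the angle \<open>\<theta>\<close>, whose
  derivative, the determinant over the squared norm, lies between \<open>C^-3\<close> and
  \<open>C^3\<close>. Homogeneity extracts the norm, which is at most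
  \<open>C = C^4 * C^-3 <= C^4 * \<theta>'\<close>; the angles fill an interval of length at most
  \<open>C^3 * (b - a)\<close>, on which the integrand has period \<open>pi\<close>. The inner
  interval is there because \<open>polar_lift\<close> differentiates the angle only strictly between
  \<open>a\<close> and \<open>b\<close>.\<close>

lemma nn_integral_direction_curve_Icc:
  fixes F :: "real \<times> real \<Rightarrow> ennreal" and x y x' y' :: "real \<Rightarrow> real"
  assumes Fm [measurable]: "F \<in> borel_measurable borel" and scale: "\<And>c v. F (c *\<^sub>R v) = ennreal \<bar>c\<bar> * F v"
    and ab: "a < a'" "a' < b'" "b' < b"
    and x: "\<And>t. t \<in> {a..b} \<Longrightarrow> (x has_real_derivative x' t) (at t)"
    and y: "\<And>t. t \<in> {a..b} \<Longrightarrow> (y has_real_derivative y' t) (at t)"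
    and cont: "continuous_on {a..b} x'" "continuous_on {a..b} y'"
    and C: "1 \<le> C"
    and bounds: "\<And>t. t \<in> {a..b} \<Longrightarrow> 1 / C \<le> norm (x t, y t) \<and> norm (x t, y t) \<le> C"
    and det: "\<And>t. t \<in> {a..b} \<Longrightarrow> 1 / C \<le> x t * y' t - x' t * y t \<and> x t * y' t - x' t * y t \<le> C"
  shows "(\<integral>\<^sup>+t. F (x t, y t) * indicator {a'..b'} t \<partial>lborel) \<le>
    ennreal (C ^ 4 * (C ^ 3 * (b - a) / pi + 2)) * (\<integral>\<^sup>+\<theta>. F (cos \<theta>, sin \<theta>) * indicator {0..pi} \<theta> \<partial>lborel)"
proof -
  have C0: "0 < C" "0 < 1 / C" using C by auto
  have n0: "0 < norm (x t, y t)" if "t \<in> {a..b}" for t using bounds[OF that] C0(2) by linarith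
  have "\<exists>\<theta>. (\<forall>t\<in>{a..b}. x t = norm (x t, y t) * cos (\<theta> t) \<and> y t = norm (x t, y t) * sin (\<theta> t)) \<and>
    (\<forall>t\<in>{a<..<b}. (\<theta> has_real_derivative (x t * y' t - x' t * y t) / (norm (x t, y t))\<^sup>2) (at t))"
    using ab n0 by (intro polar_lift x y cont) (auto simp del: norm_Pair)
  then obtain \<theta> where pol: "\<And>t. t \<in> {a..b} \<Longrightarrow> x t = norm (x t, y t) * cos (\<theta> t) \<and> y t = norm (x t, y t) * sin (\<theta> t)"
    and d\<theta>: "\<And>t. t \<in> {a<..<b} \<Longrightarrow> (\<theta> has_real_derivative (x t * y' t - x' t * y t) / (norm (x t, y t))\<^sup>2) (at t)"
    by blast
  define \<theta>' where "\<theta>' t = (x t * y' t - x' t * y t) / (norm (x t, y t))\<^sup>2" for t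
  define f where "f s = F (cos s, sin s)" for s
  have [measurable]: "f \<in> borel_measurable borel" unfolding f_def by measurable
  have neg: "F (- u, - v) = F (u, v)" for u v using scale[of "-1" "(u, v)"] by simp
  have \<theta>'b: "1 / C ^ 3 \<le> \<theta>' t \<and> \<theta>' t \<le> C ^ 3" if t: "t \<in> {a..b}" for t
  proof
    have d0: "0 \<le> x t * y' t - x' t * y t" using det[OF t] C0(2) by linarith
    have "1 / C ^ 3 = (1 / C) / C\<^sup>2" by (simp add: power3_eq_cube power2_eq_square)
    also have "\<dots> \<le> \<theta>' t" unfolding \<theta>'_def
      using det[OF t] bounds[OF t] n0[OF t] C0 d0
      by (intro frac_le power_mono) (auto simp del: diff_ge_0_iff_ge)
    finally show "1 / C ^ 3 \<le> \<theta>' t" .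
    have "\<theta>' t \<le> C / (1 / C)\<^sup>2" unfolding \<theta>'_def
      using det[OF t] bounds[OF t] n0[OF t] C0 d0
      by (intro frac_le power_mono) (auto simp del: diff_ge_0_iff_ge)
    also have "\<dots> = C ^ 3" by (simp add: power3_eq_cube power2_eq_square)
    finally show "\<theta>' t \<le> C ^ 3" .
  qed
  have cx: "continuous_on {a..b} x" "continuous_on {a..b} y"
    by (rule continuous_at_imp_continuous_on, rule ballI, rule DERIV_isCont, erule x y)+
  have sub: "{a'..b'} \<subseteq> {a..b}" "{a'..b'} \<subseteq> {a<..<b}" using ab by auto
  have cont': "continuous_on {a'..b'} \<theta>'"
    unfolding \<theta>'_def [abs_def] using n0 sub(1)
    by (intro continuous_intros continuous_on_subset[OF cx(1)] continuous_on_subset[OF cx(2)]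
        continuous_on_subset[OF cont(1)] continuous_on_subset[OF cont(2)] sub) force
  have der: "(\<theta> has_real_derivative \<theta>' t) (at t)" if "t \<in> {a'..b'}" for t
    using d\<theta>[of t] that sub(2) unfolding \<theta>'_def by blast
  have C3: "0 < C ^ 3" "0 < 1 / C ^ 3" using C0 by auto
  have nn: "0 \<le> \<theta>' t" if "t \<in> {a'..b'}" for t
  proof -
    have "t \<in> {a..b}" using that sub(1) by blast
    then show ?thesis using \<theta>'b[of t] C3 by linarith
  qed
  have "F (x t, y t) * indicator {a'..b'} t \<le> ennreal (C ^ 4) * (f (\<theta> t) * ennreal (\<theta>' t) * indicator {a'..b'} t)" for t
  proof (cases "t \<in> {a'..b'}")
    case True
    then have t: "t \<in> {a..b}" using sub(1) by blast
    have "(x t, y t) = norm (x t, y t) *\<^sub>R (cos (\<theta> t), sin (\<theta> t))" using pol[OF t] by simp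
    then have "F (x t, y t) = ennreal (norm (x t, y t)) * f (\<theta> t)"
      using scale[of "norm (x t, y t)" "(cos (\<theta> t), sin (\<theta> t))"] by (simp add: f_def del: norm_Pair)
    also have "\<dots> \<le> ennreal (C ^ 4 * \<theta>' t) * f (\<theta> t)"
    proof (intro mult_right_mono ennreal_leI)
      have "norm (x t, y t) \<le> C" using bounds[OF t] by simp
      also have "C = C ^ 4 * (1 / C ^ 3)" using C0 by (simp add: eval_nat_numeral)
      also have "\<dots> \<le> C ^ 4 * \<theta>' t" using \<theta>'b[OF t] C0 by (intro mult_left_mono) auto
      finally show "norm (x t, y t) \<le> C ^ 4 * \<theta>' t" .
    qed simp
    also have "\<dots> = ennreal (C ^ 4) * (f (\<theta> t) * ennreal (\<theta>' t))"
      using C0 nn[OF True] by (simp add: ennreal_mult mult_ac)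
    finally show ?thesis using True by simp
  qed simp
  then have "(\<integral>\<^sup>+t. F (x t, y t) * indicator {a'..b'} t \<partial>lborel) \<le>
      (\<integral>\<^sup>+t. ennreal (C ^ 4) * (f (\<theta> t) * ennreal (\<theta>' t) * indicator {a'..b'} t) \<partial>lborel)"
    by (intro nn_integral_mono)
  also have "\<dots> \<le> ennreal (C ^ 4) * (\<integral>\<^sup>+t. f (\<theta> t) * ennreal (\<theta>' t) * indicator {a'..b'} t \<partial>lborel)"
  proof -
    have c\<theta>: "continuous_on {a'..b'} \<theta>"
      by (rule continuous_at_imp_continuous_on, rule ballI, rule DERIV_isCont, erule der)
    \<comment> \<open>Cutting off outside the interval gives Borel functions on the whole line and
      leaves the integrand unchanged.\<close>
    have m1: "(\<lambda>t. indicator {a'..b'} t *\<^sub>R \<theta> t) \<in> borel_measurable borel" "(\<lambda>t. indicator {a'..b'} t *\<^sub>R \<theta>' t) \<in> borel_measurable borel"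
      by (intro borel_measurable_continuous_on_indicator c\<theta> cont'; simp)+
    note [measurable] = m1
    have "(\<lambda>t. f (indicator {a'..b'} t *\<^sub>R \<theta> t) * ennreal (indicator {a'..b'} t *\<^sub>R \<theta>' t) * indicator {a'..b'} t) \<in> borel_measurable borel"
      by measurable
    also have "(\<lambda>t. f (indicator {a'..b'} t *\<^sub>R \<theta> t) * ennreal (indicator {a'..b'} t *\<^sub>R \<theta>' t) * indicator {a'..b'} t) =
      (\<lambda>t. f (\<theta> t) * ennreal (\<theta>' t) * indicator {a'..b'} t)" by (auto simp: indicator_def)
    finally show ?thesis by (simp add: nn_integral_cmult)
  qed
  also have "(\<integral>\<^sup>+t. f (\<theta> t) * ennreal (\<theta>' t) * indicator {a'..b'} t \<partial>lborel) =
      (\<integral>\<^sup>+s. f s * indicator {\<theta> a'..\<theta> b'} s \<partial>lborel)"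
    by (rule nn_integral_substitution_aux[symmetric]) (use der cont' nn ab in auto)
  also have "\<dots> \<le> ennreal ((\<theta> b' - \<theta> a') / pi + 2) * (\<integral>\<^sup>+s. f s * indicator {0..pi} s \<partial>lborel)"
  proof (rule nn_integral_periodic_le)
    show "f (s + pi) = f s" for s using neg by (simp add: f_def)
    show "\<theta> a' \<le> \<theta> b'"
    proof (rule DERIV_nonneg_imp_nondecreasing[where f = \<theta>])
      show "a' \<le> b'" using ab by simp
    next
      fix t assume "a' \<le> t" "t \<le> b'"
      then have "t \<in> {a'..b'}" by simp
      then show "\<exists>u. (\<theta> has_real_derivative u) (at t) \<and> 0 \<le> u" using der nn by (intro exI[of _ "\<theta>' t"] conjI)
    qed
  qed simp
  also have "\<dots> \<le> ennreal (C ^ 3 * (b - a) / pi + 2) * (\<integral>\<^sup>+s. f s * indicator {0..pi} s \<partial>lborel)"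
  proof (intro mult_right_mono ennreal_leI add_right_mono divide_right_mono)
    obtain t where t: "a' < t" "t < b'" "\<theta> b' - \<theta> a' = (b' - a') * \<theta>' t"
      using MVT2[of a' b' \<theta> \<theta>'] ab der by auto
    have "(b' - a') * \<theta>' t \<le> (b - a) * C ^ 3"
      using \<theta>'b[of t] t ab nn[of t] by (intro mult_mono) auto
    then show "\<theta> b' - \<theta> a' \<le> C ^ 3 * (b - a)" using t(3) by (simp add: mult.commute)
  qed auto
  finally have *: "(\<integral>\<^sup>+t. F (x t, y t) * indicator {a'..b'} t \<partial>lborel) \<le>
    ennreal (C ^ 4) * (ennreal (C ^ 3 * (b - a) / pi + 2) * (\<integral>\<^sup>+s. f s * indicator {0..pi} s \<partial>lborel))"
    by (simp add: mult_left_mono)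
  have "0 \<le> C ^ 3 * (b - a) / pi + 2" using C0 ab by simp
  then have "ennreal (C ^ 4) * (ennreal (C ^ 3 * (b - a) / pi + 2) * (\<integral>\<^sup>+s. f s * indicator {0..pi} s \<partial>lborel)) =
    ennreal (C ^ 4 * (C ^ 3 * (b - a) / pi + 2)) * (\<integral>\<^sup>+s. f s * indicator {0..pi} s \<partial>lborel)"
    using C0 by (simp add: ennreal_mult mult.assoc)
  with * show ?thesis by (simp add: f_def)
qed

text \<open>Monotone convergence along compact intervals exhausting the open one; the constants for
  these intervals are bounded by the one with \<open>b - a\<close>.\<close>

lemma nn_integral_direction_curve_pos:
  fixes F :: "real \<times> real \<Rightarrow> ennreal" and x y x' y' :: "real \<Rightarrow> real"
  assumes Fm [measurable]: "F \<in> borel_measurable borel" and scale: "\<And>c v. F (c *\<^sub>R v) = ennreal \<bar>c\<bar> * F v"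
    and ab: "a < b"
    and x: "\<And>t. t \<in> {a<..<b} \<Longrightarrow> (x has_real_derivative x' t) (at t)"
    and y: "\<And>t. t \<in> {a<..<b} \<Longrightarrow> (y has_real_derivative y' t) (at t)"
    and cont: "continuous_on {a<..<b} x'" "continuous_on {a<..<b} y'"
    and C: "1 \<le> C"
    and bounds: "\<And>t. t \<in> {a<..<b} \<Longrightarrow> 1 / C \<le> norm (x t, y t) \<and> norm (x t, y t) \<le> C"
    and det: "\<And>t. t \<in> {a<..<b} \<Longrightarrow> 1 / C \<le> x t * y' t - x' t * y t \<and> x t * y' t - x' t * y t \<le> C"
  shows "(\<integral>\<^sup>+t. F (x t, y t) * indicator {a<..<b} t \<partial>lborel) \<le>
    ennreal (C ^ 4 * (C ^ 3 * (b - a) / pi + 2)) * (\<integral>\<^sup>+\<theta>. F (cos \<theta>, sin \<theta>) * indicator {0..pi} \<theta> \<partial>lborel)"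
proof -
  \<comment> \<open>The 3 keeps the shrunken interval non-degenerate already for
    \<open>n = 0\<close>.\<close>
  define d where "d n = (b - a) / (real n + 3)" for n :: nat
  have d: "0 < d n" "2 * d n < b - a" "d (Suc n) < d n" for n
  proof -
    show "0 < d n" using ab by (simp add: d_def)
    have "(b - a) * 2 < (b - a) * (real n + 3)" using ab by (intro mult_strict_left_mono) auto
    then have "2 * (b - a) < (b - a) * (real n + 3)" by (simp only: mult.commute)
    then show "2 * d n < b - a" by (simp add: d_def divide_less_eq)
    show "d (Suc n) < d n" unfolding d_def using ab by (intro divide_strict_left_mono) auto
  qed
  define J where "J n = {a + d n..b - d n}" for n
  have cx: "continuous_on {a<..<b} x" "continuous_on {a<..<b} y"
    by (rule continuous_at_imp_continuous_on, rule ballI, rule DERIV_isCont, erule x y)+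
  have [measurable]: "(\<lambda>t. indicator {a<..<b} t *\<^sub>R x t) \<in> borel_measurable borel" "(\<lambda>t. indicator {a<..<b} t *\<^sub>R y t) \<in> borel_measurable borel"
    by (intro borel_measurable_continuous_on_indicator cx; simp)+
  have m: "(\<lambda>t. F (x t, y t) * indicator (J n) t) \<in> borel_measurable borel" for n
  proof -
    have J: "J n \<subseteq> {a<..<b}" "J n \<in> sets borel" using d[of n] by (auto simp: J_def)
    then have "(\<lambda>t. F (x t, y t) * indicator (J n) t) = (\<lambda>t. F (indicator {a<..<b} t *\<^sub>R x t, indicator {a<..<b} t *\<^sub>R y t) * indicator (J n) t)"
      by (auto simp: indicator_def fun_eq_iff)
    also have "\<dots> \<in> borel_measurable borel" using J(2) by measurable
    finally show ?thesis .
  qed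
  have Jmono: "J n \<subseteq> J (Suc n)" for n using d(3)[of n] by (auto simp: J_def)
  have JU: "(\<Union>n. J n) = {a<..<b}"
  proof (intro equalityI subsetI)
    fix t assume t: "t \<in> {a<..<b}"
    have "(\<lambda>n. (b - a) / (real n + 3)) \<longlonglongrightarrow> 0"
      using filterlim_tendsto_add_at_top[OF tendsto_const filterlim_real_sequentially, of 3]
      by (intro tendsto_divide_0[OF tendsto_const] filterlim_at_top_imp_at_infinity)
         (simp add: add.commute)
    then have "\<forall>\<^sub>F n in sequentially. d n < min (t - a) (b - t)"
      unfolding d_def using t by (intro order_tendstoD(2)) auto
    then obtain n where "d n < min (t - a) (b - t)" by (auto simp: eventually_sequentially)
    then have "t \<in> J n" by (auto simp: J_def)
    then show "t \<in> (\<Union>n. J n)" by blast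
  next
    fix t assume "t \<in> (\<Union>n. J n)"
    then obtain n where "t \<in> J n" by blast
    then show "t \<in> {a<..<b}" using d(1)[of n] by (simp add: J_def)
  qed
  have lim: "F (x t, y t) * indicator {a<..<b} t = (SUP n. F (x t, y t) * indicator (J n) t)" for t
  proof -
    have "(SUP n. indicator (J n) t) = (indicator (\<Union>n. J n) t :: ennreal)"
    proof (rule antisym)
      show "(SUP n. indicator (J n) t) \<le> (indicator (\<Union>n. J n) t :: ennreal)"
        by (rule SUP_least) (auto simp: indicator_def)
      show "(indicator (\<Union>n. J n) t :: ennreal) \<le> (SUP n. indicator (J n) t)"
      proof (cases "t \<in> (\<Union>n. J n)")
        case True
        then obtain n where "t \<in> J n" by blast
        then show ?thesis by (intro SUP_upper2[of n]) (auto simp: indicator_def)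
      qed simp
    qed
    then have "F (x t, y t) * indicator {a<..<b} t = F (x t, y t) * (SUP n. indicator (J n) t)"
      unfolding JU[symmetric] by (rule arg_cong[OF sym])
    also have "\<dots> = (SUP n. F (x t, y t) * indicator (J n) t)" by (rule SUP_mult_left_ennreal)
    finally show ?thesis .
  qed
  have "(\<integral>\<^sup>+t. F (x t, y t) * indicator {a<..<b} t \<partial>lborel) = (SUP n. \<integral>\<^sup>+t. F (x t, y t) * indicator (J n) t \<partial>lborel)"
    unfolding lim using m Jmono
    by (intro nn_integral_monotone_convergence_SUP)
       (auto simp: incseq_Suc_iff le_fun_def indicator_def intro!: mult_left_mono)
  also have "\<dots> \<le> ennreal (C ^ 4 * (C ^ 3 * (b - a) / pi + 2)) * (\<integral>\<^sup>+\<theta>. F (cos \<theta>, sin \<theta>) * indicator {0..pi} \<theta> \<partial>lborel)"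
  proof (rule SUP_least)
    fix n
    have s: "{a + d (Suc n)..b - d (Suc n)} \<subseteq> {a<..<b}" using d[of "Suc n"] by auto
    have "(\<integral>\<^sup>+t. F (x t, y t) * indicator (J n) t \<partial>lborel) \<le> ennreal (C ^ 4 * (C ^ 3 * ((b - d (Suc n)) - (a + d (Suc n))) / pi + 2)) *
      (\<integral>\<^sup>+\<theta>. F (cos \<theta>, sin \<theta>) * indicator {0..pi} \<theta> \<partial>lborel)"
      unfolding J_def
      by (rule nn_integral_direction_curve_Icc[OF Fm scale _ _ _ x y continuous_on_subset[OF cont(1) s]
            continuous_on_subset[OF cont(2) s] C bounds det])
         (use d(2,3)[of n] d(1,2)[of "Suc n"] in auto)
    also have "\<dots> \<le> ennreal (C ^ 4 * (C ^ 3 * (b - a) / pi + 2)) * (\<integral>\<^sup>+\<theta>. F (cos \<theta>, sin \<theta>) * indicator {0..pi} \<theta> \<partial>lborel)"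
      using d[of "Suc n"] C
      by (intro mult_right_mono ennreal_leI mult_left_mono add_right_mono divide_right_mono) auto
    finally show "(\<integral>\<^sup>+t. F (x t, y t) * indicator (J n) t \<partial>lborel) \<le> \<dots>" .
  qed
  finally show ?thesis .
qed

text \<open>The determinant is continuous and never 0, hence of one sign; a negative sign is
  reversed by reflecting the second coordinate.\<close>

lemma nn_integral_direction_curve:
  fixes F :: "real \<times> real \<Rightarrow> ennreal" and x y x' y' :: "real \<Rightarrow> real"
  assumes Fm [measurable]: "F \<in> borel_measurable borel" and scale: "\<And>c v. F (c *\<^sub>R v) = ennreal \<bar>c\<bar> * F v"
    and ab: "a < b"
    and x: "\<And>t. t \<in> {a<..<b} \<Longrightarrow> (x has_real_derivative x' t) (at t)"
    and y: "\<And>t. t \<in> {a<..<b} \<Longrightarrow> (y has_real_derivative y' t) (at t)"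
    and cont: "continuous_on {a<..<b} x'" "continuous_on {a<..<b} y'"
    and C: "1 \<le> C"
    and bounds: "\<And>t. t \<in> {a<..<b} \<Longrightarrow> 1 / C \<le> norm (x t, y t) \<and> norm (x t, y t) \<le> C"
    and det: "\<And>t. t \<in> {a<..<b} \<Longrightarrow> 1 / C \<le> \<bar>x t * y' t - x' t * y t\<bar> \<and> \<bar>x t * y' t - x' t * y t\<bar> \<le> C"
  shows "(\<integral>\<^sup>+t. F (x t, y t) * indicator {a<..<b} t \<partial>lborel) \<le>
    ennreal (C ^ 4 * (C ^ 3 * (b - a) / pi + 2)) * (\<integral>\<^sup>+\<theta>. F (cos \<theta>, sin \<theta>) * indicator {0..pi} \<theta> \<partial>lborel)"
proof -
  define D where "D t = x t * y' t - x' t * y t" for t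
  have cx: "continuous_on {a<..<b} x" "continuous_on {a<..<b} y"
    by (rule continuous_at_imp_continuous_on, rule ballI, rule DERIV_isCont, erule x y)+
  have cD: "continuous_on {a<..<b} D" unfolding D_def [abs_def] using cx cont by (intro continuous_intros)
  have D0: "D t \<noteq> 0" if "t \<in> {a<..<b}" for t
  proof -
    have "0 < 1 / C" using C by simp
    then show ?thesis using det[OF that] by (auto simp: D_def)
  qed
  have "(\<forall>t\<in>{a<..<b}. 0 < D t) \<or> (\<forall>t\<in>{a<..<b}. D t < 0)"
  proof (rule ccontr)
    assume "\<not> ?thesis"
    then obtain s t where st: "s \<in> {a<..<b}" "t \<in> {a<..<b}" "D s \<le> 0" "0 \<le> D t" by (auto simp: not_less)
    have "connected (D ` {a<..<b})" by (intro connected_continuous_image cD) simp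
    then have "0 \<in> D ` {a<..<b}" by (rule connectedD_interval[OF _ imageI[OF st(1)] imageI[OF st(2)] st(3,4)])
    then obtain r where "0 = D r" "r \<in> {a<..<b}" by (rule imageE)
    then show False using D0[of r] by simp
  qed
  then show ?thesis
  proof
    assume pos: "\<forall>t\<in>{a<..<b}. 0 < D t"
    show ?thesis
    proof (rule nn_integral_direction_curve_pos[OF Fm scale ab x y cont C bounds])
      show "1 / C \<le> x t * y' t - x' t * y t \<and> x t * y' t - x' t * y t \<le> C" if "t \<in> {a<..<b}" for t
        using det[OF that] bspec[OF pos that] unfolding D_def by simp
    qed
  next
    assume neg: "\<forall>t\<in>{a<..<b}. D t < 0"
    define G where "G v = F (fst v, - snd v)" for v
    have Gm: "G \<in> borel_measurable borel" unfolding G_def [abs_def]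
      by (rule measurable_compose[OF _ Fm]) (intro borel_measurable_continuous_onI continuous_intros)
    have Gs: "G (c *\<^sub>R v) = ennreal \<bar>c\<bar> * G v" for c v
      using scale[of c "(fst v, - snd v)"] by (simp add: G_def)
    have "(\<integral>\<^sup>+t. G (x t, - y t) * indicator {a<..<b} t \<partial>lborel) \<le>
      ennreal (C ^ 4 * (C ^ 3 * (b - a) / pi + 2)) * (\<integral>\<^sup>+\<theta>. G (cos \<theta>, sin \<theta>) * indicator {0..pi} \<theta> \<partial>lborel)"
    proof (rule nn_integral_direction_curve_pos[OF Gm Gs ab x _ cont(1) _ C])
      show "((\<lambda>t. - y t) has_real_derivative - y' t) (at t)" if "t \<in> {a<..<b}" for t
        using y[OF that] by (rule DERIV_minus)
      show "continuous_on {a<..<b} (\<lambda>t. - y' t)" using cont(2) by (rule continuous_on_minus)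
      show "1 / C \<le> norm (x t, - y t) \<and> norm (x t, - y t) \<le> C" if "t \<in> {a<..<b}" for t
        using bounds[OF that] by (simp add: norm_Pair)
      show "1 / C \<le> x t * - y' t - x' t * - y t \<and> x t * - y' t - x' t * - y t \<le> C" if "t \<in> {a<..<b}" for t
      proof -
        have e: "x t * - y' t - x' t * - y t = \<bar>D t\<bar>" using bspec[OF neg that] by (simp add: D_def)
        show ?thesis unfolding e unfolding D_def using det[OF that] .
      qed
    qed
    moreover have "(\<integral>\<^sup>+\<theta>. G (cos \<theta>, sin \<theta>) * indicator {0..pi} \<theta> \<partial>lborel) = (\<integral>\<^sup>+\<theta>. F (cos \<theta>, sin \<theta>) * indicator {0..pi} \<theta> \<partial>lborel)"
    proof -
      note [measurable] = Gm
      \<comment> \<open>Reflecting the second coordinate amounts to \<open>pi - \<theta>\<close> up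
        to the sign of the vector, which \<open>F\<close> ignores.\<close>
      have n: "F (- u, - v) = F (u, v)" for u v using scale[of "-1" "(u, v)"] by simp
      have m: "(\<lambda>\<theta>. G (cos \<theta>, sin \<theta>) * indicator {0..pi} \<theta>) \<in> borel_measurable borel"
        by measurable
      have "(\<integral>\<^sup>+\<theta>. G (cos \<theta>, sin \<theta>) * indicator {0..pi} \<theta> \<partial>lborel) =
        (\<integral>\<^sup>+\<theta>. G (cos (pi + (-1) * \<theta>), sin (pi + (-1) * \<theta>)) * indicator {0..pi} (pi + (-1) * \<theta>) \<partial>lborel)"
        using nn_integral_real_affine[OF m, of "-1" pi] by simp
      also have "\<dots> = (\<integral>\<^sup>+\<theta>. F (cos \<theta>, sin \<theta>) * indicator {0..pi} \<theta> \<partial>lborel)"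
        by (intro nn_integral_cong) (auto simp: G_def sin_diff cos_diff n indicator_def)
      finally show ?thesis .
    qed
    ultimately show ?thesis by (simp add: G_def)
  qed
qed

section \<open>Families with the transversality condition\<close>

lemma partial_prod_right:
  "partial (0, e) (\<lambda>(\<alpha>, x). \<Psi> \<alpha> x) = (\<lambda>(\<alpha>, x). partial e (\<Psi> \<alpha>) x)"
  by (simp add: partial_def fun_eq_iff case_prod_beta)

lemma partial_prod_left:
  "partial (1, 0) (\<lambda>(\<alpha>, x). \<Psi> \<alpha> x) (\<alpha>, x) = deriv (\<lambda>\<beta>. \<Psi> \<beta> x) \<alpha>"
  using deriv_shift_0[of "\<lambda>\<beta>. \<Psi> \<beta> x" \<alpha>] by (simp add: partial_def o_def)

lemma line_has_derivative:
  fixes g :: "'a::real_normed_vector \<Rightarrow> real"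
  assumes "(\<lambda>t. g (x + s *\<^sub>R e + t *\<^sub>R e)) differentiable at 0"
  shows "((\<lambda>t. g (x + t *\<^sub>R e)) has_real_derivative partial e g (x + s *\<^sub>R e)) (at s)"
proof -
  have "((\<lambda>t. g (x + s *\<^sub>R e + t *\<^sub>R e)) has_real_derivative partial e g (x + s *\<^sub>R e)) (at 0)"
    using assms unfolding partial_def by (simp add: DERIV_deriv_iff_real_differentiable)
  then have "((\<lambda>t. g (x + s *\<^sub>R e + (t + - s) *\<^sub>R e)) has_real_derivative partial e g (x + s *\<^sub>R e)) (at s)"
    by (subst DERIV_shift[symmetric]) simp
  moreover have "x + s *\<^sub>R e + (t + - s) *\<^sub>R e = x + t *\<^sub>R e" for t
    unfolding add.assoc scaleR_left_distrib[symmetric] by simp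
  ultimately show ?thesis by (simp only:)
qed

lemma C_diff_Suc_differentiable:
  "C_diff (Suc k) D f \<Longrightarrow> e \<in> Basis \<Longrightarrow> x \<in> D \<Longrightarrow> (\<lambda>t. f (x + t *\<^sub>R e)) differentiable at 0"
  by simp

lemma C_diff_partial: "C_diff (Suc k) D f \<Longrightarrow> e \<in> Basis \<Longrightarrow> C_diff k D (partial e f)"
  by simp

lemma C_diff_continuous: "C_diff k D f \<Longrightarrow> continuous_on D f"
  by (cases k) auto

lemma mvt_segment:
  fixes f f' :: "real \<Rightarrow> real"
  assumes "\<And>t. t \<in> {0..1} \<Longrightarrow> (f has_real_derivative f' t) (at t)" and ab: "a \<in> {0..1}" "b \<in> {0..1}"
  shows "\<exists>t\<in>{0..1}. \<bar>t - a\<bar> \<le> \<bar>b - a\<bar> \<and> f b - f a = (b - a) * f' t"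
proof -
  consider "a < b" | "a = b" | "b < a" by linarith
  then show ?thesis
  proof cases
    case 1
    then obtain t where "a < t" "t < b" "f b - f a = (b - a) * f' t"
      using MVT2[of a b f f'] assms by auto
    then show ?thesis using ab by (intro bexI[of _ t]) auto
  next
    case 2
    then show ?thesis using ab by (intro bexI[of _ a]) auto
  next
    case 3
    then obtain t where "b < t" "t < a" "f a - f b = (a - b) * f' t"
      using MVT2[of b a f f'] assms by auto
    then show ?thesis using ab by (intro bexI[of _ t]) (auto simp: algebra_simps)
  qed
qed

locale transversal_family =
  fixes a b C0 :: real and I :: "real set" and U :: "(real \<times> real) set"
    and \<Phi> :: "real \<Rightarrow> real \<times> real \<Rightarrow> real"
  assumes ab: "a < b" and I: "I = {a<..<b}"
    and unit: "{0..1} \<times> {0..1} \<subseteq> U"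
    and C2: "C_diff 2 (I \<times> U) (\<lambda>(\<alpha>, x). \<Phi> \<alpha> x)"
    and C0: "C0 \<ge> 1"
    and grad_bounds: "\<And>\<alpha> x. \<alpha> \<in> I \<Longrightarrow> x \<in> U \<Longrightarrow> 1 / C0 \<le> norm (grad (\<Phi> \<alpha>) x) \<and> norm (grad (\<Phi> \<alpha>) x) \<le> C0"
    and second_bounds: "\<And>\<alpha> x d d'. \<alpha> \<in> I \<Longrightarrow> x \<in> U \<Longrightarrow> d \<in> {pd1, pd2} \<Longrightarrow> d' \<in> {pd1, pd2} \<Longrightarrow>
           \<bar>d (d' (\<Phi> \<alpha>)) x\<bar> \<le> C0"
    and det_bounds: "\<And>\<alpha> x. \<alpha> \<in> I \<Longrightarrow> x \<in> U \<Longrightarrow>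
           1 / C0 \<le> \<bar>mixed_det \<Phi> \<alpha> x\<bar> \<and> \<bar>mixed_det \<Phi> \<alpha> x\<bar> \<le> C0"
begin

lemma Basis_elems:
  "(1, 0) \<in> (Basis :: (real \<times> (real \<times> real)) set)"
  "(0, (1, 0)) \<in> (Basis :: (real \<times> (real \<times> real)) set)"
  "(0, (0, 1)) \<in> (Basis :: (real \<times> (real \<times> real)) set)"
  by (auto simp: Basis_prod_def zero_prod_def)

lemma C1: "e \<in> {(1, 0), (0, 1)} \<Longrightarrow> C_diff 1 (I \<times> U) (\<lambda>(\<alpha>, x). partial e (\<Phi> \<alpha>) x)"
  using C_diff_partial[of 1 "I \<times> U" "\<lambda>(\<alpha>, x). \<Phi> \<alpha> x" "(0, e)"] C2 Basis_elems
  by (auto simp: partial_prod_right numeral_2_eq_2)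

lemma deriv_first:
  assumes "\<alpha> \<in> I" "x + s *\<^sub>R e \<in> U" "e \<in> {(1, 0), (0, 1)}"
  shows "((\<lambda>t. \<Phi> \<alpha> (x + t *\<^sub>R e)) has_real_derivative partial e (\<Phi> \<alpha>) (x + s *\<^sub>R e)) (at s)"
proof -
  have "(0, e) \<in> (Basis :: (real \<times> (real \<times> real)) set)" using assms(3) Basis_elems by auto
  then have "(\<lambda>t. \<Phi> \<alpha> (x + s *\<^sub>R e + t *\<^sub>R e)) differentiable at 0"
    using C_diff_Suc_differentiable[of 1 "I \<times> U" "\<lambda>(\<alpha>, x). \<Phi> \<alpha> x" "(0, e)" "(\<alpha>, x + s *\<^sub>R e)"] C2 assms(1,2)
    by (simp add: numeral_2_eq_2)
  then show ?thesis by (rule line_has_derivative)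
qed

lemma deriv_second:
  assumes "\<alpha> \<in> I" "x + s *\<^sub>R e' \<in> U" "e \<in> {(1, 0), (0, 1)}" "e' \<in> {(1, 0), (0, 1)}"
  shows "((\<lambda>t. partial e (\<Phi> \<alpha>) (x + t *\<^sub>R e')) has_real_derivative partial e' (partial e (\<Phi> \<alpha>)) (x + s *\<^sub>R e')) (at s)"
proof -
  have "(0, e') \<in> (Basis :: (real \<times> (real \<times> real)) set)" using assms(4) Basis_elems by auto
  then have "(\<lambda>t. partial e (\<Phi> \<alpha>) (x + s *\<^sub>R e' + t *\<^sub>R e')) differentiable at 0"
    using C_diff_Suc_differentiable[of 0 "I \<times> U" "\<lambda>(\<alpha>, x). partial e (\<Phi> \<alpha>) x" "(0, e')" "(\<alpha>, x + s *\<^sub>R e')"]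
      C1[OF assms(3)] assms(1,2) by simp
  then show ?thesis by (rule line_has_derivative)
qed

lemma deriv_parameter:
  assumes "\<alpha> \<in> I" "x \<in> U" "e \<in> {(1, 0), (0, 1)}"
  shows "((\<lambda>\<beta>. partial e (\<Phi> \<beta>) x) has_real_derivative deriv (\<lambda>\<beta>. partial e (\<Phi> \<beta>) x) \<alpha>) (at \<alpha>)"
proof -
  have "(\<lambda>t. (\<lambda>(\<alpha>, x). partial e (\<Phi> \<alpha>) x) ((\<alpha>, x) + t *\<^sub>R (1, 0))) differentiable at 0"
    using C1[OF assms(3)] assms(1,2) Basis_elems(1) by (intro C_diff_Suc_differentiable[of 0 "I \<times> U"]) auto
  then have "((\<lambda>t. partial e (\<Phi> (\<alpha> + t)) x) has_real_derivative deriv (\<lambda>t. partial e (\<Phi> (\<alpha> + t)) x) 0) (at 0)"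
    by (simp add: DERIV_deriv_iff_real_differentiable)
  then have "((\<lambda>\<beta>. partial e (\<Phi> \<beta>) x) has_real_derivative deriv (\<lambda>t. partial e (\<Phi> (\<alpha> + t)) x) 0) (at \<alpha>)"
    using DERIV_shift[of "\<lambda>\<beta>. partial e (\<Phi> \<beta>) x" _ 0 \<alpha>] by (simp add: add.commute)
  then show ?thesis by (simp add: DERIV_imp_deriv)
qed

text \<open>Provides the continuity of the speed of the gradient curve that the change of variables
  requires.\<close>

lemma continuous_deriv_parameter:
  assumes "x \<in> U" "e \<in> {(1, 0), (0, 1)}"
  shows "continuous_on I (\<lambda>\<alpha>. deriv (\<lambda>\<beta>. partial e (\<Phi> \<beta>) x) \<alpha>)"
proof -
  have "continuous_on (I \<times> U) (partial (1, 0) (\<lambda>(\<alpha>, x). partial e (\<Phi> \<alpha>) x))"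
    using C_diff_continuous[OF C_diff_partial[of 0 "I \<times> U" "\<lambda>(\<alpha>, x). partial e (\<Phi> \<alpha>) x" "(1, 0)"]]
      C1[OF assms(2)] Basis_elems(1) by simp
  then have "continuous_on I (\<lambda>\<alpha>. partial (1, 0) (\<lambda>(\<alpha>, x). partial e (\<Phi> \<alpha>) x) (\<alpha>, x))"
    by (rule continuous_on_compose2) (use assms(1) in \<open>auto intro!: continuous_intros\<close>)
  then show ?thesis by (simp add: partial_prod_left)
qed

text \<open>The path from \<open>x\<close> to \<open>y\<close> runs parallel to the axes, so only
  mean values along coordinate segments inside the unit square occur. The first partial derivative
  is compared at points differing in both coordinates, the second at points differing in one, whence
  \<open>3 = 2 + 1\<close>.\<close>

lemma taylor:
  assumes \<alpha>: "\<alpha> \<in> I" and x: "x \<in> {0..1} \<times> {0..1}" and y: "y \<in> {0..1} \<times> {0..1}"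
    and r: "\<bar>fst y - fst x\<bar> \<le> r" "\<bar>snd y - snd x\<bar> \<le> r"
  shows "\<bar>\<Phi> \<alpha> y - \<Phi> \<alpha> x - grad (\<Phi> \<alpha>) x \<bullet> (y - x)\<bar> \<le> 3 * C0 * r\<^sup>2"
proof -
  obtain x1 x2 y1 y2 where xy: "x = (x1, x2)" "y = (y1, y2)" by (cases x, cases y) auto
  have c: "x1 \<in> {0..1}" "x2 \<in> {0..1}" "y1 \<in> {0..1}" "y2 \<in> {0..1}" using x y xy by auto
  have r1: "\<bar>y1 - x1\<bar> \<le> r" "\<bar>y2 - x2\<bar> \<le> r" using r xy by auto
  have U: "(u, v) \<in> U" if "u \<in> {0..1}" "v \<in> {0..1}" for u v using that unit by auto
  have h: "((\<lambda>t. \<Phi> \<alpha> (t, v)) has_real_derivative pd1 (\<Phi> \<alpha>) (u, v)) (at u)" if "u \<in> {0..1}" "v \<in> {0..1}" for u v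
    using deriv_first[OF \<alpha>, of "(0, v)" u "(1, 0)"] U[OF that] by simp
  have v: "((\<lambda>t. \<Phi> \<alpha> (u, t)) has_real_derivative pd2 (\<Phi> \<alpha>) (u, v)) (at v)" if "u \<in> {0..1}" "v \<in> {0..1}" for u v
    using deriv_first[OF \<alpha>, of "(u, 0)" v "(0, 1)"] U[OF that] by simp
  have lip1: "\<bar>d (\<Phi> \<alpha>) (u', v) - d (\<Phi> \<alpha>) (u, v)\<bar> \<le> C0 * \<bar>u' - u\<bar>"
    if "u \<in> {0..1}" "u' \<in> {0..1}" "v \<in> {0..1}" "d = pd1 \<or> d = pd2" for u u' v d
  proof -
    have "((\<lambda>t. d (\<Phi> \<alpha>) (t, v)) has_real_derivative pd1 (d (\<Phi> \<alpha>)) (t, v)) (at t)" if "t \<in> {0..1}" for t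
      using deriv_second[OF \<alpha>, of "(0, v)" t "(1, 0)" "(1, 0)"] deriv_second[OF \<alpha>, of "(0, v)" t "(1, 0)" "(0, 1)"]
        U[OF that \<open>v \<in> {0..1}\<close>] \<open>d = pd1 \<or> d = pd2\<close> by auto
    from mvt_segment[OF this that(1,2)] obtain t where t: "t \<in> {0..1}"
      "d (\<Phi> \<alpha>) (u', v) - d (\<Phi> \<alpha>) (u, v) = (u' - u) * pd1 (d (\<Phi> \<alpha>)) (t, v)" by blast
    have "\<bar>pd1 (d (\<Phi> \<alpha>)) (t, v)\<bar> \<le> C0" using second_bounds[OF \<alpha> U[OF t(1) that(3)], of pd1 d] that(4) by auto
    then show ?thesis unfolding t(2) abs_mult mult.commute[of C0] by (rule mult_left_mono) simp
  qed
  have lip2: "\<bar>d (\<Phi> \<alpha>) (u, v') - d (\<Phi> \<alpha>) (u, v)\<bar> \<le> C0 * \<bar>v' - v\<bar>"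
    if "u \<in> {0..1}" "v \<in> {0..1}" "v' \<in> {0..1}" "d = pd1 \<or> d = pd2" for u v' v d
  proof -
    have "((\<lambda>t. d (\<Phi> \<alpha>) (u, t)) has_real_derivative pd2 (d (\<Phi> \<alpha>)) (u, t)) (at t)" if "t \<in> {0..1}" for t
      using deriv_second[OF \<alpha>, of "(u, 0)" t "(0, 1)" "(1, 0)"] deriv_second[OF \<alpha>, of "(u, 0)" t "(0, 1)" "(0, 1)"]
        U[OF \<open>u \<in> {0..1}\<close> that] \<open>d = pd1 \<or> d = pd2\<close> by auto
    from mvt_segment[OF this that(2,3)] obtain t where t: "t \<in> {0..1}"
      "d (\<Phi> \<alpha>) (u, v') - d (\<Phi> \<alpha>) (u, v) = (v' - v) * pd2 (d (\<Phi> \<alpha>)) (u, t)" by blast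
    have "\<bar>pd2 (d (\<Phi> \<alpha>)) (u, t)\<bar> \<le> C0" using second_bounds[OF \<alpha> U[OF that(1) t(1)], of pd2 d] that(4) by auto
    then show ?thesis unfolding t(2) abs_mult mult.commute[of C0] by (rule mult_left_mono) simp
  qed
  obtain \<xi> where \<xi>: "\<xi> \<in> {0..1}" "\<bar>\<xi> - x1\<bar> \<le> \<bar>y1 - x1\<bar>"
      "\<Phi> \<alpha> (y1, y2) - \<Phi> \<alpha> (x1, y2) = (y1 - x1) * pd1 (\<Phi> \<alpha>) (\<xi>, y2)"
    using mvt_segment[OF h[OF _ c(4)] c(1,3)] by auto
  obtain \<eta> where \<eta>: "\<eta> \<in> {0..1}" "\<bar>\<eta> - x2\<bar> \<le> \<bar>y2 - x2\<bar>"
      "\<Phi> \<alpha> (x1, y2) - \<Phi> \<alpha> (x1, x2) = (y2 - x2) * pd2 (\<Phi> \<alpha>) (x1, \<eta>)"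
    using mvt_segment[OF v[OF c(1)] c(2,4)] by auto
  have r0: "0 \<le> r" using r1(1) by linarith
  have Cr: "C0 * z \<le> C0 * r" if "z \<le> r" for z using that C0 by (intro mult_left_mono) auto
  have "\<bar>pd1 (\<Phi> \<alpha>) (\<xi>, y2) - pd1 (\<Phi> \<alpha>) (x1, y2)\<bar> \<le> C0 * r"
    using order_trans[OF lip1[OF c(1) \<xi>(1) c(4) disjI1[OF refl]] Cr] \<xi>(2) r1 by linarith
  moreover have "\<bar>pd1 (\<Phi> \<alpha>) (x1, y2) - pd1 (\<Phi> \<alpha>) (x1, x2)\<bar> \<le> C0 * r"
    using order_trans[OF lip2[OF c(1,2,4) disjI1[OF refl]] Cr] r1 by linarith
  ultimately have D1: "\<bar>pd1 (\<Phi> \<alpha>) (\<xi>, y2) - pd1 (\<Phi> \<alpha>) (x1, x2)\<bar> \<le> 2 * C0 * r"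
    by linarith
  have D2: "\<bar>pd2 (\<Phi> \<alpha>) (x1, \<eta>) - pd2 (\<Phi> \<alpha>) (x1, x2)\<bar> \<le> C0 * r"
    using order_trans[OF lip2[OF c(1,2) \<eta>(1) disjI2[OF refl]] Cr] \<eta>(2) r1 by linarith
  have "\<Phi> \<alpha> y - \<Phi> \<alpha> x - grad (\<Phi> \<alpha>) x \<bullet> (y - x) =
    (y1 - x1) * (pd1 (\<Phi> \<alpha>) (\<xi>, y2) - pd1 (\<Phi> \<alpha>) (x1, x2)) + (y2 - x2) * (pd2 (\<Phi> \<alpha>) (x1, \<eta>) - pd2 (\<Phi> \<alpha>) (x1, x2))"
    using \<xi>(3) \<eta>(3) by (simp add: xy grad_def algebra_simps)
  also have "\<bar>\<dots>\<bar> \<le> r * (2 * C0 * r) + r * (C0 * r)"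
    using D1 D2 r1 r0
    by (intro order_trans[OF abs_triangle_ineq] add_mono) (auto simp: abs_mult intro!: mult_mono)
  also have "\<dots> = 3 * C0 * r\<^sup>2" by (simp add: power2_eq_square algebra_simps)
  finally show ?thesis .
qed

text \<open>The number of shifts from \<open>- N\<close> to \<open>N + 1\<close>, with
  \<open>N\<close> the ceiling of \<open>3 * C0^2\<close>: an error of \<open>3 * C0\<close> is at
  most \<open>3 * C0^2\<close> interval lengths, each at least \<open>1 / C0\<close>.\<close>

definition cover_number :: nat where
  "cover_number = 2 * nat \<lceil>3 * C0\<^sup>2\<rceil> + 2"

text \<open>
  The second order error displaces the points of the shadow by at most \<open>3 C0 L\<^sup>-\<^sup>k\<close> before rescaling,
  and the shadow consists of intervals of length at least \<open>L\<^sup>-\<^sup>k / C0\<close>.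
\<close>

lemma image_piece_cover:
  assumes \<alpha>: "\<alpha> \<in> I" and L: "L > 0" and km: "k \<le> m" and Q: "Q \<in> grid L m" and B: "B \<subseteq> grid L k"
  defines "x \<equiv> (1 / real L ^ m) *\<^sub>R idx Q"
  shows "\<exists>W\<in>sets lebesgue. \<Phi> \<alpha> ` (\<Union>r\<in>B. grid_square L (m + k) (L ^ k * fst Q + fst r, L ^ k * snd Q + snd r)) \<subseteq> W \<and>
    emeasure lebesgue W \<le> ennreal (real cover_number / real L ^ m) *
      emeasure lebesgue ((\<bullet>) (grad (\<Phi> \<alpha>) x) ` (\<Union>r\<in>B. grid_square L k r))"
proof -
  define v where "v = grad (\<Phi> \<alpha>) x"
  define S where "S = (\<bullet>) v ` (\<Union>r\<in>B. grid_square L k r)"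
  define w where "w = high_end v - low_end v"
  define N where "N = nat \<lceil>3 * C0\<^sup>2\<rceil>"
  \<comment> \<open>Copies of the linear shadow, shifted by multiples of the length
    \<open>w / L^k\<close> of one of its intervals.\<close>
  define T where "T = (\<Union>i\<in>{- int N..int N + 1}. (\<lambda>s. 1 *\<^sub>R s + of_int i * w / real L ^ k) ` S)"
  define W where "W = (\<lambda>s. (1 / real L ^ m) *\<^sub>R s + \<Phi> \<alpha> x) ` T"
  have pm: "real L ^ m > 0" and pk: "real L ^ k > 0" using L by simp_all
  have fB: "finite B" using B by (rule finite_subset) simp
  have xu: "x \<in> {0..1} \<times> {0..1}"
  proof -
    have "real (fst Q) \<le> real L ^ m" "real (snd Q) \<le> real L ^ m"
      using Q by (auto simp: grid_def simp flip: of_nat_power)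
    then show ?thesis using pm by (simp add: x_def idx_def)
  qed
  then have "x \<in> U" using unit by blast
  then have "1 / C0 \<le> norm v" unfolding v_def by (rule conjunct1[OF grad_bounds[OF \<alpha>]])
  also have "norm v \<le> w"
    unfolding w_def high_end_minus_low_end by (cases v) (simp add: norm_Pair sqrt_sum_squares_le_sum_abs)
  finally have w: "1 / C0 \<le> w" .
  have w0: "0 < w" using w C0 by (meson less_le_trans zero_less_divide_1_iff zero_less_one)
  have Nw: "3 * C0 / w \<le> real N"
  proof -
    have "3 * C0 / w \<le> 3 * C0 / (1 / C0)" using w w0 C0 by (intro divide_left_mono) auto
    also have "\<dots> = 3 * C0\<^sup>2" by (simp add: power2_eq_square)
    also have "\<dots> \<le> real N" unfolding N_def by (rule real_nat_ceiling_ge)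
    finally show ?thesis .
  qed
  have cS: "compact S"
    unfolding S_def grid_square_def
    by (intro compact_continuous_image continuous_intros compact_UN fB compact_Times) auto
  have cT: "compact T"
    unfolding T_def by (intro compact_UN compact_continuous_image continuous_intros cS) auto
  have cW: "compact W"
    unfolding W_def by (intro compact_continuous_image continuous_intros cT)
  have leb: "X \<in> sets lebesgue" if "compact X" for X :: "real set"
    using borel_compact[OF that] by simp
  have "\<Phi> \<alpha> ` (\<Union>r\<in>B. grid_square L (m + k) (L ^ k * fst Q + fst r, L ^ k * snd Q + snd r)) \<subseteq> W"
  proof (intro image_subsetI)
    fix y assume "y \<in> (\<Union>r\<in>B. grid_square L (m + k) (L ^ k * fst Q + fst r, L ^ k * snd Q + snd r))"
    then obtain r where r: "r \<in> B" "y \<in> grid_square L (m + k) (L ^ k * fst Q + fst r, L ^ k * snd Q + snd r)" by blast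
    then obtain u where u: "u \<in> {0..1} \<times> {0..1}"
      "y = (1 / real L ^ (m + k)) *\<^sub>R (idx (L ^ k * fst Q + fst r, L ^ k * snd Q + snd r) + u)"
      unfolding grid_square_eq_image[OF L] by blast
    define z where "z = (1 / real L ^ k) *\<^sub>R (idx r + u)"
    have zr: "z \<in> grid_square L k r" unfolding grid_square_eq_image[OF L] z_def using u(1) by blast
    have zu: "z \<in> {0..1} \<times> {0..1}" using grid_square_subset[OF L, of r k] B r(1) zr by blast
    have yx: "y - x = (1 / real L ^ m) *\<^sub>R z"
      using pm pk by (simp add: u(2) x_def z_def idx_def power_add prod_eq_iff field_simps)
    have yu: "y \<in> {0..1} \<times> {0..1}"
    proof (rule subsetD[OF grid_square_subset[OF L] r(2)])
      have *: "L ^ k * a + c < L ^ (m + k)" if "a < L ^ m" "c < L ^ k" for a c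
      proof -
        have "L ^ k * a + c < L ^ k * (a + 1)" using that(2) by simp
        also have "\<dots> \<le> L ^ k * L ^ m" using that(1) by (intro mult_left_mono) auto
        finally show ?thesis by (simp add: power_add mult.commute)
      qed
      show "(L ^ k * fst Q + fst r, L ^ k * snd Q + snd r) \<in> grid L (m + k)"
        using Q subsetD[OF B r(1)] by (auto simp: grid_def intro!: *)
    qed
    define e where "e = real L ^ m * (\<Phi> \<alpha> y - \<Phi> \<alpha> x) - v \<bullet> z"
    have "\<bar>\<Phi> \<alpha> y - \<Phi> \<alpha> x - v \<bullet> (y - x)\<bar> \<le> 3 * C0 * (1 / real L ^ m)\<^sup>2"
      unfolding v_def
    proof (rule taylor[OF \<alpha> xu yu])
      have "fst y - fst x = 1 / real L ^ m * fst z" "snd y - snd x = 1 / real L ^ m * snd z"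
        using arg_cong[OF yx, of fst] arg_cong[OF yx, of snd] by simp_all
      then show "\<bar>fst y - fst x\<bar> \<le> 1 / real L ^ m" "\<bar>snd y - snd x\<bar> \<le> 1 / real L ^ m"
        using zu pm by (auto simp: abs_mult mem_Times_iff divide_right_mono)
    qed
    then have "real L ^ m * \<bar>\<Phi> \<alpha> y - \<Phi> \<alpha> x - v \<bullet> (y - x)\<bar> \<le> real L ^ m * (3 * C0 * (1 / real L ^ m)\<^sup>2)"
      using pm by (intro mult_left_mono) auto
    also have "real L ^ m * \<bar>\<Phi> \<alpha> y - \<Phi> \<alpha> x - v \<bullet> (y - x)\<bar> = \<bar>e\<bar>"
    proof -
      have "e = real L ^ m * (\<Phi> \<alpha> y - \<Phi> \<alpha> x - v \<bullet> (y - x))"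
        unfolding yx e_def right_diff_distrib using pm by simp
      then show ?thesis using pm by (simp add: abs_mult)
    qed
    also have "real L ^ m * (3 * C0 * (1 / real L ^ m)\<^sup>2) = 3 * C0 / real L ^ m"
      using pm by (simp add: power2_eq_square)
    \<comment> \<open>Here \<open>k \<le> m\<close> enters: the Taylor error magnified by
      \<open>L^m\<close> stays within a constant multiple of the finest scale \<open>L^-k\<close> of
      the shadow.\<close>
    also have "\<dots> \<le> 3 * C0 / real L ^ k"
      using L km C0 pk pm by (intro divide_left_mono power_increasing) auto
    finally have e: "\<bar>e\<bar> \<le> 3 * C0 / real L ^ k" .
    define \<sigma> where "\<sigma> = real L ^ k * (v \<bullet> z + e) - v \<bullet> idx r"
    \<comment> \<open>The shift that brings the displaced point back into the interval of the same
      square \<open>r\<close>.\<close>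
    define i where "i = \<lfloor>(\<sigma> - low_end v) / w\<rfloor>"
    have "v \<bullet> z \<in> (\<bullet>) v ` grid_square L k r" using zr by blast
    then have I0: "low_end v \<le> real L ^ k * (v \<bullet> z) - v \<bullet> idx r" "real L ^ k * (v \<bullet> z) - v \<bullet> idx r \<le> low_end v + w"
      unfolding image_grid_square[OF L] by (auto simp: proj_interval_def w_def)
    have "\<bar>real L ^ k * e\<bar> \<le> 3 * C0" using e pk by (simp add: abs_mult field_simps)
    then have "- (3 * C0) \<le> \<sigma> - low_end v" "\<sigma> - low_end v \<le> w + 3 * C0"
      using I0 unfolding \<sigma>_def distrib_left by linarith+
    from this[THEN divide_right_mono, OF less_imp_le[OF w0]]
    have "- (3 * C0) / w \<le> (\<sigma> - low_end v) / w" "(\<sigma> - low_end v) / w \<le> (w + 3 * C0) / w" .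
    then have "- real N \<le> (\<sigma> - low_end v) / w" "(\<sigma> - low_end v) / w \<le> 1 + real N"
      using Nw w0 by (simp_all add: add_divide_distrib)
    then have iN: "i \<in> {- int N..int N + 1}"
      unfolding i_def by (simp add: le_floor_iff) linarith
    have "of_int i \<le> (\<sigma> - low_end v) / w" "(\<sigma> - low_end v) / w < of_int i + 1" by (auto simp: i_def)
    then have \<sigma>i: "low_end v \<le> \<sigma> - of_int i * w" "\<sigma> - of_int i * w \<le> high_end v"
      using w0 by (auto simp: field_simps w_def)
    define s where "s = v \<bullet> z + e - of_int i * w / real L ^ k"
    have "real L ^ k * s - v \<bullet> idx r = \<sigma> - of_int i * w"
      using L by (simp add: s_def \<sigma>_def algebra_simps)
    then have "s \<in> (\<bullet>) v ` grid_square L k r"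
      unfolding image_grid_square[OF L] using \<sigma>i by (simp add: proj_interval_def)
    then have "s \<in> S" unfolding S_def using r(1) by blast
    moreover have "v \<bullet> z + e = 1 *\<^sub>R s + of_int i * w / real L ^ k" by (simp add: s_def)
    ultimately have "v \<bullet> z + e \<in> T" unfolding T_def using iN by blast
    moreover have "\<Phi> \<alpha> y = (1 / real L ^ m) *\<^sub>R (v \<bullet> z + e) + \<Phi> \<alpha> x" using pm by (simp add: e_def)
    ultimately show "\<Phi> \<alpha> y \<in> W" unfolding W_def by blast
  qed
  moreover have "emeasure lebesgue W \<le> ennreal (real cover_number / real L ^ m) * emeasure lebesgue S"
  proof -
    have "emeasure lebesgue T \<le> (\<Sum>i\<in>{- int N..int N + 1}. emeasure lebesgue ((\<lambda>s. 1 *\<^sub>R s + of_int i * w / real L ^ k) ` S))"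
      unfolding T_def
      by (intro emeasure_subadditive_finite) (auto intro!: leb compact_continuous_image continuous_intros cS)
    also have "\<dots> = (\<Sum>i\<in>{- int N..int N + 1}. emeasure lebesgue S)"
      by (intro sum.cong refl, subst emeasure_lebesgue_affine) simp
    also have "\<dots> = ennreal (real cover_number) * emeasure lebesgue S"
    proof -
      have "card {- int N..int N + 1} = cover_number" by (simp add: cover_number_def N_def[symmetric])
      then show ?thesis by (simp only: sum_constant ennreal_of_nat_eq_real_of_nat)
    qed
    finally have T: "emeasure lebesgue T \<le> ennreal (real cover_number) * emeasure lebesgue S" .
    have "emeasure lebesgue W = ennreal (1 / real L ^ m) * emeasure lebesgue T"
      unfolding W_def using emeasure_lebesgue_affine[of "1 / real L ^ m" "\<Phi> \<alpha> x" T] pm by simp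
    also have "\<dots> \<le> ennreal (1 / real L ^ m) * (ennreal (real cover_number) * emeasure lebesgue S)"
      by (intro mult_left_mono T) simp
    also have "\<dots> = ennreal (real cover_number / real L ^ m) * emeasure lebesgue S"
      by (simp add: mult.assoc[symmetric] ennreal_mult[symmetric])
    finally show ?thesis .
  qed
  ultimately show ?thesis using leb[OF cW] unfolding S_def v_def by blast
qed

definition distortion :: real where
  "distortion = C0 ^ 4 * (C0 ^ 3 * (b - a) / pi + 2)"

lemma distortion_pos: "0 < distortion"
proof -
  have "0 \<le> C0 ^ 3 * (b - a) / pi" using C0 ab by simp
  then show ?thesis unfolding distortion_def using C0 by (intro mult_pos_pos) auto
qed

text \<open>Extended by 0 outside \<open>I\<close>, so that it is Borel measurable on the whole
  line.\<close>

definition gradient_at :: "real \<times> real \<Rightarrow> real \<Rightarrow> real \<times> real" where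
  "gradient_at x \<alpha> = indicator I \<alpha> *\<^sub>R grad (\<Phi> \<alpha>) x"

lemma measurable_gradient_at:
  assumes "x \<in> U"
  shows "gradient_at x \<in> borel_measurable borel"
proof -
  have "continuous_on I (\<lambda>\<alpha>. partial e (\<Phi> \<alpha>) x)" if "e \<in> {(1, 0), (0, 1)}" for e
    by (rule continuous_at_imp_continuous_on, rule ballI, rule DERIV_isCont)
       (erule deriv_parameter[OF _ assms that])
  then have "continuous_on I (\<lambda>\<alpha>. grad (\<Phi> \<alpha>) x)"
    unfolding grad_def by (intro continuous_on_Pair) auto
  then show ?thesis unfolding gradient_at_def [abs_def]
    by (intro borel_measurable_continuous_on_indicator) (auto simp: I)
qed

text \<open>At a fixed point \<open>x\<close>, the determinant condition says that the curve of
  gradients turns with speed bounded above and below; this is where the curved family meets the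
  ordinary directions.\<close>

lemma nn_integral_mean_shadow_gradient:
  assumes sel: "selection L \<mu>" and L: "L > 0" and x: "x \<in> U"
  shows "(\<integral>\<^sup>+\<alpha>. mean_shadow L \<mu> k (gradient_at x \<alpha>) * indicator I \<alpha> \<partial>lborel) \<le>
    ennreal distortion * expectation_of (random_set L \<mu> k) favard"
proof -
  have "(\<integral>\<^sup>+\<alpha>. mean_shadow L \<mu> k (gradient_at x \<alpha>) * indicator I \<alpha> \<partial>lborel) =
    (\<integral>\<^sup>+\<alpha>. mean_shadow L \<mu> k (pd1 (\<Phi> \<alpha>) x, pd2 (\<Phi> \<alpha>) x) * indicator {a<..<b} \<alpha> \<partial>lborel)"
    unfolding I[symmetric] by (intro nn_integral_cong) (simp add: gradient_at_def grad_def indicator_def)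
  also have "\<dots> \<le> ennreal distortion * (\<integral>\<^sup>+\<theta>. mean_shadow L \<mu> k (cos \<theta>, sin \<theta>) * indicator {0..pi} \<theta> \<partial>lborel)"
    unfolding distortion_def
  proof (rule nn_integral_direction_curve[OF measurable_mean_shadow[OF sel L] mean_shadow_scaleR ab])
    show "((\<lambda>\<beta>. pd1 (\<Phi> \<beta>) x) has_real_derivative deriv (\<lambda>\<beta>. pd1 (\<Phi> \<beta>) x) \<alpha>) (at \<alpha>)" if "\<alpha> \<in> {a<..<b}" for \<alpha>
      using deriv_parameter[OF _ x, of \<alpha> "(1, 0)"] that by (simp add: I)
    show "((\<lambda>\<beta>. pd2 (\<Phi> \<beta>) x) has_real_derivative deriv (\<lambda>\<beta>. pd2 (\<Phi> \<beta>) x) \<alpha>) (at \<alpha>)" if "\<alpha> \<in> {a<..<b}" for \<alpha>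
      using deriv_parameter[OF _ x, of \<alpha> "(0, 1)"] that by (simp add: I)
    show "continuous_on {a<..<b} (\<lambda>\<alpha>. deriv (\<lambda>\<beta>. pd1 (\<Phi> \<beta>) x) \<alpha>)"
      "continuous_on {a<..<b} (\<lambda>\<alpha>. deriv (\<lambda>\<beta>. pd2 (\<Phi> \<beta>) x) \<alpha>)"
      using continuous_deriv_parameter[OF x, of "(1, 0)"] continuous_deriv_parameter[OF x, of "(0, 1)"] by (simp_all add: I)
    show "1 / C0 \<le> norm (pd1 (\<Phi> \<alpha>) x, pd2 (\<Phi> \<alpha>) x) \<and> norm (pd1 (\<Phi> \<alpha>) x, pd2 (\<Phi> \<alpha>) x) \<le> C0" if "\<alpha> \<in> {a<..<b}" for \<alpha>
      using grad_bounds[of \<alpha> x] that x by (simp add: I grad_def)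
    show "1 / C0 \<le> \<bar>pd1 (\<Phi> \<alpha>) x * deriv (\<lambda>\<beta>. pd2 (\<Phi> \<beta>) x) \<alpha> - deriv (\<lambda>\<beta>. pd1 (\<Phi> \<beta>) x) \<alpha> * pd2 (\<Phi> \<alpha>) x\<bar> \<and>
      \<bar>pd1 (\<Phi> \<alpha>) x * deriv (\<lambda>\<beta>. pd2 (\<Phi> \<beta>) x) \<alpha> - deriv (\<lambda>\<beta>. pd1 (\<Phi> \<beta>) x) \<alpha> * pd2 (\<Phi> \<alpha>) x\<bar> \<le> C0" if "\<alpha> \<in> {a<..<b}" for \<alpha>
      using det_bounds[of \<alpha> x] that x by (simp add: I mixed_det_def det_2)
  qed (use C0 in auto)
  finally show ?thesis by (simp add: expectation_favard[OF sel L])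
qed

lemma grid_squares_subset_pieces:
  assumes L: "L > 0" and A: "A \<subseteq> grid L (m + k)"
  shows "(\<Union>q\<in>A. grid_square L (m + k) q) \<subseteq>
    (\<Union>Q\<in>grid L m. \<Union>r\<in>restrict_to L k Q A. grid_square L (m + k) (L ^ k * fst Q + fst r, L ^ k * snd Q + snd r))"
proof
  fix y assume "y \<in> (\<Union>q\<in>A. grid_square L (m + k) q)"
  then obtain q where q: "q \<in> A" "y \<in> grid_square L (m + k) q" by blast
  define Q r where "Q = (fst q div L ^ k, snd q div L ^ k)" and "r = (fst q mod L ^ k, snd q mod L ^ k)"
  have e: "(L ^ k * fst Q + fst r, L ^ k * snd Q + snd r) = q" by (simp add: Q_def r_def)
  have "fst q < L ^ m * L ^ k" "snd q < L ^ m * L ^ k"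
    using subsetD[OF A q(1)] by (auto simp: grid_def power_add)
  then have "Q \<in> grid L m" by (auto simp: Q_def grid_def less_mult_imp_div_less)
  moreover have "r \<in> grid L k" using L by (auto simp: r_def grid_def)
  then have "r \<in> restrict_to L k Q A" using q(1) e by (simp add: restrict_to_def)
  ultimately show "y \<in> (\<Union>Q\<in>grid L m. \<Union>r\<in>restrict_to L k Q A. grid_square L (m + k) (L ^ k * fst Q + fst r, L ^ k * snd Q + snd r))"
    using q(2) e by (intro UN_I[of Q] UN_I[of r]) simp_all
qed

text \<open>Subadditivity is applied to measurable covers \<open>W Q\<close> of the images of the
  pieces.\<close>

lemma emeasure_image_le_pieces:
  assumes \<alpha>: "\<alpha> \<in> I" and L: "L > 0" and km: "k \<le> m" and A: "A \<subseteq> grid L (m + k)"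
  shows "emeasure lebesgue (\<Phi> \<alpha> ` (\<Union>q\<in>A. grid_square L (m + k) q)) \<le>
    (\<Sum>Q\<in>grid L m. ennreal (real cover_number / real L ^ m) *
      emeasure lebesgue ((\<bullet>) (grad (\<Phi> \<alpha>) ((1 / real L ^ m) *\<^sub>R idx Q)) ` (\<Union>r\<in>restrict_to L k Q A. grid_square L k r)))"
proof -
  let ?piece = "\<lambda>Q. \<Union>r\<in>restrict_to L k Q A. grid_square L (m + k) (L ^ k * fst Q + fst r, L ^ k * snd Q + snd r)"
  let ?bound = "\<lambda>Q. ennreal (real cover_number / real L ^ m) *
      emeasure lebesgue ((\<bullet>) (grad (\<Phi> \<alpha>) ((1 / real L ^ m) *\<^sub>R idx Q)) ` (\<Union>r\<in>restrict_to L k Q A. grid_square L k r))"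
  have "\<forall>Q\<in>grid L m. \<exists>W. W \<in> sets lebesgue \<and> \<Phi> \<alpha> ` ?piece Q \<subseteq> W \<and> emeasure lebesgue W \<le> ?bound Q"
  proof
    fix Q assume Q: "Q \<in> grid L m"
    have "restrict_to L k Q A \<subseteq> grid L k" by (auto simp: restrict_to_def)
    from image_piece_cover[OF \<alpha> L km Q this]
    show "\<exists>W. W \<in> sets lebesgue \<and> \<Phi> \<alpha> ` ?piece Q \<subseteq> W \<and> emeasure lebesgue W \<le> ?bound Q" by blast
  qed
  then obtain W where W: "\<And>Q. Q \<in> grid L m \<Longrightarrow> W Q \<in> sets lebesgue"
    "\<And>Q. Q \<in> grid L m \<Longrightarrow> \<Phi> \<alpha> ` ?piece Q \<subseteq> W Q" "\<And>Q. Q \<in> grid L m \<Longrightarrow> emeasure lebesgue (W Q) \<le> ?bound Q"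
    unfolding bchoice_iff by blast
  have "\<Phi> \<alpha> ` (\<Union>q\<in>A. grid_square L (m + k) q) \<subseteq> \<Phi> \<alpha> ` (\<Union>Q\<in>grid L m. ?piece Q)"
    by (intro image_mono grid_squares_subset_pieces L A)
  also have "\<dots> \<subseteq> (\<Union>Q\<in>grid L m. W Q)" unfolding image_UN[of "\<Phi> \<alpha>" ?piece] by (intro UN_mono subset_refl W(2))
  finally have "emeasure lebesgue (\<Phi> \<alpha> ` (\<Union>q\<in>A. grid_square L (m + k) q)) \<le> emeasure lebesgue (\<Union>Q\<in>grid L m. W Q)"
    by (rule emeasure_mono) (auto intro!: sets.finite_UN W(1))
  also have "\<dots> \<le> (\<Sum>Q\<in>grid L m. emeasure lebesgue (W Q))"
    by (rule emeasure_subadditive_finite) (use W(1) in auto)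
  also have "\<dots> \<le> (\<Sum>Q\<in>grid L m. ?bound Q)" by (intro sum_mono W(3))
  finally show ?thesis .
qed

text \<open>There are \<open>L^(2 * m)\<close> squares \<open>Q\<close> of generation
  \<open>m\<close>; one factor \<open>L^-m\<close> comes from rescaling and one from the probability
  that \<open>Q\<close> is chosen, and together they cancel the number of squares.\<close>

theorem expectation_family_favard_le:
  assumes u: "uniform_selection L \<mu>" and L: "L > 0" and km: "k \<le> m"
  shows "expectation_of (random_set L \<mu> (m + k)) (family_favard I \<Phi>) \<le>
    ennreal (real cover_number * distortion) * expectation_of (random_set L \<mu> k) favard"
proof -
  note sel = uniform_imp_selection[OF u]
  define x where "x Q = (1 / real L ^ m) *\<^sub>R idx Q" for Q
  define c where "c = ennreal (real cover_number / real L ^ m)"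
  define G where "G B v = emeasure lebesgue ((\<bullet>) v ` (\<Union>r\<in>B. grid_square L k r))" for B v
  define \<psi> where "\<psi> Q B = (\<integral>\<^sup>+\<alpha>. G B (gradient_at (x Q) \<alpha>) * indicator I \<alpha> \<partial>lborel)" for Q B
  let ?E = "expectation_of (random_set L \<mu> k) favard"
  have xU: "x Q \<in> U" if "Q \<in> grid L m" for Q
  proof -
    have "real (fst Q) \<le> real L ^ m" "real (snd Q) \<le> real L ^ m"
      using that by (auto simp: grid_def simp flip: of_nat_power)
    then have "x Q \<in> {0..1} \<times> {0..1}" using L by (simp add: x_def idx_def)
    then show ?thesis by (rule subsetD[OF unit])
  qed
  have Im: "I \<in> sets borel" by (simp add: I)
  have m: "(\<lambda>\<alpha>. G B (gradient_at (x Q) \<alpha>) * indicator I \<alpha>) \<in> borel_measurable borel"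
    if "finite B" "Q \<in> grid L m" for B Q
  proof -
    have "(\<lambda>\<alpha>. G B (gradient_at (x Q) \<alpha>)) \<in> borel_measurable borel"
      unfolding G_def by (rule measurable_compose[OF measurable_gradient_at[OF xU[OF that(2)]] measurable_shadow[OF L that(1)]])
    then show ?thesis using Im by measurable
  qed
  have fin: "finite (restrict_to L k Q A)" for Q A
    by (rule finite_subset[of _ "grid L k"]) (auto simp: restrict_to_def)
  have one: "family_favard I \<Phi> (\<Union>q\<in>A. grid_square L (m + k) q) \<le> (\<Sum>Q\<in>grid L m. c * \<psi> Q (restrict_to L k Q A))"
    if A: "A \<in> set_pmf (chosen_squares L \<mu> (m + k))" for A
  proof -
    have "family_favard I \<Phi> (\<Union>q\<in>A. grid_square L (m + k) q) \<le>
      (\<integral>\<^sup>+\<alpha>. (\<Sum>Q\<in>grid L m. c * (G (restrict_to L k Q A) (gradient_at (x Q) \<alpha>) * indicator I \<alpha>)) \<partial>lebesgue)"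
      unfolding family_favard_def
    proof (intro nn_integral_mono)
      fix \<alpha> :: real
      show "emeasure lebesgue (\<Phi> \<alpha> ` (\<Union>q\<in>A. grid_square L (m + k) q)) * indicator I \<alpha> \<le>
        (\<Sum>Q\<in>grid L m. c * (G (restrict_to L k Q A) (gradient_at (x Q) \<alpha>) * indicator I \<alpha>))"
      proof (cases "\<alpha> \<in> I")
        case True
        then show ?thesis
          using emeasure_image_le_pieces[OF True L km chosen_squares_subset[OF sel A]]
          by (simp add: G_def c_def x_def gradient_at_def)
      qed simp
    qed
    also have "\<dots> = (\<integral>\<^sup>+\<alpha>. (\<Sum>Q\<in>grid L m. c * (G (restrict_to L k Q A) (gradient_at (x Q) \<alpha>) * indicator I \<alpha>)) \<partial>lborel)"
      by (rule nn_integral_completion)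
    also have "\<dots> = (\<Sum>Q\<in>grid L m. c * \<psi> Q (restrict_to L k Q A))"
      using m[OF fin] by (simp add: nn_integral_sum nn_integral_cmult \<psi>_def)
    finally show ?thesis .
  qed
  have "expectation_of (random_set L \<mu> (m + k)) (family_favard I \<Phi>) =
    (\<integral>\<^sup>+A. family_favard I \<Phi> (\<Union>q\<in>A. grid_square L (m + k) q) \<partial>measure_pmf (chosen_squares L \<mu> (m + k)))"
    by (simp add: expectation_of_def random_set_def)
  also have "\<dots> \<le> (\<integral>\<^sup>+A. (\<Sum>Q\<in>grid L m. c * \<psi> Q (restrict_to L k Q A)) \<partial>measure_pmf (chosen_squares L \<mu> (m + k)))"
    using one by (intro nn_integral_mono_AE) (simp add: AE_measure_pmf_iff)
  also have "\<dots> = (\<Sum>Q\<in>grid L m. c * (\<integral>\<^sup>+A. \<psi> Q (restrict_to L k Q A) \<partial>measure_pmf (chosen_squares L \<mu> (m + k))))"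
    by (simp add: nn_integral_sum nn_integral_cmult)
  also have "\<dots> \<le> (\<Sum>Q\<in>grid L m. c * (ennreal (1 / real L ^ m) * (ennreal distortion * ?E)))"
  proof (intro sum_mono mult_left_mono)
    fix Q assume Q: "Q \<in> grid L m"
    have "(\<integral>\<^sup>+A. \<psi> Q (restrict_to L k Q A) \<partial>measure_pmf (chosen_squares L \<mu> (m + k))) =
      ennreal (1 / real L ^ m) * (\<integral>\<^sup>+B. \<psi> Q B \<partial>measure_pmf (chosen_squares L \<mu> k))"
      by (rule nn_integral_restrict_to[OF u Q]) (simp add: \<psi>_def G_def)
    also have "(\<integral>\<^sup>+B. \<psi> Q B \<partial>measure_pmf (chosen_squares L \<mu> k)) =
      (\<Sum>B\<in>set_pmf (chosen_squares L \<mu> k). \<integral>\<^sup>+\<alpha>. G B (gradient_at (x Q) \<alpha>) * indicator I \<alpha> * ennreal (pmf (chosen_squares L \<mu> k) B) \<partial>lborel)"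
      by (subst nn_integral_measure_pmf_finite[OF finite_set_pmf_chosen[OF sel]])
         (auto simp: \<psi>_def nn_integral_multc m[OF finite_chosen_squares[OF sel] Q] intro!: sum.cong)
    also have "\<dots> = (\<integral>\<^sup>+\<alpha>. (\<Sum>B\<in>set_pmf (chosen_squares L \<mu> k). G B (gradient_at (x Q) \<alpha>) * indicator I \<alpha> * ennreal (pmf (chosen_squares L \<mu> k) B)) \<partial>lborel)"
      using m[OF finite_chosen_squares[OF sel] Q] by (intro nn_integral_sum[symmetric]) auto
    also have "\<dots> = (\<integral>\<^sup>+\<alpha>. mean_shadow L \<mu> k (gradient_at (x Q) \<alpha>) * indicator I \<alpha> \<partial>lborel)"
      unfolding mean_shadow_eq_sum[OF sel] G_def
      by (intro nn_integral_cong) (simp add: sum_distrib_right sum_distrib_left mult_ac)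
    also have "\<dots> \<le> ennreal distortion * ?E"
      by (rule nn_integral_mean_shadow_gradient[OF sel L xU[OF Q]])
    finally show "(\<integral>\<^sup>+A. \<psi> Q (restrict_to L k Q A) \<partial>measure_pmf (chosen_squares L \<mu> (m + k))) \<le>
      ennreal (1 / real L ^ m) * (ennreal distortion * ?E)" by (simp add: mult_left_mono)
  qed simp
  also have "\<dots> = of_nat (L ^ m * L ^ m) * (c * (ennreal (1 / real L ^ m) * (ennreal distortion * ?E)))"
    by (simp add: card_grid)
  also have "\<dots> = ennreal (real (L ^ m * L ^ m) * (real cover_number / real L ^ m) * (1 / real L ^ m) * distortion) * ?E"
  proof -
    have em: "ennreal y * (ennreal z * e) = ennreal (y * z) * e" if "0 \<le> y" "0 \<le> z" for y z e
      using that by (simp add: ennreal_mult mult.assoc)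
    show ?thesis
      unfolding c_def ennreal_of_nat_eq_real_of_nat using distortion_pos by (simp add: em)
  qed
  also have "real (L ^ m * L ^ m) * (real cover_number / real L ^ m) * (1 / real L ^ m) * distortion = real cover_number * distortion"
    using L by simp
  finally show ?thesis .
qed

text \<open>The larger half \<open>n - n div 2\<close> is taken as the generation of the pieces, as
  the Taylor estimate asks for \<open>k \<le> m\<close>.\<close>

lemma half_generation_bound:
  assumes "uniform_selection L \<mu>" and "L > 0"
  shows "expectation_of (random_set L \<mu> n) (family_favard I \<Phi>) \<le>
    ennreal (real cover_number * distortion) * expectation_of (random_set L \<mu> (n div 2)) favard"
proof -
  have "n = (n - n div 2) + n div 2" "n div 2 \<le> n - n div 2" by linarith+
  then show ?thesis using expectation_family_favard_le[OF assms, of "n div 2" "n - n div 2"] by simp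
qed

end

section \<open>Bounds for the curved family\<close>

lemma expectation_favard_finite:
  assumes sel: "selection L \<mu>" and L: "L > 0"
  shows "expectation_of (random_set L \<mu> n) favard \<le> ennreal (2 * pi)"
proof -
  have "expectation_of (random_set L \<mu> n) favard \<le> (\<integral>\<^sup>+\<theta>. ennreal 2 * indicator {0..pi} \<theta> \<partial>lborel)"
    unfolding expectation_favard[OF sel L]
  proof (intro nn_integral_mono mult_right_mono)
    fix \<theta> :: real
    have "mean_shadow L \<mu> n (cos \<theta>, sin \<theta>) \<le> ennreal (\<bar>cos \<theta>\<bar> + \<bar>sin \<theta>\<bar>)"
      using mean_shadow_le[OF sel L, of n "(cos \<theta>, sin \<theta>)"] by simp
    also have "\<dots> \<le> ennreal 2" using abs_cos_le_one[of \<theta>] abs_sin_le_one[of \<theta>] by (intro ennreal_leI) linarith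
    finally show "mean_shadow L \<mu> n (cos \<theta>, sin \<theta>) \<le> ennreal 2" .
  qed simp
  also have "\<dots> = ennreal 2 * ennreal pi" by (simp add: nn_integral_cmult)
  also have "\<dots> = ennreal (2 * pi)" using ennreal_mult[of 2 pi] by simp
  finally show ?thesis .
qed

theorem theorem2p6:
  fixes a b C\<^sub>0 :: real and I :: "real set" and U :: "(real \<times> real) set"
    and \<Phi> :: "real \<Rightarrow> real \<times> real \<Rightarrow> real" and L :: nat
  assumes "a < b" and "I = {a<..<b}"
    and "open U" and "{0..1} \<times> {0..1} \<subseteq> U"
    and "C_diff 2 (I \<times> U) (\<lambda>(\<alpha>, x). \<Phi> \<alpha> x)"
    and "C\<^sub>0 \<ge> 1"
    and "\<And>\<alpha> x. \<alpha> \<in> I \<Longrightarrow> x \<in> U \<Longrightarrow> 1 / C\<^sub>0 \<le> norm (grad (\<Phi> \<alpha>) x) \<and> norm (grad (\<Phi> \<alpha>) x) \<le> C\<^sub>0"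
    and "\<And>\<alpha> x d d'. \<alpha> \<in> I \<Longrightarrow> x \<in> U \<Longrightarrow> d \<in> {pd1, pd2} \<Longrightarrow> d' \<in> {pd1, pd2} \<Longrightarrow>
           \<bar>d (d' (\<Phi> \<alpha>)) x\<bar> \<le> C\<^sub>0"
    and "\<And>\<alpha> x. \<alpha> \<in> I \<Longrightarrow> x \<in> U \<Longrightarrow>
           1 / C\<^sub>0 \<le> \<bar>mixed_det \<Phi> \<alpha> x\<bar> \<and> \<bar>mixed_det \<Phi> \<alpha> x\<bar> \<le> C\<^sub>0"
    and "L \<ge> 2"
  shows "(\<exists>C>0. \<forall>\<mu>. uniform_selection L \<mu> \<longrightarrow>
            (\<forall>n. expectation_of (random_set L \<mu> n) (family_favard I \<Phi>)
                   \<le> ennreal C * expectation_of (random_set L \<mu> (n div 2)) favard)) \<and>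
         (\<forall>\<mu>. uniform_selection L \<mu> \<and> \<not> degenerate L \<mu> \<longrightarrow>
            (\<exists>K>0. \<forall>n\<ge>1. expectation_of (random_set L \<mu> n) (family_favard I \<Phi>)
                           \<le> ennreal (K * (1 / real n)))) \<and>
         (\<forall>\<mu>. uniform_selection L \<mu> \<and> degenerate L \<mu> \<longrightarrow>
            (\<exists>K>0. \<forall>n\<ge>2. expectation_of (random_set L \<mu> n) (family_favard I \<Phi>)
                           \<le> ennreal (K * (ln (real n) / real n))))"
proof -
  interpret transversal_family a b C\<^sub>0 I U \<Phi>
    using assms by unfold_locales
  have L: "L \<ge> 2" and L0: "L > 0" using \<open>L \<ge> 2\<close> by auto
  define C where "C = real cover_number * distortion"
  have "0 < real cover_number" unfolding of_nat_0_less_iff by (simp add: cover_number_def)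
  then have C: "0 < C" using distortion_pos by (simp add: C_def)
  have half: "expectation_of (random_set L \<mu> n) (family_favard I \<Phi>) \<le>
      ennreal C * expectation_of (random_set L \<mu> (n div 2)) favard" if "uniform_selection L \<mu>" for \<mu> n
    unfolding C_def by (rule half_generation_bound[OF that L0])
  have transfer: "expectation_of (random_set L \<mu> n) (family_favard I \<Phi>) \<le> ennreal (C * X)"
    if "uniform_selection L \<mu>" "expectation_of (random_set L \<mu> (n div 2)) favard \<le> ennreal X" "0 \<le> X" for \<mu> n X
  proof -
    have "ennreal C * expectation_of (random_set L \<mu> (n div 2)) favard \<le> ennreal C * ennreal X"
      using that(2) by (rule mult_left_mono) simp
    also have "\<dots> = ennreal (C * X)" using C that(3) by (simp add: ennreal_mult)
    finally show ?thesis using half[OF that(1), of n] by (rule order_trans[rotated])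
  qed
  have nondeg: "\<exists>K>0. \<forall>n\<ge>1. expectation_of (random_set L \<mu> n) (family_favard I \<Phi>) \<le> ennreal (K * (1 / real n))"
    if u: "uniform_selection L \<mu>" and nd: "\<not> degenerate L \<mu>" for \<mu>
  proof -
    obtain c where c: "c > 0" "\<And>n. n \<ge> 1 \<Longrightarrow> expectation_of (random_set L \<mu> n) favard \<le> ennreal (c / real n)"
      using favard_nondegenerate_bound[OF u L nd] by blast
    \<comment> \<open>For \<open>n = 1\<close> the half generation is 0 and the trivial bound
      \<open>2 * pi\<close> is used; the other \<open>n\<close> satisfy
      \<open>n <= 3 * (n div 2)\<close>, whence \<open>3 * c\<close>.\<close>
    define K where "K = C * (2 * pi + 3 * c)"
    have "expectation_of (random_set L \<mu> n) (family_favard I \<Phi>) \<le> ennreal (K * (1 / real n))" if n: "n \<ge> 1" for n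
    proof (cases "n = 1")
      case True
      have "expectation_of (random_set L \<mu> n) (family_favard I \<Phi>) \<le> ennreal (C * (2 * pi))"
        by (rule transfer[OF u expectation_favard_finite[OF uniform_imp_selection[OF u] L0]]) simp
      also have "\<dots> \<le> ennreal (K * (1 / real n))"
        using True C c(1) by (intro ennreal_leI) (simp add: K_def)
      finally show ?thesis .
    next
      case False
      then have n2: "n \<ge> 2" using n by simp
      then have "n \<le> 3 * (n div 2)" by linarith
      then have "real n \<le> real (3 * (n div 2))" by (rule of_nat_mono)
      with n2 have h: "n div 2 \<ge> 1" "real n \<le> 3 * real (n div 2)" by simp_all
      have "expectation_of (random_set L \<mu> n) (family_favard I \<Phi>) \<le> ennreal (C * (c / real (n div 2)))"
        using c(1) by (intro transfer[OF u c(2)[OF h(1)]]) simp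
      also have "\<dots> \<le> ennreal (K * (1 / real n))"
      proof (rule ennreal_leI)
        have "1 / real (n div 2) \<le> 3 / real n" using h n by (simp add: field_simps)
        then have "C * c * (1 / real (n div 2)) \<le> C * c * (3 / real n)" using C c(1) by (intro mult_left_mono) auto
        also have "\<dots> \<le> K * (1 / real n)" using C by (simp add: K_def algebra_simps divide_right_mono)
        finally show "C * (c / real (n div 2)) \<le> K * (1 / real n)" by simp
      qed
      finally show ?thesis .
    qed
    moreover have "K > 0" using C c(1) by (simp add: K_def add_pos_pos)
    ultimately show ?thesis by blast
  qed
  obtain c where c: "c > 0" "\<And>\<mu> n. uniform_selection L \<mu> \<Longrightarrow> n \<ge> 1 \<Longrightarrow>
      expectation_of (random_set L \<mu> n) favard \<le> ennreal (c * (1 + ln (real n)) / real n)"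
    using favard_uniform_bound[OF L] by blast
  have deg: "\<exists>K>0. \<forall>n\<ge>2. expectation_of (random_set L \<mu> n) (family_favard I \<Phi>) \<le> ennreal (K * (ln (real n) / real n))"
    if u: "uniform_selection L \<mu>" for \<mu>
  \<comment> \<open>One factor 3 comes from \<open>n <= 3 * (n div 2)\<close>, the other from
    \<open>1 + ln (n div 2) <= 3 * ln n\<close>, which rests on \<open>ln n >= 1 / 2\<close> for
    \<open>n >= 2\<close>.\<close>
  proof (intro exI[of _ "9 * C * c"] conjI allI impI)
    show "9 * C * c > 0" using C c(1) by simp
    fix n :: nat assume n: "n \<ge> 2"
    then have "n \<le> 3 * (n div 2)" by linarith
    then have "real n \<le> real (3 * (n div 2))" by (rule of_nat_mono)
    with n have h: "n div 2 \<ge> 1" "real n \<le> 3 * real (n div 2)" "real (n div 2) \<le> real n" by simp_all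
    have ln0: "0 \<le> ln (real (n div 2))" using h(1) by simp
    have "expectation_of (random_set L \<mu> n) (family_favard I \<Phi>) \<le> ennreal (C * (c * (1 + ln (real (n div 2))) / real (n div 2)))"
      using c(1) ln0 by (intro transfer[OF u c(2)[OF u h(1)]]) auto
    also have "\<dots> \<le> ennreal (9 * C * c * (ln (real n) / real n))"
    proof (rule ennreal_leI)
      have "ln (1 / 2 :: real) \<le> 1 / 2 - 1" by (rule ln_le_minus_one) simp
      then have "1 / 2 \<le> ln (2 :: real)" by (simp add: ln_div)
      also have "\<dots> \<le> ln (real n)" using n by simp
      finally have "1 / 2 \<le> ln (real n)" .
      moreover have "ln (real (n div 2)) \<le> ln (real n)" using h by (intro ln_mono) auto
      ultimately have "1 + ln (real (n div 2)) \<le> 3 * ln (real n)" by linarith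
      moreover have "1 / real (n div 2) \<le> 3 / real n" using h n by (simp add: field_simps)
      ultimately have "(1 + ln (real (n div 2))) * (1 / real (n div 2)) \<le> 3 * ln (real n) * (3 / real n)"
        using ln0 by (intro mult_mono) auto
      then have "C * c * ((1 + ln (real (n div 2))) * (1 / real (n div 2))) \<le> C * c * (3 * ln (real n) * (3 / real n))"
        using C c(1) by (intro mult_left_mono) auto
      then show "C * (c * (1 + ln (real (n div 2))) / real (n div 2)) \<le> 9 * C * c * (ln (real n) / real n)"
        by (simp add: mult_ac)
    qed
    finally show "expectation_of (random_set L \<mu> n) (family_favard I \<Phi>) \<le> ennreal (9 * C * c * (ln (real n) / real n))" .
  qed
  show ?thesis using C half nondeg deg by blast
qed

end
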